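(* The space $\mathcal{BO}(\mathrm{F})$ of bi-orderings of Thompson's group $\mathrm{F}$ is the disjoint union of the eight-element set $\mathcal{BO}_{Isol}(\mathrm{F})=\{\preceq_{x^-}^+,\preceq_{x^-}^-,\preceq_{x^+}^+,\preceq_{x^+}^-,\preceq_{0,x^-}^{+,-},\preceq_{0,x^-}^{-,+},\preceq_{1,x^+}^{+,-},\preceq_{1,x^+}^{-,+}\}$, each of whose elements is an isolated point of $\mathcal{BO}(\mathrm{F})$, and the four sets $\Lambda_{x^-}^+,\Lambda_{x^-}^-,\Lambda_{x^+}^+,\Lambda_{x^+}^-$, each of which is homeomorphic to the Cantor set.
   Context: $\mathrm{F}$ is the group of orientation-preserving piecewise-linear homeomorphisms $f$ of $[0,1]$ with finitely many break points, all dyadic rationals, whose slopes are integer powers of $2$ and which map the dyadic rationals of $[0,1]$ bijectively onto themselves. Its commutator subgroup is $\mathrm{F}'=\{f\in\mathrm{F}: f'_+(0)=f'_-(1)=1\}$. For nontrivial $f$, $x_f^-$ (resp. $x_f^+$) is the leftmost point $x$ with $f'_+(x)\ne1$ (resp. rightmost point with $f'_-(x)\neq 1$), $f'_\pm$ denoting one-sided derivatives. A bi-ordering is a total order invariant under left and right multiplication; it is determined by its set of positive elements. Define bi-orderings of $\mathrm{F}$ by declaring $f\succ id$ iff: for $\preceq_{x^-}^+$: $f'_+(x_f^-)>1$; for $\preceq_{x^-}^-$: $f'_+(x_f^-)<1$; for $\preceq_{x^+}^+$: $f'_-(x_f^+)<1$; for $\preceq_{x^+}^-$: $f'_-(x_f^+)>1$;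 for $\preceq_{0,x^-}^{+,-}$: either $x_f^-=0$ and $f'_+(0)>1$, or $x_f^-\ne0$ and $f'_+(x_f^-)<1$; for $\preceq_{0,x^-}^{-,+}$: either $x_f^-=0$ and $f'_+(0)<1$, or $x_f^-\neq0$ and $f'_+(x_f^-)>1$; for $\preceq_{1,x^+}^{+,-}$: either $x_f^+=1$ and $f'_-(1)<1$, or $x_f^+\neq1$ and $f'_-(x_f^+)>1$; for $\preceq_{1,x^+}^{-,+}$: either $x_f^+=1$ and $f'_-(1)>1$, or $x_f^+\ne1$ and $f'_-(x_f^+)<1$. For a bi-ordering $\preceq_{\mathbb{Z}^2}$ of $\mathbb{Z}^2$ and $\preceq_{\mathrm{F}'}$ one of the restrictions to $\mathrm{F}'$ of $\preceq_{x^-}^{\pm}$, $\preceq_{x^+}^{\pm}$, define the bi-ordering $\preceq$ of $\mathrm{F}$ by $f\succ id$ iff either $f\notin\mathrm{F}'$ and $(\log_2 f'_+(0),\log_2 f'_-(1))\succ_{\mathbb{Z}^2}(0,0)$, or $f\in\mathrm{F}'$ and $f\succ_{\mathrm{F}'}id$. $\Lambda_{x^-}^+$ (resp. $\Lambda_{x^-}^-,\Lambda_{x^+}^+,\Lambda_{x^+}^-$) is the set of all bi-orderings so obtained with $\preceq_{\mathrm{F}'}$ the restriction of $\preceq_{x^-}^+$ (resp. $\preceq_{x^-}^-,\preceq_{x^+}^+,\preceq_{x^+}^-$), as $\preceq_{\mathbb{Z}^2}$ ranges over all bi-orderings of $\mathbb{Z}^2$. $\mathcal{BO}(\mathrm{F})$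 is topologized as a subspace of $\{0,1\}^{\mathrm{F}}$ by identifying an ordering with the characteristic function of its positive elements. *)

theory Defs
  imports "HOL-Analysis.Analysis"
begin

definition dyadic :: "real \<Rightarrow> bool" where
  "dyadic x \<longleftrightarrow> (\<exists>m::int. \<exists>k::nat. x = of_int m / 2 ^ k)"

text \<open>Elements of F are represented as functions real to real which are the
  identity outside [0,1]; the group operation is composition, the unit is id.\<close>
definition thompsonF :: "(real \<Rightarrow> real) set" where
  "thompsonF = {f.
     (\<forall>x. x \<notin> {0..1} \<longrightarrow> f x = x) \<and>
     f 0 = 0 \<and> f 1 = 1 \<and>
     continuous_on {0..1} f \<and> strict_mono_on {0..1} f \<and> f ` {0..1} = {0..1} \<and>
     (\<exists>xs::real list. length xs \<ge> 2 \<and> sorted_wrt (<) xs \<and> hd xs = 0 \<and> last xs = 1 \<and>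
        (\<forall>a\<in>set xs. dyadic a) \<and>
        (\<forall>i. Suc i < length xs \<longrightarrow>
           (\<exists>k::int. \<exists>c::real. \<forall>x\<in>{xs ! i .. xs ! Suc i}. f x = 2 powi k * x + c))) \<and>
     f ` {x\<in>{0..1}. dyadic x} = {x\<in>{0..1}. dyadic x}}"

definition rderiv :: "(real \<Rightarrow> real) \<Rightarrow> real \<Rightarrow> real" where
  "rderiv f x = (THE d. (f has_real_derivative d) (at_right x))"

definition lderiv :: "(real \<Rightarrow> real) \<Rightarrow> real \<Rightarrow> real" where
  "lderiv f x = (THE d. (f has_real_derivative d) (at_left x))"

definition xminus :: "(real \<Rightarrow> real) \<Rightarrow> real" where
  "xminus f = (LEAST x. 0 \<le> x \<and> x < 1 \<and> rderiv f x \<noteq> 1)"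

definition xplus :: "(real \<Rightarrow> real) \<Rightarrow> real" where
  "xplus f = (GREATEST x. 0 < x \<and> x \<le> 1 \<and> lderiv f x \<noteq> 1)"

definition commF :: "(real \<Rightarrow> real) set" where
  "commF = {f \<in> thompsonF. rderiv f 0 = 1 \<and> lderiv f 1 = 1}"

definition is_biordering :: "'a set \<Rightarrow> ('a \<Rightarrow> 'a \<Rightarrow> 'a) \<Rightarrow> ('a \<Rightarrow> 'a \<Rightarrow> bool) \<Rightarrow> bool" where
  "is_biordering G gop le \<longleftrightarrow>
     (\<forall>x\<in>G. le x x) \<and>
     (\<forall>x\<in>G. \<forall>y\<in>G. le x y \<and> le y x \<longrightarrow> x = y) \<and>
     (\<forall>x\<in>G. \<forall>y\<in>G. \<forall>z\<in>G. le x y \<and> le y z \<longrightarrow> le x z) \<and>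
     (\<forall>x\<in>G. \<forall>y\<in>G. le x y \<or> le y x) \<and>
     (\<forall>x\<in>G. \<forall>y\<in>G. \<forall>z\<in>G. le x y \<longrightarrow> le (gop z x) (gop z y) \<and> le (gop x z) (gop y z))"

definition positive_set :: "'a set \<Rightarrow> 'a \<Rightarrow> ('a \<Rightarrow> 'a \<Rightarrow> bool) \<Rightarrow> 'a set" where
  "positive_set G e le = {x \<in> G. x \<noteq> e \<and> le e x}"

definition BO_F :: "(real \<Rightarrow> real) set set" where
  "BO_F = {positive_set thompsonF id le | le. is_biordering thompsonF (\<circ>) le}"

definition addZ2 :: "int \<times> int \<Rightarrow> int \<times> int \<Rightarrow> int \<times> int" where
  "addZ2 u v = (fst u + fst v, snd u + snd v)"

definition BO_Z2 :: "(int \<times> int) set set" where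
  "BO_Z2 = {positive_set UNIV (0, 0) le | le. is_biordering UNIV addZ2 le}"

definition chi :: "(real \<Rightarrow> real) set \<Rightarrow> (real \<Rightarrow> real) \<Rightarrow> bool" where
  "chi P = restrict (\<lambda>f. f \<in> P) thompsonF"

definition BO_top :: "((real \<Rightarrow> real) \<Rightarrow> bool) topology" where
  "BO_top = subtopology (product_topology (\<lambda>_. discrete_topology (UNIV :: bool set)) thompsonF)
                        (chi ` BO_F)"

definition P_xm_plus where
  "P_xm_plus = {f \<in> thompsonF. f \<noteq> id \<and> rderiv f (xminus f) > 1}"
definition P_xm_minus where
  "P_xm_minus = {f \<in> thompsonF. f \<noteq> id \<and> rderiv f (xminus f) < 1}"
definition P_xp_plus where
  "P_xp_plus = {f \<in> thompsonF. f \<noteq> id \<and> lderiv f (xplus f) < 1}"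
definition P_xp_minus where
  "P_xp_minus = {f \<in> thompsonF. f \<noteq> id \<and> lderiv f (xplus f) > 1}"
definition P_0xm_pm where
  "P_0xm_pm = {f \<in> thompsonF. f \<noteq> id \<and>
     ((xminus f = 0 \<and> rderiv f 0 > 1) \<or> (xminus f \<noteq> 0 \<and> rderiv f (xminus f) < 1))}"
definition P_0xm_mp where
  "P_0xm_mp = {f \<in> thompsonF. f \<noteq> id \<and>
     ((xminus f = 0 \<and> rderiv f 0 < 1) \<or> (xminus f \<noteq> 0 \<and> rderiv f (xminus f) > 1))}"
definition P_1xp_pm where
  "P_1xp_pm = {f \<in> thompsonF. f \<noteq> id \<and>
     ((xplus f = 1 \<and> lderiv f 1 < 1) \<or> (xplus f \<noteq> 1 \<and> lderiv f (xplus f) > 1))}"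
definition P_1xp_mp where
  "P_1xp_mp = {f \<in> thompsonF. f \<noteq> id \<and>
     ((xplus f = 1 \<and> lderiv f 1 > 1) \<or> (xplus f \<noteq> 1 \<and> lderiv f (xplus f) < 1))}"

definition BO_Isol :: "((real \<Rightarrow> real) \<Rightarrow> bool) set" where
  "BO_Isol = chi ` {P_xm_plus, P_xm_minus, P_xp_plus, P_xp_minus,
                    P_0xm_pm, P_0xm_mp, P_1xp_pm, P_1xp_mp}"

definition log2int :: "real \<Rightarrow> int" where
  "log2int d = (THE k::int. d = 2 powi k)"

definition Lambda :: "(real \<Rightarrow> real) set \<Rightarrow> ((real \<Rightarrow> real) \<Rightarrow> bool) set" where
  "Lambda PF = chi ` {{f \<in> thompsonF.
        (f \<notin> commF \<and> (log2int (rderiv f 0), log2int (lderiv f 1)) \<in> Q) \<or>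
        (f \<in> commF \<and> f \<in> PF)} | Q. Q \<in> BO_Z2}"

definition cantor_set :: "real set" where
  "cantor_set = {x. \<exists>d::nat \<Rightarrow> nat. (\<forall>n. d n \<in> {0, 2}) \<and>
                     (\<lambda>n. real (d n) / 3 ^ Suc n) sums x}"

end

(*
  The heart of the matter is that an element f of Thompson's group dominates, in every bi-ordering,
  each g supported strictly inside the hull of the support of f. If f were positive and below such a g,
  then conjugating f by elements u that are supported next to the support of g would make commutators
  of the form [z, v] smaller than all conjugates of g; the elements with this property form
  a normal subgroup, which by perfectness of the derived subgroup contains g itself. Hence the sign of an
  element of F' depends only on the pair (m, n) of exponents of its slopes at the two ends
  of its support. Gluing elements with one common end point shows that the positive pairs are closed
  under enough partial additions to be cut out by the sign of m or by the sign of n: these are the four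
  bi-orderings of F'. On F, either every element outside F' dominates F', which gives a lexicographic
  ordering over F / F' = Z^2; or some element outside F' is bounded by F', and then (for the orderings
  read off at the left end) all elements with slope 1 at 0 are bounded by F' and have the sign that the
  rule for F' gives, so that only the sign of the elements with slope 2 at 0 remains free.
  Finitely many elements separate these eight from all the others, and the bi-orderings of Z^2
  form a closed perfect subset of the Cantor space.
*)
theory Submission
  imports Defs
begin

text \<open>The commutator estimate by itself compares a commutator \<open>[z, v]\<close> with a
  conjugate of g only if v and its image under z lie on one side of the support of that conjugate.
  The side condition disappears because moving the conjugate by some t far to the right and by
  \<open>- t\<close> far to the left gives two upper bounds, and bi-invariance puts one of them at
  or below the conjugate itself. Smallness must refer to all conjugates and all multiples at once;
  otherwise it would not define a normal subgroup. Perfectness enters in the form that a normal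
  subgroup containing every \<open>[z, v]\<close> with v in F' and z arbitrary contains F'; this is
  proved by an explicit factorization. To have room for the constructions, elements are cut out of
  dyadic piecewise linear homeomorphisms of the whole line, which can be glued at dyadic points and
  can carry any dyadic interval onto any other. Slopes enter through integer exponents of one-sided
  germs, which add under composition. Reflection of the interval and inversion of the order reduce
  the classification to orderings read off at the left end with positive sign on F'.\<close>

lemma dyadic_of_int [simp]: "dyadic (of_int m)"
  unfolding dyadic_def by (intro exI[of _ m] exI[of _ 0]) simp

lemma dyadic_numeral [simp]: "dyadic 0" "dyadic 1" "dyadic (numeral w)" "dyadic (of_nat n)"
  using dyadic_of_int[of 0] dyadic_of_int[of 1] dyadic_of_int[of "numeral w"] dyadic_of_int[of "int n"]
  by simp_all

lemma dyadic_add: "dyadic x \<Longrightarrow> dyadic y \<Longrightarrow> dyadic (x + y)"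
proof -
  assume "dyadic x" "dyadic y"
  then obtain m k n l where "x = of_int m / 2 ^ k" "y = of_int n / 2 ^ l"
    unfolding dyadic_def by blast
  then have "x + y = of_int m / 2 ^ k + of_int n / 2 ^ l" by simp
  also have "\<dots> = of_int (m * 2 ^ l + n * 2 ^ k) / 2 ^ (k + l)"
    by (simp add: field_simps power_add)
  finally show "dyadic (x + y)" unfolding dyadic_def by blast
qed

lemma dyadic_mult: "dyadic x \<Longrightarrow> dyadic y \<Longrightarrow> dyadic (x * y)"
proof -
  assume "dyadic x" "dyadic y"
  then obtain m k n l where "x = of_int m / 2 ^ k" "y = of_int n / 2 ^ l"
    unfolding dyadic_def by blast
  then have "x * y = of_int m / 2 ^ k * (of_int n / 2 ^ l)" by simp
  also have "\<dots> = of_int (m * n) / 2 ^ (k + l)"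
    by (simp add: field_simps power_add)
  finally show "dyadic (x * y)" unfolding dyadic_def by blast
qed

lemma dyadic_minus [simp]: "dyadic (- x) \<longleftrightarrow> dyadic x"
  using dyadic_mult[of "- 1" x] dyadic_mult[of "- 1" "- x"] dyadic_of_int[of "- 1"] by auto

lemma dyadic_diff: "dyadic x \<Longrightarrow> dyadic y \<Longrightarrow> dyadic (x - y)"
  using dyadic_add[of x "- y"] by simp

lemma dyadic_powi [simp]: "dyadic (2 powi k)"
proof (cases "k \<ge> 0")
  case True
  then have "(2::real) powi k = of_int (2 ^ nat k)" by (simp add: power_int_def)
  then show ?thesis by (metis dyadic_of_int)
next
  case False
  then have "(2::real) powi k = of_int 1 / 2 ^ nat (- k)" by (simp add: power_int_def field_simps)
  then show ?thesis unfolding dyadic_def by blast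
qed

lemma dyadic_power [simp]: "dyadic (2 ^ n)"
  using dyadic_powi[of "int n"] by simp

lemma dyadic_half_power [simp]: "dyadic (1 / 2 ^ n)"
  using dyadic_powi[of "- int n"] by (simp add: power_int_minus field_simps)

lemma dyadic_powi_mult_iff [simp]: "dyadic (2 powi k * x) \<longleftrightarrow> dyadic x"
proof
  assume "dyadic (2 powi k * x)"
  then have "dyadic (2 powi (- k) * (2 powi k * x))" by (rule dyadic_mult[OF dyadic_powi])
  then show "dyadic x" by (simp add: power_int_minus flip: mult.assoc)
qed (rule dyadic_mult[OF dyadic_powi])

lemma dyadic_add_iff: "dyadic y \<Longrightarrow> dyadic (x + y) \<longleftrightarrow> dyadic x"
  using dyadic_add[of x y] dyadic_diff[of "x + y" y] by auto

lemma dyadic_div2: "dyadic x \<Longrightarrow> dyadic (x / 2)"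
  using dyadic_powi_mult_iff[of "- 1" x] by (simp add: power_int_minus)

lemma exists_half_power_less: "(e::real) > 0 \<Longrightarrow> \<exists>n. 1 / 2 ^ n < e"
  using real_arch_pow_inv[of e "1/2"] by (auto simp: power_one_over)

lemma dyadic_dense:
  assumes "(a::real) < b" shows "\<exists>x. dyadic x \<and> a < x \<and> x < b"
proof -
  obtain n where n: "1 / 2 ^ n < b - a" using exists_half_power_less[of "b - a"] assms by auto
  define m where "m = \<lfloor>a * 2 ^ n\<rfloor> + 1"
  have "of_int m > a * 2 ^ n" "of_int m \<le> a * 2 ^ n + 1" unfolding m_def by linarith+
  then have "of_int m / 2 ^ n > a" "of_int m / 2 ^ n \<le> a + 1 / 2 ^ n" by (simp_all add: field_simps)
  then show ?thesis using n unfolding dyadic_def by (intro exI[of _ "of_int m / 2 ^ n"]) auto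
qed

section \<open>One-sided germs whose slopes are powers of two\<close>

definition rg :: "(real \<Rightarrow> real) \<Rightarrow> real \<Rightarrow> int \<Rightarrow> bool" where
  "rg f x k \<longleftrightarrow> (\<exists>e>0. \<forall>y\<in>{x<..x + e}. f y = f x + 2 powi k * (y - x))"

definition lg :: "(real \<Rightarrow> real) \<Rightarrow> real \<Rightarrow> int \<Rightarrow> bool" where
  "lg f x k \<longleftrightarrow> (\<exists>e>0. \<forall>y\<in>{x - e..<x}. f y = f x + 2 powi k * (y - x))"

text \<open>The reflection \<open>x \<mapsto> 1 - x\<close> exchanges right and left germs without
  changing the exponent. Through it the left-hand versions of uniqueness, composition and inversion
  are read off from the right-hand ones.\<close>

lemma rg_flip: "rg (\<lambda>x. 1 - f (1 - x)) x k \<longleftrightarrow> lg f (1 - x) k"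
proof
  assume "lg f (1 - x) k"
  then obtain e where e: "e > 0" "\<forall>y\<in>{1 - x - e..<1 - x}. f y = f (1 - x) + 2 powi k * (y - (1 - x))"
    unfolding lg_def by blast
  have "1 - f (1 - y) = 1 - f (1 - x) + 2 powi k * (y - x)" if "y \<in> {x<..x + e}" for y
  proof -
    have "f (1 - y) = f (1 - x) + 2 powi k * (1 - y - (1 - x))" using that by (intro e(2)[rule_format]) simp
    then show ?thesis by (simp only:) (simp add: algebra_simps)
  qed
  then show "rg (\<lambda>x. 1 - f (1 - x)) x k" unfolding rg_def using e(1) by (intro exI[of _ e] conjI ballI)
next
  assume "rg (\<lambda>x. 1 - f (1 - x)) x k"
  then obtain e where e: "e > 0" "\<forall>y\<in>{x<..x + e}. 1 - f (1 - y) = 1 - f (1 - x) + 2 powi k * (y - x)"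
    unfolding rg_def by blast
  have "f y = f (1 - x) + 2 powi k * (y - (1 - x))" if "y \<in> {1 - x - e..<1 - x}" for y
  proof -
    have "1 - f (1 - (1 - y)) = 1 - f (1 - x) + 2 powi k * (1 - y - x)" using that by (intro e(2)[rule_format]) simp
    then show ?thesis by (simp add: algebra_simps)
  qed
  then show "lg f (1 - x) k" unfolding lg_def using e(1) by (intro exI[of _ e] conjI ballI)
qed

lemma lg_flip: "lg (\<lambda>x. 1 - f (1 - x)) x k \<longleftrightarrow> rg f (1 - x) k"
  using rg_flip[of "\<lambda>x. 1 - f (1 - x)" "1 - x" k] by simp

lemma lg_iff_rg: "lg f x k \<longleftrightarrow> rg (\<lambda>y. 1 - f (1 - y)) (1 - x) k"
  by (simp add: rg_flip)

lemma rgE: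
  assumes "rg f x k" "b > x"
  obtains c where "x < c" "c < b" "\<And>y. x < y \<Longrightarrow> y \<le> c \<Longrightarrow> f y = f x + 2 powi k * (y - x)"
proof -
  obtain e where e: "e > 0" "\<forall>y\<in>{x<..x + e}. f y = f x + 2 powi k * (y - x)"
    using assms unfolding rg_def by blast
  define d where "d = min e ((b - x) / 2)"
  have "0 < d" "d \<le> e" "d < b - x" using e(1) assms(2) by (auto simp: d_def min_def)
  then show thesis by (intro that[of "x + d"]) (use e(2) in auto)
qed

lemma lgE:
  assumes "lg f x k" "b < x"
  obtains c where "b < c" "c < x" "\<And>y. c \<le> y \<Longrightarrow> y < x \<Longrightarrow> f y = f x + 2 powi k * (y - x)"
proof -
  obtain e where e: "e > 0" "\<forall>y\<in>{x - e..<x}. f y = f x + 2 powi k * (y - x)"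
    using assms unfolding lg_def by blast
  define d where "d = min e ((x - b) / 2)"
  have "0 < d" "d \<le> e" "d < x - b" using e(1) assms(2) by (auto simp: d_def min_def)
  then show thesis by (intro that[of "x - d"]) (use e(2) in auto)
qed

lemma rgI:
  assumes "x < c" "\<And>y. x < y \<Longrightarrow> y \<le> c \<Longrightarrow> f y = f x + 2 powi k * (y - x)"
  shows "rg f x k"
  unfolding rg_def by (rule exI[of _ "c - x"]) (use assms in auto)

lemma lgI:
  assumes "c < x" "\<And>y. c \<le> y \<Longrightarrow> y < x \<Longrightarrow> f y = f x + 2 powi k * (y - x)"
  shows "lg f x k"
  unfolding lg_def by (rule exI[of _ "x - c"]) (use assms in auto)

lemma powi2_less [simp]: "(2::real) powi k < 2 powi l \<longleftrightarrow> k < l"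
proof
  assume "(2::real) powi k < 2 powi l"
  then show "k < l" using power_int_increasing[of l k "2::real"] by force
qed (simp add: power_int_strict_increasing)

lemma powi2_inject [simp]: "(2::real) powi k = 2 powi l \<longleftrightarrow> k = l"
  by (metis linorder_neqE order_less_irrefl powi2_less)

lemma powi2_1_cmp [simp]:
  "(2::real) powi k > 1 \<longleftrightarrow> k > 0" "(2::real) powi k < 1 \<longleftrightarrow> k < 0"
  "(2::real) powi k = 1 \<longleftrightarrow> k = 0"
  using powi2_less[of 0 k] powi2_less[of k 0] powi2_inject[of k 0] by (simp_all del: powi2_less powi2_inject)

lemma rg_cong:
  assumes "x < c" "\<And>y. x \<le> y \<Longrightarrow> y \<le> c \<Longrightarrow> f y = g y"
  shows "rg f x k \<longleftrightarrow> rg g x k"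
proof -
  have "rg g x k" if "rg f x k" "\<And>y. x \<le> y \<Longrightarrow> y \<le> c \<Longrightarrow> f y = g y" for f g
    using that assms(1) by (elim rgE[of f x k c]) (auto intro!: rgI[where f = g])
  then show ?thesis using assms(2) by (metis (no_types, lifting))
qed

lemma lg_cong: "c < x \<Longrightarrow> (\<And>y. c \<le> y \<Longrightarrow> y \<le> x \<Longrightarrow> f y = g y) \<Longrightarrow> lg f x k \<longleftrightarrow> lg g x k"
  unfolding lg_iff_rg by (rule rg_cong[of "1 - x" "1 - c"]) auto

lemma rg_unique: "rg f x k \<Longrightarrow> rg f x l \<Longrightarrow> k = l"
proof -
  assume "rg f x k" "rg f x l"
  then obtain d e where "d > x" "e > x"
    "\<And>y. x < y \<Longrightarrow> y \<le> d \<Longrightarrow> f y = f x + 2 powi k * (y - x)"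
    "\<And>y. x < y \<Longrightarrow> y \<le> e \<Longrightarrow> f y = f x + 2 powi l * (y - x)"
    using rgE[of f x _ "x + 1"] by (metis less_add_one)
  from this(3,4)[of "min d e"] this(1,2) show "k = l" by auto
qed

lemma lg_unique: "lg f x k \<Longrightarrow> lg f x l \<Longrightarrow> k = l"
  unfolding lg_iff_rg by (rule rg_unique)

lemma rg_comp:
  assumes f: "rg f (g x) k" and g: "rg g x l"
  shows "rg (f \<circ> g) x (k + l)"
proof -
  obtain c where c: "g x < c" "\<And>y. g x < y \<Longrightarrow> y \<le> c \<Longrightarrow> f y = f (g x) + 2 powi k * (y - g x)"
    using rgE[OF f, of "g x + 1"] by auto
  \<comment> \<open>The bound on \<open>d\<close> keeps \<open>g y\<close> inside the interval up to
    \<open>c\<close> on which \<open>f\<close> is affine.\<close>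
  obtain d where d: "x < d" "d < x + (c - g x) / 2 powi l"
    "\<And>y. x < y \<Longrightarrow> y \<le> d \<Longrightarrow> g y = g x + 2 powi l * (y - x)"
    using rgE[OF g, of "x + (c - g x) / 2 powi l"] c by auto
  show ?thesis
  proof (rule rgI[OF d(1)])
    fix y assume y: "x < y" "y \<le> d"
    have "y - x < (c - g x) / 2 powi l" using y d(2) by linarith
    then have "2 powi l * (y - x) < c - g x" by (simp add: field_simps)
    then have "g y \<le> c" "g x < g y" using d(3)[OF y] y by auto
    then show "(f \<circ> g) y = (f \<circ> g) x + 2 powi (k + l) * (y - x)"
      using c(2)[of "g y"] d(3)[OF y] by (simp add: power_int_add)
  qed
qed

lemma lg_comp: "lg f (g x) k \<Longrightarrow> lg g x l \<Longrightarrow> lg (f \<circ> g) x (k + l)"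
  using rg_comp[of "\<lambda>y. 1 - f (1 - y)" "\<lambda>y. 1 - g (1 - y)" "1 - x" k l] by (simp add: lg_iff_rg o_def)

lemma rg_rderiv:
  assumes "rg f x k" shows "rderiv f x = 2 powi k"
proof -
  obtain c where c: "x < c" "\<And>y. x < y \<Longrightarrow> y \<le> c \<Longrightarrow> f y = f x + 2 powi k * (y - x)"
    using rgE[OF assms, of "x + 1"] by auto
  have "((\<lambda>y. f x + 2 powi k * (y - x)) has_real_derivative 2 powi k) (at_right x)"
    by (auto intro!: derivative_eq_intros)
  moreover have "eventually (\<lambda>y. f y = f x + 2 powi k * (y - x)) (at_right x)"
    using c by (auto simp: eventually_at_right_field)
  ultimately have D: "(f has_real_derivative 2 powi k) (at_right x)"
    by (subst has_field_derivative_cong_eventually) auto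
  show ?thesis unfolding rderiv_def
    by (rule the_equality) (use D in \<open>auto intro: has_field_derivative_unique\<close>)
qed

lemma lg_lderiv:
  assumes "lg f x k" shows "lderiv f x = 2 powi k"
proof -
  obtain c where c: "c < x" "\<And>y. c \<le> y \<Longrightarrow> y < x \<Longrightarrow> f y = f x + 2 powi k * (y - x)"
    using lgE[OF assms, of "x - 1"] by auto
  have "((\<lambda>y. f x + 2 powi k * (y - x)) has_real_derivative 2 powi k) (at_left x)"
    by (auto intro!: derivative_eq_intros)
  moreover have "eventually (\<lambda>y. f y = f x + 2 powi k * (y - x)) (at_left x)"
    using c by (auto simp: eventually_at_left_field)
  ultimately have D: "(f has_real_derivative 2 powi k) (at_left x)"
    by (subst has_field_derivative_cong_eventually) auto
  show ?thesis unfolding lderiv_def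
    by (rule the_equality) (use D in \<open>auto intro: has_field_derivative_unique\<close>)
qed

text \<open>Break points are described locally: both germs exist everywhere and may differ only at
  dyadic points. This form passes to compositions, inverses and gluings without any handling of
  lists, and it admits affine maps as building blocks. Local finiteness of the breaks is a
  consequence.\<close>

definition pl2 :: "(real \<Rightarrow> real) set" where
  "pl2 = {f. strict_mono f \<and> surj f \<and> (\<forall>x. dyadic (f x) = dyadic x) \<and>
     (\<forall>x. \<exists>k l. rg f x k \<and> lg f x l \<and> (k \<noteq> l \<longrightarrow> dyadic x))}"

lemma pl2D:
  assumes "f \<in> pl2"
  shows "strict_mono f" "surj f" "inj f" "bij f" "dyadic (f x) = dyadic x"
    "f x < f y \<longleftrightarrow> x < y" "f x \<le> f y \<longleftrightarrow> x \<le> y" "f x = f y \<longleftrightarrow> x = y"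
  using assms unfolding pl2_def bij_def
  by (auto dest: strict_mono_imp_inj_on simp: strict_mono_less strict_mono_less_eq inj_eq)

lemma pl2_germs:
  assumes "f \<in> pl2" obtains k l where "rg f x k" "lg f x l" "k \<noteq> l \<longrightarrow> dyadic x"
  using assms unfolding pl2_def by blast

lemma pl2_inv_simps:
  assumes "f \<in> pl2" shows "inv f (f x) = x" "f (inv f x) = x"
  using pl2D(2,3)[OF assms] by (auto simp: surj_f_inv_f)

lemma pl2_continuous: "f \<in> pl2 \<Longrightarrow> continuous_on A f"
  by (rule continuous_on_subset[OF continuous_onI_mono[of f UNIV]]) (auto simp: pl2D)

lemma rg_affine [simp]: "rg (\<lambda>x. 2 powi k * x + c) x l \<longleftrightarrow> l = k"
proof -
  have "rg (\<lambda>x. 2 powi k * x + c) x k" by (rule rgI[of x "x + 1"]) (simp_all add: algebra_simps)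
  then show ?thesis using rg_unique by blast
qed

lemma lg_affine [simp]: "lg (\<lambda>x. 2 powi k * x + c) x l \<longleftrightarrow> l = k"
proof -
  have "lg (\<lambda>x. 2 powi k * x + c) x k" by (rule lgI[of "x - 1" x]) (simp_all add: algebra_simps)
  then show ?thesis using lg_unique by blast
qed

lemma rg_id [simp]: "rg id x l \<longleftrightarrow> l = 0" and lg_id [simp]: "lg id x l \<longleftrightarrow> l = 0"
  using rg_affine[of 0 0 x l] lg_affine[of 0 0 x l] by (simp_all add: id_def)

lemma pl2_affine: "dyadic c \<Longrightarrow> (\<lambda>x. 2 powi k * x + c) \<in> pl2"
proof -
  assume c: "dyadic c"
  have "surj (\<lambda>x::real. 2 powi k * x + c)"
    by (rule surjI[of _ "\<lambda>y. (y - c) / 2 powi k"]) simp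
  then show ?thesis using c by (auto simp: pl2_def strict_mono_def dyadic_add_iff)
qed

lemma pl2_id: "id \<in> pl2"
  using pl2_affine[of 0 0] by (simp add: id_def)

lemma pl2_comp:
  assumes f: "f \<in> pl2" and g: "g \<in> pl2" shows "f \<circ> g \<in> pl2"
proof -
  have "\<exists>k l. rg (f \<circ> g) x k \<and> lg (f \<circ> g) x l \<and> (k \<noteq> l \<longrightarrow> dyadic x)" for x
  proof -
    obtain k l where a: "rg f (g x) k" "lg f (g x) l" "k \<noteq> l \<longrightarrow> dyadic (g x)"
      using pl2_germs[OF f] .
    obtain k' l' where b: "rg g x k'" "lg g x l'" "k' \<noteq> l' \<longrightarrow> dyadic x" using pl2_germs[OF g] .
    show ?thesis
      by (rule exI[of _ "k + k'"], rule exI[of _ "l + l'"])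
        (use a b rg_comp[of f g] lg_comp[of f g] pl2D(5)[OF g] in auto)
  qed
  moreover have "surj (f \<circ> g)" using pl2D(2) f g by (intro comp_surj) auto
  ultimately show ?thesis using f g by (auto simp: pl2_def strict_mono_def)
qed

lemma rg_inv:
  assumes f: "f \<in> pl2" and r: "rg f x k" shows "rg (inv f) (f x) (- k)"
proof -
  obtain c where c: "x < c" "\<And>y. x < y \<Longrightarrow> y \<le> c \<Longrightarrow> f y = f x + 2 powi k * (y - x)"
    using rgE[OF r, of "x + 1"] by auto
  show ?thesis
  proof (rule rgI[of "f x" "f c"])
    fix y assume "f x < y" "y \<le> f c"
    moreover obtain z where z: "y = f z" using pl2D(2)[OF f] by (metis surjD)
    ultimately have "x < z" "z \<le> c" using pl2D(6,7)[OF f] by auto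
    then show "inv f y = inv f (f x) + 2 powi - k * (y - f x)"
      using c(2)[of z] unfolding z pl2_inv_simps[OF f] by (simp add: power_int_minus flip: mult.assoc)
  qed (use c(1) pl2D(6)[OF f] in auto)
qed

lemma pl2_flip:
  assumes f: "f \<in> pl2" shows "(\<lambda>x. 1 - f (1 - x)) \<in> pl2" (is "?h \<in> _")
proof -
  have d1: "dyadic (1 - y) = dyadic y" for y
    using dyadic_diff[of 1 y] dyadic_diff[of 1 "1 - y"] by auto
  have "strict_mono ?h" using pl2D(6)[OF f] by (auto simp: strict_mono_def)
  moreover have "surj ?h" by (rule surjI[of _ "\<lambda>y. 1 - inv f (1 - y)"]) (simp add: pl2_inv_simps[OF f])
  moreover have "dyadic (?h x) = dyadic x" for x using pl2D(5)[OF f] d1 by simp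
  moreover have "\<exists>k l. rg ?h x k \<and> lg ?h x l \<and> (k \<noteq> l \<longrightarrow> dyadic x)" for x
    unfolding rg_flip lg_flip using pl2_germs[OF f, of "1 - x"] d1 by metis
  ultimately show ?thesis by (auto simp: pl2_def)
qed

lemma lg_inv:
  assumes f: "f \<in> pl2" and l: "lg f x k" shows "lg (inv f) (f x) (- k)"
proof -
  have "inv (\<lambda>y. 1 - f (1 - y)) = (\<lambda>y. 1 - inv f (1 - y))"
    by (rule inv_equality) (simp_all add: pl2_inv_simps[OF f])
  then show ?thesis using rg_inv[OF pl2_flip[OF f], of "1 - x" k] l by (simp add: lg_iff_rg)
qed

lemma pl2_inv:
  assumes f: "f \<in> pl2" shows "inv f \<in> pl2"
proof -
  have ff: "f (inv f x) = x" for x by (rule pl2_inv_simps[OF f])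
  have "strict_mono (inv f)"
    unfolding strict_mono_def using pl2D(6)[OF f] ff by (metis (full_types))
  moreover have "surj (inv f)" using pl2D(3)[OF f] by (rule inj_imp_surj_inv)
  moreover have "dyadic (inv f x) = dyadic x" for x using pl2D(5)[OF f, of "inv f x"] ff by simp
  moreover have "\<exists>k l. rg (inv f) x k \<and> lg (inv f) x l \<and> (k \<noteq> l \<longrightarrow> dyadic x)" for x
  proof -
    obtain k l where a: "rg f (inv f x) k" "lg f (inv f x) l" "k \<noteq> l \<longrightarrow> dyadic (inv f x)"
      using pl2_germs[OF f] .
    show ?thesis
      by (rule exI[of _ "- k"], rule exI[of _ "- l"])
        (use a rg_inv[OF f a(1)] lg_inv[OF f a(2)] pl2D(5)[OF f, of "inv f x"] ff in auto)
  qed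
  ultimately show ?thesis by (auto simp: pl2_def)
qed

lemma pl2_glue:
  assumes f: "f \<in> pl2" and g: "g \<in> pl2" and c: "dyadic c" and fg: "f c = g c"
  shows "(\<lambda>x. if x \<le> c then f x else g x) \<in> pl2" (is "?h \<in> _")
proof -
  have "strict_mono ?h"
  proof (rule strict_monoI)
    fix x y :: real assume xy: "x < y"
    show "?h x < ?h y"
      using pl2D(6)[OF f, of x y] pl2D(6)[OF g, of x y] pl2D(7)[OF f, of x c] pl2D(6)[OF g, of c y]
        fg xy by (auto simp: not_le)
  qed
  moreover have "surj ?h"
  proof (rule surjI)
    fix y show "?h (if y \<le> f c then inv f y else inv g y) = y"
      using pl2D(7)[OF f, of "inv f y" c] pl2D(7)[OF g, of "inv g y" c] fg
      by (auto simp: pl2_inv_simps[OF f] pl2_inv_simps[OF g])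
  qed
  moreover have "dyadic (?h x) = dyadic x" for x using pl2D(5)[OF f] pl2D(5)[OF g] by auto
  moreover have "\<exists>k l. rg ?h x k \<and> lg ?h x l \<and> (k \<noteq> l \<longrightarrow> dyadic x)" for x
  proof -
    obtain k l where a: "rg f x k" "lg f x l" "k \<noteq> l \<longrightarrow> dyadic x" using pl2_germs[OF f] .
    obtain k' l' where b: "rg g x k'" "lg g x l'" "k' \<noteq> l' \<longrightarrow> dyadic x" using pl2_germs[OF g] .
    consider "x < c" | "x = c" | "x > c" by linarith
    then show ?thesis
    proof cases
      case 1
      have "rg ?h x k" using a(1) 1 by (subst rg_cong[of x c _ f]) auto
      moreover have "lg ?h x l" using a(2) 1 by (subst lg_cong[of "x - 1" x _ f]) auto
      ultimately show ?thesis using a by blast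
    next
      case 2
      have "rg ?h x k'" using b(1) 2 fg by (subst rg_cong[of x "c + 1" _ g]) auto
      moreover have "lg ?h x l" using a(2) 2 by (subst lg_cong[of "x - 1" x _ f]) auto
      ultimately show ?thesis using 2 c by blast
    next
      case 3
      have "rg ?h x k'" using b(1) 3 by (subst rg_cong[of x "x + 1" _ g]) auto
      moreover have "lg ?h x l'" using b(2) 3 fg by (subst lg_cong[of c x _ g]) auto
      ultimately show ?thesis using b by blast
    qed
  qed
  ultimately show ?thesis by (auto simp: pl2_def)
qed

section \<open>Carrying dyadic intervals onto each other\<close>

lemma pl2_stretch_unit:
  assumes "m \<ge> 1"
  shows "\<exists>h\<in>pl2. h 0 = 0 \<and> h (real m) = real (Suc m)"
proof (rule bexI[of _ "\<lambda>x. if x \<le> 1 then 2 powi 1 * x + 0 else 2 powi 0 * x + 1"])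
  show "(\<lambda>x::real. if x \<le> 1 then 2 powi 1 * x + 0 else 2 powi 0 * x + 1) \<in> pl2"
    by (rule pl2_glue[of "\<lambda>x. 2 powi 1 * x + 0" "\<lambda>x. 2 powi 0 * x + 1" 1, OF pl2_affine pl2_affine])
      simp_all
qed (use assms in auto)

text \<open>Each unit stretch doubles \<open>[0,1]\<close> and translates the rest, so it increases
  the image of the right end by 1.\<close>

lemma pl2_stretch:
  assumes "m \<ge> 1" "m \<le> n"
  shows "\<exists>h\<in>pl2. h 0 = 0 \<and> h (real m) = real n"
  using assms(2)
proof (induction n rule: dec_induct)
  case base then show ?case by (rule bexI[OF _ pl2_id]) simp
next
  case (step n)
  then obtain h where h: "h \<in> pl2" "h 0 = 0" "h (real m) = real n" by blast
  obtain h' where h': "h' \<in> pl2" "h' 0 = 0" "h' (real n) = real (Suc n)"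
    using pl2_stretch_unit[of n] assms(1) step.hyps by auto
  show ?case by (rule bexI[OF _ pl2_comp[OF h'(1) h(1)]]) (use h h' in auto)
qed

text \<open>Scaling by powers of two turns both lengths into positive integers \<open>m'\<close> and
  \<open>n'\<close>; these are matched by unit stretches or, if \<open>n' < m'\<close>, by the
  inverse of such a map.\<close>

lemma pl2_interval:
  assumes "dyadic a" "dyadic b" "a < b" "dyadic c" "dyadic d" "c < d"
  shows "\<exists>h\<in>pl2. h a = c \<and> h b = d"
proof -
  obtain m k where m: "b - a = of_int m / 2 ^ k" using dyadic_diff[OF assms(2,1)] unfolding dyadic_def by blast
  obtain n l where n: "d - c = of_int n / 2 ^ l" using dyadic_diff[OF assms(5,4)] unfolding dyadic_def by blast
  have "real_of_int m / 2 ^ k > 0" "real_of_int n / 2 ^ l > 0" using m n assms(3,6) by linarith+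
  then have "m > 0" "n > 0" by (simp_all add: zero_less_divide_iff)
  define m' n' where "m' = nat m" "n' = nat n"
  with \<open>m > 0\<close> \<open>n > 0\<close> have mn: "b - a = real m' / 2 ^ k" "d - c = real n' / 2 ^ l" "m' \<ge> 1" "n' \<ge> 1"
    using m n by auto
  obtain h where h: "h \<in> pl2" "h 0 = 0" "h (real m') = real n'"
  proof (cases "m' \<le> n'")
    case True then show ?thesis using pl2_stretch[of m' n'] mn that by blast
  next
    case False
    then obtain h where h: "h \<in> pl2" "h 0 = 0" "h (real n') = real m'"
      using pl2_stretch[of n' m'] mn by auto
    show ?thesis by (rule that[OF pl2_inv[OF h(1)]]) (use h pl2_inv_simps[OF h(1)] in metis)+
  qed
  define p where "p = (\<lambda>x::real. 2 powi int k * x + - (2 powi int k * a))"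
  define q where "q = (\<lambda>x::real. 2 powi (- int l) * x + c)"
  have "p \<in> pl2" unfolding p_def by (rule pl2_affine) (simp add: assms del: power_int_of_nat)
  moreover have "q \<in> pl2" unfolding q_def by (rule pl2_affine) (simp add: assms)
  ultimately have "q \<circ> (h \<circ> p) \<in> pl2" using h(1) by (intro pl2_comp)
  moreover have "p a = 0" "p b = real m'" using mn(1) by (auto simp: p_def field_simps)
  moreover have "q 0 = c" "q (real n') = d" using mn(2) by (auto simp: q_def power_int_minus field_simps)
  ultimately show ?thesis using h by (intro bexI[of _ "q \<circ> (h \<circ> p)"]) auto
qed

text \<open>The basic construction: a map prescribed on the left and one prescribed on the right can
  be joined across \<open>[a,b]\<close>, because this dyadic interval can be carried onto
  \<open>[f a, g b]\<close>.\<close>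

lemma pl2_connect:
  assumes f: "f \<in> pl2" and g: "g \<in> pl2" and ab: "dyadic a" "dyadic b" "a < b" "f a < g b"
  obtains t where "t \<in> pl2" "\<And>x. x \<le> a \<Longrightarrow> t x = f x" "\<And>x. b \<le> x \<Longrightarrow> t x = g x"
proof -
  obtain h where h: "h \<in> pl2" "h a = f a" "h b = g b"
    using pl2_interval[of a b "f a" "g b"] ab pl2D(5)[OF f] pl2D(5)[OF g] by auto
  define u where "u = (\<lambda>x. if x \<le> a then f x else h x)"
  have u: "u \<in> pl2" unfolding u_def by (rule pl2_glue) (use f h ab in auto)
  have "(\<lambda>x. if x \<le> b then u x else g x) \<in> pl2"
    by (rule pl2_glue) (use u g h ab in \<open>auto simp: u_def\<close>)
  then show thesis by (rule that) (use ab h in \<open>auto simp: u_def\<close>)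
qed

section \<open>Local finiteness of the breaks\<close>

lemma germs_agree_if_affine:
  assumes "a < x" "x < b" "\<And>y. a < y \<Longrightarrow> y < b \<Longrightarrow> f y = c + 2 powi k * y" "rg f x r" "lg f x l"
  shows "r = k" "l = k"
proof -
  have "rg (\<lambda>y. 2 powi k * y + c) x r"
    using assms by (subst rg_cong[of x "(x + b) / 2" _ f]) (auto simp: field_simps)
  then show "r = k" by simp
  have "lg (\<lambda>y. 2 powi k * y + c) x l"
    using assms by (subst lg_cong[of "(a + x) / 2" x _ f]) (auto simp: field_simps)
  then show "l = k" by simp
qed

definition breaks :: "(real \<Rightarrow> real) \<Rightarrow> real set" where
  "breaks f = {x. \<exists>k l. rg f x k \<and> lg f x l \<and> k \<noteq> l}"

lemma breaks_dyadic: "f \<in> pl2 \<Longrightarrow> x \<in> breaks f \<Longrightarrow> dyadic x"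
proof -
  assume f: "f \<in> pl2" and "x \<in> breaks f"
  then obtain r s where rs: "rg f x r" "lg f x s" "r \<noteq> s" unfolding breaks_def by blast
  obtain k l where "rg f x k" "lg f x l" "k \<noteq> l \<longrightarrow> dyadic x" using pl2_germs[OF f] .
  moreover from this have "k = r" "l = s" using rs rg_unique[of f x k r] lg_unique[of f x l s] by simp_all
  ultimately show "dyadic x" using rs(3) by blast
qed

text \<open>Infinitely many breaks would accumulate at some \<open>x\<close> by compactness. But
  \<open>f\<close> is affine on a one-sided neighbourhood on either side of \<open>x\<close>, which
  excludes breaks near \<open>x\<close> other than \<open>x\<close> itself.\<close>

lemma finite_breaks:
  assumes f: "f \<in> pl2" shows "finite (breaks f \<inter> {a..b})"
proof (rule ccontr)
  assume "infinite (breaks f \<inter> {a..b})"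
  then obtain x where x: "x islimpt (breaks f \<inter> {a..b})"
    using compact_Icc[of a b] unfolding compact_eq_Bolzano_Weierstrass by (meson inf_le2)
  obtain k l where kl: "rg f x k" "lg f x l" using pl2_germs[OF f] .
  obtain c where c: "x < c" "\<And>y. x < y \<Longrightarrow> y \<le> c \<Longrightarrow> f y = f x + 2 powi k * (y - x)"
    using rgE[OF kl(1) less_add_one] by metis
  obtain d where d: "d < x" "\<And>y. d \<le> y \<Longrightarrow> y < x \<Longrightarrow> f y = f x + 2 powi l * (y - x)"
    using lgE[OF kl(2), of "x - 1"] by (metis less_add_one diff_less_eq)
  obtain y where y: "y \<in> breaks f" "y \<in> {d<..<c}" "y \<noteq> x"
    using x c(1) d(1) unfolding islimpt_def by (metis IntE greaterThanLessThan_iff open_greaterThanLessThan)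
  from y(1) obtain r s where rs: "rg f y r" "lg f y s" "r \<noteq> s" unfolding breaks_def by blast
  show False
  proof (cases "x < y")
    case True
    have "r = k" "s = k"
      by (rule germs_agree_if_affine[OF True _ _ rs(1,2), of c "f x - 2 powi k * x"],
          use y c(2) in \<open>auto simp: algebra_simps\<close>)+
    then show False using rs by simp
  next
    case False
    then have "y < x" using y by simp
    have "r = l" "s = l"
      by (rule germs_agree_if_affine[OF _ \<open>y < x\<close> _ rs(1,2), of d "f x - 2 powi l * x"],
          use y d(2) in \<open>auto simp: algebra_simps\<close>)+
    then show False using rs by simp
  qed
qed

text \<open>Continuation argument: \<open>s\<close> is the supremum of the points up to which the
  affine formula starting at \<open>a\<close> holds. Without a break at \<open>s\<close> the formula
  would continue past \<open>s\<close> as long as \<open>s < b\<close>.\<close>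

lemma pl2_affine_on_interval:
  assumes f: "f \<in> pl2" and ab: "a < b" and no: "\<And>x. a < x \<Longrightarrow> x < b \<Longrightarrow> x \<notin> breaks f"
  shows "\<exists>k c. \<forall>x\<in>{a..b}. f x = 2 powi k * x + c"
proof -
  obtain k where k: "rg f a k" using pl2_germs[OF f, of a] by metis
  define T where "T = {t\<in>{a..b}. \<forall>y\<in>{a..t}. f y = f a + 2 powi k * (y - a)}"
  define s where "s = Sup T"
  have aT: "a \<in> T" using ab by (auto simp: T_def)
  have bdd: "bdd_above T" unfolding T_def by (rule bdd_aboveI[of _ b]) auto
  have as: "a \<le> s" unfolding s_def by (rule cSup_upper[OF aT bdd])
  have sb: "s \<le> b" unfolding s_def by (rule cSup_least) (use aT in blast, auto simp only: T_def atLeastAtMost_iff mem_Collect_eq)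
  have below: "f y = f a + 2 powi k * (y - a)" if "a \<le> y" "y < s" for y
  proof -
    obtain t where "t \<in> T" "y < t" using less_cSupD[of T y] aT \<open>y < s\<close> unfolding s_def by blast
    then have "\<forall>y\<in>{a..t}. f y = f a + 2 powi k * (y - a)" unfolding T_def by blast
    then show ?thesis by (rule bspec) (use that \<open>y < t\<close> in auto)
  qed
  obtain r l where rl: "rg f s r" "lg f s l" using pl2_germs[OF f] .
  have at: "f s = f a + 2 powi k * (s - a) \<and> (s < b \<longrightarrow> r = k)"
  proof (cases "a = s")
    case True then show ?thesis using k rl rg_unique by auto
  next
    case False
    then have "a < s" using as by simp
    obtain c where c: "a < c" "c < s" "\<And>y. c \<le> y \<Longrightarrow> y < s \<Longrightarrow> f y = f s + 2 powi l * (y - s)"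
      using lgE[OF rl(2) \<open>a < s\<close>] by metis
    define m where "m = (c + s) / 2"
    have m: "c < m" "m < s" using c(2) by (auto simp: m_def)
    \<comment> \<open>The formula from the left and the left germ at \<open>s\<close> agree at the
      two points \<open>c\<close> and \<open>m\<close>; hence the slopes coincide, and then so does
      the value at \<open>s\<close>.\<close>
    have e1: "f a + 2 powi k * (c - a) = f s + 2 powi l * (c - s)" using below[of c] c(3)[of c] c(1,2) by simp
    have e2: "f a + 2 powi k * (m - a) = f s + 2 powi l * (m - s)" using below[of m] c(3)[of m] c(1) m by simp
    have "2 powi k * (m - c) = 2 powi l * (m - c)" using e1 e2 by (simp add: algebra_simps)
    then have lk: "l = k" using m by simp
    then have "f s = f a + 2 powi k * (s - a)" using e1 by (simp add: algebra_simps)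
    moreover have "r = k" if "s < b"
      using no[OF \<open>a < s\<close> that] rl lk unfolding breaks_def by blast
    ultimately show ?thesis by blast
  qed
  have "s = b"
  proof (rule ccontr)
    assume "s \<noteq> b"
    then have "s < b" using sb by simp
    obtain c where c: "s < c" "c < b" "\<And>y. s < y \<Longrightarrow> y \<le> c \<Longrightarrow> f y = f s + 2 powi r * (y - s)"
      using rgE[OF rl(1) \<open>s < b\<close>] by metis
    have H: "f y = f a + 2 powi k * (y - a)" if "a \<le> y" "y \<le> c" for y
    proof (cases "y < s")
      case True then show ?thesis using below that by blast
    next
      case False
      have e: "f s = f a + 2 powi k * (s - a)" "r = k" using at \<open>s < b\<close> by auto
      show ?thesis
      proof (cases "y = s")
        case False
        then have "f y = f s + 2 powi k * (y - s)" using c(3)[of y] e(2) \<open>\<not> y < s\<close> that by simp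
        also have "\<dots> = f a + 2 powi k * (y - a)" unfolding e(1) by (simp only: algebra_simps)
        finally show ?thesis .
      qed (use e in blast)
    qed
    have "c \<in> T" unfolding T_def
      by (intro CollectI conjI ballI H) (use as c(1,2) in simp_all)
    then have "c \<le> s" unfolding s_def using bdd by (rule cSup_upper)
    then show False using c by simp
  qed
  have "f y = 2 powi k * y + (f a - 2 powi k * a)" if "a \<le> y" "y \<le> b" for y
  proof -
    have "f y = f a + 2 powi k * (y - a)"
      using below[of y] at that \<open>s = b\<close> by (cases "y = s") (simp only:, linarith)
    also have "\<dots> = 2 powi k * y + (f a - 2 powi k * a)" by (simp add: algebra_simps)
    finally show ?thesis .
  qed
  then show ?thesis by (meson atLeastAtMost_iff)
qed

lemma finite_dyadic_common_denominator:
  assumes "finite B" "\<And>x. x \<in> B \<Longrightarrow> dyadic x"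
  shows "\<exists>N. \<forall>n\<ge>N. \<forall>x\<in>B. \<exists>j::int. x = of_int j / 2 ^ n"
  using assms
proof (induction B rule: finite_induct)
  case empty then show ?case by simp
next
  case (insert x B)
  then obtain N where N: "\<forall>n\<ge>N. \<forall>x\<in>B. \<exists>j::int. x = of_int j / 2 ^ n" by auto
  obtain m k where mk: "x = of_int m / 2 ^ k" using insert.prems[of x] unfolding dyadic_def by auto
  have "\<exists>j::int. x = of_int j / 2 ^ n" if "n \<ge> k" for n
  proof -
    have "x = of_int (m * 2 ^ (n - k)) / 2 ^ n"
      using that by (simp add: mk field_simps flip: power_add)
    then show ?thesis by blast
  qed
  then show ?case using N by (intro exI[of _ "max N k"]) auto
qed

text \<open>Every sufficiently fine grid of mesh \<open>1 / 2 ^ n\<close> contains all breaks in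
  \<open>[a,b]\<close>. A uniform grid serves both as a list of break points and as the subdivision
  for the factorization into basic elements.\<close>

lemma pl2_grid:
  fixes a b :: real
  assumes f: "f \<in> pl2"
  shows "\<exists>N. \<forall>n\<ge>N. \<forall>m::int. a \<le> of_int m / 2 ^ n \<longrightarrow> of_int (m + 1) / 2 ^ n \<le> b \<longrightarrow>
    (\<exists>k c. \<forall>x\<in>{of_int m / 2 ^ n .. of_int (m + 1) / 2 ^ n}. f x = 2 powi k * x + c)"
proof -
  obtain N where N: "\<forall>n\<ge>N. \<forall>x\<in>breaks f \<inter> {a..b}. \<exists>j::int. x = of_int j / 2 ^ n"
    using finite_dyadic_common_denominator[OF finite_breaks[OF f, of a b]] breaks_dyadic[OF f] by auto
  show ?thesis
  proof (intro exI[of _ N] allI impI)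
    fix n :: nat and m :: int
    assume n: "n \<ge> N" and m: "a \<le> of_int m / 2 ^ n" "of_int (m + 1) / 2 ^ n \<le> b"
    show "\<exists>k c. \<forall>x\<in>{of_int m / 2 ^ n .. of_int (m + 1) / 2 ^ n}. f x = 2 powi k * x + c"
    proof (rule pl2_affine_on_interval[OF f])
      fix x :: real assume x: "of_int m / 2 ^ n < x" "x < of_int (m + 1) / 2 ^ n"
      show "x \<notin> breaks f"
      proof
        assume "x \<in> breaks f"
        then obtain j :: int where j: "x = of_int j / 2 ^ n" using N n x m by fastforce
        then have "m < j" "j < m + 1" using x by (auto simp: divide_less_cancel)
        then show False by simp
      qed
    qed (simp add: divide_strict_right_mono)
  qed
qed

section \<open>Agreement with the definition of Thompson's group\<close>

lemma sorted_list_cell: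
  fixes xs :: "real list"
  assumes "length xs \<ge> 2" "sorted_wrt (<) xs" "hd xs \<le> x" "x < last xs"
  shows "\<exists>i. Suc i < length xs \<and> xs ! i \<le> x \<and> x < xs ! Suc i"
proof -
  define P where "P i \<longleftrightarrow> i < length xs \<and> xs ! i \<le> x" for i
  define i where "i = (GREATEST i. P i)"
  have P0: "P 0" unfolding P_def using assms by (cases xs) auto
  have bd: "\<And>j. P j \<Longrightarrow> j \<le> length xs" unfolding P_def by simp
  have Pi: "P i" unfolding i_def using P0 bd by (rule GreatestI_nat[of P])
  have max: "\<And>j. P j \<Longrightarrow> j \<le> i" unfolding i_def by (rule Greatest_le_nat[of P]) (use bd in auto)
  have "xs ! (length xs - 1) > x" using assms(1,4) by (metis last_conv_nth list.size(3) not_numeral_le_zero)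
  then have "i \<noteq> length xs - 1" using Pi unfolding P_def by auto
  then have "Suc i < length xs" using Pi unfolding P_def by linarith
  then show ?thesis using max[of "Suc i"] Pi unfolding P_def by (intro exI[of _ i]) (auto simp: not_le[symmetric])
qed

lemma sorted_list_cell':
  fixes xs :: "real list"
  assumes "length xs \<ge> 2" "sorted_wrt (<) xs" "hd xs < x" "x \<le> last xs"
  shows "\<exists>i. Suc i < length xs \<and> xs ! i < x \<and> x \<le> xs ! Suc i"
proof -
  define i where "i = (LEAST i. i < length xs \<and> x \<le> xs ! i)"
  have "length xs - 1 < length xs \<and> x \<le> xs ! (length xs - 1)"
    using assms(1,4) by (metis One_nat_def Suc_le_lessD diff_less last_conv_nth le_zero_eq length_greater_0_conv lessI list.size(3) not_numeral_le_zero zero_less_iff_neq_zero)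
  then have i: "i < length xs \<and> x \<le> xs ! i" unfolding i_def by (rule LeastI)
  have "i \<noteq> 0" using i assms(1,3) by (metis hd_conv_nth length_0_conv not_le not_numeral_le_zero)
  then obtain j where j: "i = Suc j" by (cases i) auto
  have "\<not> (j < length xs \<and> x \<le> xs ! j)" using not_less_Least[of j "\<lambda>i. i < length xs \<and> x \<le> xs ! i"] j unfolding i_def by auto
  then show ?thesis using i j by auto
qed

lemma thompsonF_imp_pl2:
  assumes "f \<in> thompsonF" shows "f \<in> pl2" "x \<notin> {0..1} \<Longrightarrow> f x = x"
proof -
  have out: "\<And>x. x \<notin> {0..1} \<Longrightarrow> f x = x" and ends: "f 0 = 0" "f 1 = 1"
    and mono: "strict_mono_on {0..1} f" and img: "f ` {0..1} = {0..1}"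
    and dy: "f ` {x\<in>{0..1}. dyadic x} = {x\<in>{0..1}. dyadic x}"
    using assms unfolding thompsonF_def by blast+
  show "x \<notin> {0..1} \<Longrightarrow> f x = x" by (rule out)
  obtain xs where xs: "length xs \<ge> 2" "sorted_wrt (<) xs" "hd xs = 0" "last xs = 1"
    "\<forall>a\<in>set xs. dyadic a"
    "\<And>i. Suc i < length xs \<Longrightarrow> \<exists>k::int. \<exists>c::real. \<forall>x\<in>{xs ! i .. xs ! Suc i}. f x = 2 powi k * x + c"
    using assms unfolding thompsonF_def by blast
  have "strict_mono f"
  proof (rule strict_monoI)
    fix x y :: real assume "x < y"
    have I: "z \<in> {0..1} \<Longrightarrow> 0 \<le> f z \<and> f z \<le> 1" for z using img by auto
    consider "x \<in> {0..1}" "y \<in> {0..1}" | "x < 0" | "y > 1" | "x > 1 \<or> y < 0" by force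
    then show "f x < f y"
    proof cases
      case 1 then show ?thesis using mono \<open>x < y\<close> by (auto simp: strict_mono_on_def)
    next
      case 2 then show ?thesis using out[of x] out[of y] I[of y] \<open>x < y\<close> by (cases "y \<in> {0..1}") auto
    next
      case 3 then show ?thesis using out[of x] out[of y] I[of x] \<open>x < y\<close> by (cases "x \<in> {0..1}") auto
    next
      case 4 then show ?thesis using out[of x] out[of y] \<open>x < y\<close> by auto
    qed
  qed
  moreover have "surj f"
  proof (rule surjI)
    fix y show "f (if y \<in> {0..1} then SOME x. f x = y else y) = y"
    proof (cases "y \<in> {0..1}")
      case True
      then have "\<exists>x. f x = y" using img by (metis imageE)
      then show ?thesis using True by (simp add: someI_ex[of "\<lambda>x. f x = y"])
    qed (use out in auto)
  qed
  moreover have "dyadic (f x) = dyadic x" for x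
  proof (cases "x \<in> {0..1}")
    case True
    show ?thesis
    proof
      assume "dyadic x" then show "dyadic (f x)" using dy True by blast
    next
      assume "dyadic (f x)"
      then have "f x \<in> f ` {x\<in>{0..1}. dyadic x}" using dy img True by blast
      then obtain y where "f x = f y" "y \<in> {0..1}" "dyadic y" by blast
      then show "dyadic x" using True mono by (metis strict_mono_on_imp_inj_on inj_onD)
    qed
  qed (simp add: out)
  moreover have "\<exists>k l. rg f x k \<and> lg f x l \<and> (k \<noteq> l \<longrightarrow> dyadic x)" for x
  proof -
    have R: "\<exists>k. rg f x k" if "0 \<le> x" "x < 1"
    proof -
      obtain i where i: "Suc i < length xs" "xs ! i \<le> x" "x < xs ! Suc i"
        using sorted_list_cell[OF xs(1,2), of x] xs(3,4) \<open>0 \<le> x\<close> \<open>x < 1\<close> by auto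
      obtain k c where "\<forall>x\<in>{xs ! i .. xs ! Suc i}. f x = 2 powi k * x + c" using xs(6)[OF i(1)] by blast
      then have "rg f x k" using i by (subst rg_cong[of x "xs ! Suc i" _ "\<lambda>x. 2 powi k * x + c"]) auto
      then show ?thesis ..
    qed
    have L: "\<exists>k. lg f x k \<and> (x < 1 \<longrightarrow> \<not> dyadic x \<longrightarrow> rg f x k)" if "0 < x" "x \<le> 1"
    proof -
      obtain i where i: "Suc i < length xs" "xs ! i < x" "x \<le> xs ! Suc i"
        using sorted_list_cell'[OF xs(1,2), of x] xs(3,4) \<open>0 < x\<close> \<open>x \<le> 1\<close> by auto
      obtain k c where k: "\<forall>x\<in>{xs ! i .. xs ! Suc i}. f x = 2 powi k * x + c" using xs(6)[OF i(1)] by blast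
      then have "lg f x k" using i by (subst lg_cong[of "xs ! i" x _ "\<lambda>x. 2 powi k * x + c"]) auto
      \<comment> \<open>A non-dyadic point is no node of the list, so it lies in the interior of its
        cell and both germs come from one formula.\<close>
      moreover have "rg f x k" if "\<not> dyadic x"
      proof -
        have "x \<noteq> xs ! Suc i" using that xs(5) i(1) by auto
        then show ?thesis
          using i k by (subst rg_cong[of x "xs ! Suc i" _ "\<lambda>x. 2 powi k * x + c"]) auto
      qed
      ultimately show ?thesis by blast
    qed
    have idl: "f y = y" if "y \<le> 0" for y using out[of y] ends that by (cases "y = 0") auto
    have idr: "f y = y" if "1 \<le> y" for y using out[of y] ends that by (cases "y = 1") auto
    have R0: "rg f x 0" if "x < 0 \<or> x \<ge> 1"
    proof -
      have "rg f x 0 \<longleftrightarrow> rg id x 0"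
        by (rule rg_cong[of x "if x < 0 then 0 else x + 1"]) (use that idl idr in \<open>auto split: if_splits\<close>)
      then show ?thesis by simp
    qed
    have L0: "lg f x 0" if "x \<le> 0 \<or> x > 1"
    proof -
      have "lg f x 0 \<longleftrightarrow> lg id x 0"
        by (rule lg_cong[of "if x > 1 then 1 else x - 1"]) (use that idl idr in \<open>auto split: if_splits\<close>)
      then show ?thesis by simp
    qed
    consider "x < 0 \<or> x > 1" | "x = 0" | "x = 1" | "0 < x" "x < 1" by linarith
    then show ?thesis
    proof cases
      case 1 then show ?thesis using R0 L0 by (intro exI[of _ 0]) auto
    next
      case 2 then show ?thesis using R L0 by (metis dyadic_numeral(1) order_refl zero_less_one)
    next
      case 3 then show ?thesis using R0 L by (metis dyadic_numeral(2) order_refl zero_less_one)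
    next
      case 4 then show ?thesis using R L by (metis less_imp_le)
    qed
  qed
  ultimately show "f \<in> pl2" unfolding pl2_def by blast
qed

lemma pl2_imp_thompsonF:
  assumes f: "f \<in> pl2" and out: "\<And>x. x \<notin> {0..1} \<Longrightarrow> f x = x"
  shows "f \<in> thompsonF"
proof -
  have f0: "f 0 = 0"
  proof (rule antisym)
    show "f 0 \<le> 0"
    proof (rule ccontr)
      assume "\<not> f 0 \<le> 0"
      obtain x where x: "f x = 0" using pl2D(2)[OF f] by (metis surjD)
      then have "x < 0" using pl2D(7)[OF f, of 0 x] \<open>\<not> f 0 \<le> 0\<close> by auto
      then show False using x out[of x] by simp
    qed
    show "0 \<le> f 0"
    proof (rule ccontr)
      assume "\<not> 0 \<le> f 0"
      then show False using pl2D(6)[OF f, of "f 0" 0] out[of "f 0"] by simp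
    qed
  qed
  have f1: "f 1 = 1"
  proof (rule antisym)
    show "1 \<le> f 1"
    proof (rule ccontr)
      assume "\<not> 1 \<le> f 1"
      obtain x where x: "f x = 1" using pl2D(2)[OF f] by (metis surjD)
      then have "x > 1" using pl2D(7)[OF f, of x 1] \<open>\<not> 1 \<le> f 1\<close> by auto
      then show False using x out[of x] by simp
    qed
    show "f 1 \<le> 1"
    proof (rule ccontr)
      assume "\<not> f 1 \<le> 1"
      then show False using pl2D(6)[OF f, of 1 "f 1"] out[of "f 1"] by simp
    qed
  qed
  have I: "f x \<in> {0..1} \<longleftrightarrow> x \<in> {0..1}" for x
    using pl2D(7)[OF f, of 0 x] pl2D(7)[OF f, of x 1] f0 f1 by auto
  have S: "\<exists>y. x = f y" for x using pl2D(2)[OF f] by (metis surjD)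
  \<comment> \<open>The nodes demanded by \<open>thompsonF\<close> are taken from a uniform grid on
    \<open>[0,1]\<close>; they need not all be break points.\<close>
  obtain N where N: "\<And>m::int. (0::real) \<le> of_int m / 2 ^ N \<Longrightarrow> of_int (m + 1) / 2 ^ N \<le> (1::real) \<Longrightarrow>
    \<exists>k c. \<forall>x\<in>{of_int m / 2 ^ N .. of_int (m + 1) / 2 ^ N}. f x = 2 powi k * x + c"
    using pl2_grid[OF f, of 0 1] by blast
  define xs where "xs = map (\<lambda>i. real i / 2 ^ N) [0..<Suc (2 ^ N)]"
  have len: "length xs = Suc (2 ^ N)" by (simp add: xs_def)
  have nth: "xs ! i = real i / 2 ^ N" if "i < Suc (2 ^ N)" for i
    using that by (simp add: xs_def del: upt_Suc)
  have "\<exists>xs::real list. length xs \<ge> 2 \<and> sorted_wrt (<) xs \<and> hd xs = 0 \<and> last xs = 1 \<and>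
        (\<forall>a\<in>set xs. dyadic a) \<and>
        (\<forall>i. Suc i < length xs \<longrightarrow>
           (\<exists>k::int. \<exists>c::real. \<forall>x\<in>{xs ! i .. xs ! Suc i}. f x = 2 powi k * x + c))"
  proof (intro exI[of _ xs] conjI allI impI ballI)
    show "length xs \<ge> 2" by (simp add: len)
    show "sorted_wrt (<) xs"
      unfolding sorted_wrt_iff_nth_less by (auto simp: len nth divide_strict_right_mono)
    show "hd xs = 0" by (subst hd_conv_nth) (use len nth in auto)
    show "last xs = 1" by (subst last_conv_nth) (use len nth[of "2 ^ N"] in auto)
    fix a assume "a \<in> set xs"
    then obtain i where "a = real i / 2 ^ N" by (auto simp: xs_def)
    then have "a = of_int (int i) / 2 ^ N" by simp
    then show "dyadic a" unfolding dyadic_def by blast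
  next
    fix i assume i: "Suc i < length xs"
    have "Suc i \<le> 2 ^ N" using i by (simp add: len)
    then have "real (Suc i) \<le> real (2 ^ N)" by (simp only: of_nat_le_iff)
    then have le: "real (Suc i) \<le> 2 ^ N" by simp
    have e: "real_of_int (int i) = real i" "real_of_int (int i + 1) = real (Suc i)" by simp_all
    have "\<exists>k c. \<forall>x\<in>{real i / 2 ^ N .. real (Suc i) / 2 ^ N}. f x = 2 powi k * x + c"
      using N[of "int i", unfolded e] le by (simp del: of_nat_Suc)
    then show "\<exists>k::int. \<exists>c::real. \<forall>x\<in>{xs ! i .. xs ! Suc i}. f x = 2 powi k * x + c"
      using i nth[of i] nth[of "Suc i"] len by simp
  qed
  moreover have "f ` {0..1} = {0..1}" 
  proof (intro equalityI subsetI)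
    fix y :: real assume "y \<in> {0..1}"
    moreover obtain z where "y = f z" using S by blast
    ultimately show "y \<in> f ` {0..1}" using I[of z] by auto
  qed (use I in blast)
  moreover have "f ` {x\<in>{0..1}. dyadic x} = {x\<in>{0..1}. dyadic x}"
  proof (intro equalityI subsetI)
    fix y assume "y \<in> {x\<in>{0..1}. dyadic x}"
    moreover obtain z where "y = f z" using S by blast
    ultimately show "y \<in> f ` {x\<in>{0..1}. dyadic x}" using I[of z] pl2D(5)[OF f] by auto
  qed (use I pl2D(5)[OF f] in auto)
  moreover have "strict_mono_on {0..1} f" using pl2D(1)[OF f] by (auto simp: strict_mono_on_def strict_mono_def)
  ultimately show ?thesis unfolding thompsonF_def
    using f0 f1 pl2_continuous[OF f] out by (intro CollectI conjI allI impI)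
qed

lemma thompsonF_iff: "f \<in> thompsonF \<longleftrightarrow> f \<in> pl2 \<and> (\<forall>x. x \<notin> {0..1} \<longrightarrow> f x = x)"
  using thompsonF_imp_pl2 pl2_imp_thompsonF by blast

text \<open>The group is written additively, so that the (noncommutative) class \<open>group_add\<close> applies:
  \<open>f + g\<close> is the composition \<open>f \<circ> g\<close>.\<close>

typedef thompson = thompsonF morphisms app Abs_thompson
  using pl2_id thompsonF_iff by (intro exI[of _ id]) auto

lemma app_pl2 [simp]: "app f \<in> pl2"
  using app[of f] thompsonF_iff by blast

lemma app_in_thompsonF [simp]: "app f \<in> thompsonF"
  by (rule app)

lemma app_outside [simp]: "x \<le> 0 \<Longrightarrow> app f x = x" "x \<ge> 1 \<Longrightarrow> app f x = x"
proof -
  have out: "x \<notin> {0..1} \<Longrightarrow> app f x = x" for x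
    using app[of f] thompsonF_iff by blast
  have "app f 0 = 0" "app f 1 = 1" using app[of f] unfolding thompsonF_def by blast+
  then show "x \<le> 0 \<Longrightarrow> app f x = x" "x \<ge> 1 \<Longrightarrow> app f x = x"
    using out[of x] by (auto simp: order_le_less)
qed

lemmas app_mono [simp] = pl2D(6-8)[OF app_pl2]

lemma app_dyadic [simp]: "dyadic (app f x) = dyadic x"
  by (rule pl2D(5)[OF app_pl2])

lemma app_01 [simp]: "0 < app f x \<longleftrightarrow> 0 < x" "app f x < 1 \<longleftrightarrow> x < 1"
  using app_mono(1)[of f 0 x] app_mono(1)[of f x 1] by (simp_all del: app_mono)

lemma thompson_eqI: "(\<And>x. app f x = app g x) \<Longrightarrow> f = g"
  by (metis app_inject ext)

lemma thompson_of_pl2: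
  assumes "f \<in> pl2" "\<And>x. x \<le> 0 \<Longrightarrow> f x = x" "\<And>x. x \<ge> 1 \<Longrightarrow> f x = x"
  obtains t where "app t = f"
proof -
  have "f \<in> thompsonF" unfolding thompsonF_iff using assms by auto
  then show thesis using that by (metis Abs_thompson_inverse)
qed

instantiation thompson :: group_add
begin

definition "0 = Abs_thompson id"
definition "f + g = Abs_thompson (app f \<circ> app g)"
definition "- f = Abs_thompson (inv (app f))"
definition "f - g = f + - (g :: thompson)"

lemma app_zero [simp]: "app 0 x = x"
proof -
  have "id \<in> thompsonF" using pl2_id thompsonF_iff by auto
  then show ?thesis by (simp add: zero_thompson_def Abs_thompson_inverse)
qed

lemma app_plus [simp]: "app (f + g) x = app f (app g x)"
proof -
  have "app f \<circ> app g \<in> thompsonF" by (auto simp: thompsonF_iff pl2_comp not_le)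
  then show ?thesis by (simp add: plus_thompson_def Abs_thompson_inverse)
qed

lemma app_uminus: "app (- f) = inv (app f)"
proof -
  have "inv (app f) x = x" if "x \<notin> {0..1}" for x
  proof -
    have "app f x = x" using that by auto
    then show ?thesis by (metis pl2_inv_simps(1)[OF app_pl2])
  qed
  then have "inv (app f) \<in> thompsonF" unfolding thompsonF_iff using pl2_inv[OF app_pl2] by blast
  then show ?thesis by (simp add: uminus_thompson_def Abs_thompson_inverse)
qed

lemma app_uminus_cancel [simp]: "app (- f) (app f x) = x" "app f (app (- f) x) = x"
  by (simp_all add: app_uminus pl2_inv_simps)

instance
  by standard (auto intro!: thompson_eqI simp: minus_thompson_def)

end

lemma app_diff [simp]: "app (f - g) x = app f (app (- g) x)"
  by (simp add: minus_thompson_def del: add_uminus_conv_diff)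

lemma app_uminus_eq_iff: "app (- f) x = y \<longleftrightarrow> x = app f y"
  by auto

lemma app_uminus_fixed [simp]: "app (- f) x = x \<longleftrightarrow> app f x = x"
  by (metis app_uminus_cancel)

lemma app_eq_id_iff [simp]: "app f = id \<longleftrightarrow> f = 0"
  by (auto intro: thompson_eqI)

lemma app_image_comp: "app f \<circ> app g = app (f + g)"
  by auto

subsection \<open>Extension of piecewise linear maps\<close>

text \<open>Since \<open>0 < h a\<close> and \<open>h b < 1\<close>, the identity outside
  \<open>[0,1]\<close> can be joined to \<open>h\<close> across \<open>[0,a]\<close> and across
  \<open>[b,1]\<close>.\<close>

lemma thompson_extend:
  assumes h: "h \<in> pl2" and ab: "dyadic a" "dyadic b" "0 < a" "a \<le> b" "b < 1" "0 < h a" "h b < 1"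
  obtains t where "\<And>x. a \<le> x \<Longrightarrow> x \<le> b \<Longrightarrow> app t x = h x"
proof -
  obtain u where u: "u \<in> pl2" "\<And>x. x \<le> 0 \<Longrightarrow> u x = id x" "\<And>x. a \<le> x \<Longrightarrow> u x = h x"
    using pl2_connect[OF pl2_id h, of 0 a] ab by auto
  have "u b < id 1" using u(3)[of b] ab by simp
  then obtain v where v: "v \<in> pl2" "\<And>x. x \<le> b \<Longrightarrow> v x = u x" "\<And>x. 1 \<le> x \<Longrightarrow> v x = id x"
    using pl2_connect[OF u(1) pl2_id ab(2) dyadic_numeral(2) ab(5)] by blast
  obtain t where t: "app t = v"
    by (rule thompson_of_pl2[OF v(1)]) (use u v ab in auto)
  show thesis by (rule that[of t]) (use t u v ab in auto)
qed

lemma thompson_extend2: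
  assumes "h1 \<in> pl2" "h2 \<in> pl2" "dyadic a" "dyadic b" "dyadic c" "dyadic d"
    and "0 < a" "a \<le> b" "b < c" "c \<le> d" "d < 1" "0 < h1 a" "h1 b < h2 c" "h2 d < 1"
  obtains t where "\<And>x. a \<le> x \<Longrightarrow> x \<le> b \<Longrightarrow> app t x = h1 x"
    "\<And>x. c \<le> x \<Longrightarrow> x \<le> d \<Longrightarrow> app t x = h2 x"
proof -
  obtain h where h: "h \<in> pl2" "\<And>x. x \<le> b \<Longrightarrow> h x = h1 x" "\<And>x. c \<le> x \<Longrightarrow> h x = h2 x"
    using pl2_connect[OF assms(1,2,4,5)] assms by metis
  obtain t where t: "\<And>x. a \<le> x \<Longrightarrow> x \<le> d \<Longrightarrow> app t x = h x"
    by (rule thompson_extend[OF h(1) assms(3,6)]) (use assms h in auto)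
  show thesis by (rule that[of t]) (use t h assms in auto)
qed

lemma thompson_extend3:
  assumes "h1 \<in> pl2" "h2 \<in> pl2" "h3 \<in> pl2"
    and "dyadic a" "dyadic b" "dyadic c" "dyadic d" "dyadic e" "dyadic f"
    and "0 < a" "a \<le> b" "b < c" "c \<le> d" "d < e" "e \<le> f" "f < 1"
    and "0 < h1 a" "h1 b < h2 c" "h2 d < h3 e" "h3 f < 1"
  obtains t where "\<And>x. a \<le> x \<Longrightarrow> x \<le> b \<Longrightarrow> app t x = h1 x"
    "\<And>x. c \<le> x \<Longrightarrow> x \<le> d \<Longrightarrow> app t x = h2 x" "\<And>x. e \<le> x \<Longrightarrow> x \<le> f \<Longrightarrow> app t x = h3 x"
proof -
  obtain h where h: "h \<in> pl2" "\<And>x. x \<le> b \<Longrightarrow> h x = h1 x" "\<And>x. c \<le> x \<Longrightarrow> h x = h2 x"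
    using pl2_connect[OF assms(1,2,5,6)] assms by metis
  obtain t where t: "\<And>x. a \<le> x \<Longrightarrow> x \<le> d \<Longrightarrow> app t x = h x" "\<And>x. e \<le> x \<Longrightarrow> x \<le> f \<Longrightarrow> app t x = h3 x"
    by (rule thompson_extend2[OF h(1) assms(3,4,7,8,9)]) (use assms h in auto)
  show thesis by (rule that) (use t h assms in auto)
qed

lemma thompson_move_interval:
  assumes "dyadic a" "dyadic b" "0 < a" "a < b" "b < 1" "dyadic c" "dyadic d" "0 < c" "c < d" "d < 1"
  obtains t where "app t a = c" "app t b = d"
proof -
  obtain h where h: "h \<in> pl2" "h a = c" "h b = d" using pl2_interval[of a b c d] assms by blast
  obtain t where "\<And>x. a \<le> x \<Longrightarrow> x \<le> b \<Longrightarrow> app t x = h x"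
    by (rule thompson_extend[OF h(1) assms(1,2)]) (use assms h in auto)
  then show thesis using that[of t] h assms by auto
qed

subsection \<open>Supports and germs at the ends of the support\<close>

definition supported :: "thompson \<Rightarrow> real \<Rightarrow> real \<Rightarrow> bool" where
  "supported f a b \<longleftrightarrow> (\<forall>x\<le>a. app f x = x) \<and> (\<forall>x\<ge>b. app f x = x)"

text \<open>The exact left end of the support, in contrast to the bounds in
  \<open>supported\<close>, which need not be sharp: \<open>p\<close> is the point
  \<open>xminus\<close>, and the slope there is \<open>2 powi m\<close>. The condition
  \<open>m \<noteq> 0\<close> makes \<open>p\<close> unique.\<close>

definition lead :: "thompson \<Rightarrow> real \<Rightarrow> int \<Rightarrow> bool" where
  "lead f p m \<longleftrightarrow> (\<forall>x\<le>p. app f x = x) \<and> rg (app f) p m \<and> m \<noteq> 0"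

definition trail :: "thompson \<Rightarrow> real \<Rightarrow> int \<Rightarrow> bool" where
  "trail f q n \<longleftrightarrow> (\<forall>x\<ge>q. app f x = x) \<and> lg (app f) q n \<and> n \<noteq> 0"

lemma supported_mono: "supported f a b \<Longrightarrow> a' \<le> a \<Longrightarrow> b \<le> b' \<Longrightarrow> supported f a' b'"
  by (auto simp: supported_def)

lemma supported_uminus [simp]: "supported (- f) a b \<longleftrightarrow> supported f a b"
  by (auto simp: supported_def)

lemma supported_conj: "supported f a b \<Longrightarrow> supported (h + f - h) (app h a) (app h b)"
  unfolding supported_def
  by (metis app_diff app_mono(2) app_plus app_uminus_cancel(2))

lemma supported_image:
  assumes "supported f a b" shows "app f x \<le> a \<longleftrightarrow> x \<le> a" "b \<le> app f x \<longleftrightarrow> b \<le> x"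
  using assms app_mono(2)[of f x a] app_mono(2)[of f b x] unfolding supported_def
  by (simp_all del: app_mono)

lemma disjoint_supports_commute:
  assumes f: "supported f a b" and g: "supported g c d" and "b \<le> c"
  shows "f + g = g + f"
proof (rule thompson_eqI)
  fix x
  show "app (f + g) x = app (g + f) x"
  proof (cases "x \<le> b")
    case True
    then have "app f x \<le> b" using supported_image(2)[OF f, of x] f by (cases "x = b") (auto simp: supported_def)
    then show ?thesis using True g \<open>b \<le> c\<close> by (simp add: supported_def)
  next
    case False
    then have "app g x \<ge> b"
      using supported_image(1)[OF g, of x] g \<open>b \<le> c\<close> by (cases "x \<le> c") (auto simp: supported_def)
    then show ?thesis using False f by (simp add: supported_def)
  qed
qed

text \<open>\<open>- k + h\<close> fixes \<open>[a,b]\<close> pointwise and therefore commutes with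
  \<open>f\<close>. So a conjugate depends only on the values of the conjugator on the support, and
  the conjugator may be rebuilt elsewhere.\<close>

lemma conj_eq_if_agree:
  assumes f: "supported f a b" and agree: "\<And>x. a \<le> x \<Longrightarrow> x \<le> b \<Longrightarrow> app h x = app k x"
  shows "h + f - h = k + f - k"
proof -
  have "(- k + h) + f = f + (- k + h)"
  proof (rule thompson_eqI)
    fix x
    show "app ((- k + h) + f) x = app (f + (- k + h)) x"
    proof (cases "a \<le> x \<and> x \<le> b")
      case True
      then have "a \<le> app f x" "app f x \<le> b"
        using supported_image[OF f, of x] f app_mono(2)[of f a x] app_mono(2)[of f x b]
        by (auto simp: supported_def simp del: app_mono)
      then show ?thesis using True agree by simp
    next
      case F: False
      then have fx: "app f x = x" using f by (auto simp: supported_def)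
      have y: "app (- k) (app h x) \<le> a \<or> b \<le> app (- k) (app h x)"
      proof (cases "a \<le> b")
        case True
        have "app (- k) (app h a) = a" "app (- k) (app h b) = b" using agree True by auto
        then show ?thesis using F by (metis app_mono(2) linear)
      qed auto
      then show ?thesis using fx f by (auto simp: supported_def)
    qed
  qed
  moreover have "h + f = k + ((- k + h) + f)" by (simp flip: add.assoc)
  moreover have "k + (f + (- k + h)) = (k + f - k) + h" by (simp only: diff_conv_add_uminus add.assoc)
  ultimately show ?thesis by (metis add_diff_cancel)
qed

lemma rg_uminus: "rg (app f) x m \<Longrightarrow> rg (app (- f)) (app f x) (- m)"
  by (simp add: app_uminus rg_inv)

lemma rg_plus: "rg (app f) (app g x) k \<Longrightarrow> rg (app g) x l \<Longrightarrow> rg (app (f + g)) x (k + l)"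
  using rg_comp[of "app f" "app g" x k l] by (simp add: app_image_comp)

lemma rg_ident: "x < c \<Longrightarrow> (\<And>y. x \<le> y \<Longrightarrow> y \<le> c \<Longrightarrow> app f y = y) \<Longrightarrow> rg (app f) x 0"
  using rg_cong[of x c "app f" id 0] by simp

lemma lg_ident: "c < x \<Longrightarrow> (\<And>y. c \<le> y \<Longrightarrow> y \<le> x \<Longrightarrow> app f y = y) \<Longrightarrow> lg (app f) x 0"
  using lg_cong[of c x "app f" id 0] by simp

lemma lead_point_unique:
  assumes "lead f p m" "lead f p' m'" shows "p = p'" "m = m'"
proof -
  have "\<not> p < p'" if "lead f p m" "lead f p' m'" for p p' m m'
    using that rg_ident[of p p' f] rg_unique unfolding lead_def by fastforce
  then show "p = p'" using assms by (meson linorder_neqE)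
  then show "m = m'" using assms rg_unique unfolding lead_def by blast
qed

lemma lead_ident: "lead f p m \<Longrightarrow> x \<le> p \<Longrightarrow> app f x = x"
  unfolding lead_def by blast

lemma lead_nonzero: "lead f p m \<Longrightarrow> f \<noteq> 0"
proof
  assume "lead f p m" "f = 0"
  then have "rg (app 0) p m" "m \<noteq> 0" using lead_def[of 0 p m] by auto
  moreover have "rg (app 0) p 0" by (rule rg_ident[of p "p + 1"]) auto
  ultimately show False using rg_unique by blast
qed

lemma lead_range:
  assumes "lead f p m" shows "0 \<le> p" "p < 1" "dyadic p"
proof -
  have m: "rg (app f) p m" "m \<noteq> 0" using assms unfolding lead_def by blast+
  show "0 \<le> p"
  proof (rule ccontr)
    assume "\<not> 0 \<le> p"
    then have "rg (app f) p 0" by (intro rg_ident[of p 0]) auto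
    then show False using m rg_unique by blast
  qed
  show "p < 1"
  proof (rule ccontr)
    assume "\<not> p < 1"
    then have "rg (app f) p 0" by (intro rg_ident[of p "p + 1"]) auto
    then show False using m rg_unique by blast
  qed
  \<comment> \<open>At \<open>p\<close> the left germ is trivial and the right one is not, so
    \<open>p\<close> is a break and therefore dyadic.\<close>
  obtain k l where kl: "rg (app f) p k" "lg (app f) p l" "k \<noteq> l \<longrightarrow> dyadic p" using pl2_germs[OF app_pl2] .
  have "lg (app f) p 0" by (intro lg_ident[of "p - 1"]) (use assms in \<open>auto simp: lead_def\<close>)
  then show "dyadic p" using kl m rg_unique lg_unique by metis
qed

text \<open>\<open>p\<close> is the supremum of the points up to which \<open>f\<close> is the
  identity. A trivial right germ would extend the identity beyond \<open>p\<close>, and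
  \<open>p = 1\<close> would give \<open>f = 0\<close>.\<close>

lemma lead_exists:
  assumes "f \<noteq> 0" obtains p m where "lead f p m"
proof -
  define S where "S = {t\<in>{0..1}. \<forall>y\<le>t. app f y = y}"
  define p where "p = Sup S"
  have S0: "0 \<in> S" by (auto simp: S_def)
  have bdd: "bdd_above S" unfolding S_def by (rule bdd_aboveI[of _ 1]) auto
  have p0: "0 \<le> p" unfolding p_def by (rule cSup_upper[OF S0 bdd])
  have p1: "p \<le> 1" unfolding p_def by (rule cSup_least) (use S0 S_def in blast, simp add: S_def)
  have below: "app f y = y" if "y < p" for y
  proof -
    obtain t where "t \<in> S" "y < t" using less_cSupD[of S y] S0 \<open>y < p\<close> unfolding p_def by blast
    then show ?thesis by (auto simp: S_def)
  qed
  have at: "app f p = p"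
  proof (rule antisym)
    show "app f p \<le> p"
      using below[of "app (- f) p"] app_mono(1)[of f "app (- f) p" p]
      by (metis app_uminus_cancel(2) linorder_not_le order_less_irrefl)
    show "p \<le> app f p"
      using below[of "app f p"] app_mono(1)[of f "app f p" p] by (auto simp: not_le[symmetric])
  qed
  have le: "app f x = x" if "x \<le> p" for x using below at that by (cases "x = p") auto
  obtain m where m: "rg (app f) p m" using pl2_germs[OF app_pl2] by metis
  have "m \<noteq> 0"
  proof
    assume "m = 0"
    have "p \<noteq> 1"
    proof
      assume "p = 1"
      then have "f = 0" using le by (intro thompson_eqI) (metis app_outside(2) app_zero linear)
      then show False using assms by simp
    qed
    then have "p < 1" using p1 by simp
    then obtain c where c: "p < c" "c < 1" "\<And>y. p < y \<Longrightarrow> y \<le> c \<Longrightarrow> app f y = app f p + 2 powi m * (y - p)"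
      using rgE[OF m \<open>p < 1\<close>] by metis
    have "app f y = y" if "y \<le> c" for y
      using c(3)[of y] at \<open>m = 0\<close> le that by (cases "y \<le> p") auto
    then have "c \<in> S" using c p0 by (auto simp: S_def)
    then have "c \<le> p" unfolding p_def using bdd by (rule cSup_upper)
    then show False using c by simp
  qed
  then show thesis using that[of p m] le m unfolding lead_def by blast
qed

lemma lead_uminus: "lead f p m \<Longrightarrow> lead (- f) p (- m)"
  using rg_uminus[of f p m] unfolding lead_def by auto

text \<open>The exponent of \<open>h\<close> at \<open>p\<close> enters once with each sign and
  cancels, so conjugation moves the end point and keeps its exponent.\<close>

lemma lead_conj:
  assumes "lead f p m" shows "lead (h + f - h) (app h p) m"
proof -
  obtain k where k: "rg (app h) p k" using pl2_germs[OF app_pl2] by metis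
  have f: "\<And>x. x \<le> p \<Longrightarrow> app f x = x" "rg (app f) p m" "m \<noteq> 0" using assms unfolding lead_def by blast+
  have "rg (app (h + f)) p (k + m)" using rg_plus[of h f p k m] f k by simp
  then have "rg (app (h + f + (- h))) (app h p) (k + m + - k)"
    using rg_plus[of "h + f" "- h" "app h p", OF _ rg_uminus[OF k]] by (simp only: app_uminus_cancel)
  moreover have "k + m + - k = m" by simp
  ultimately have "rg (app (h + f - h)) (app h p) m" by (simp only: diff_conv_add_uminus)
  moreover have "app (h + f - h) x = x" if "x \<le> app h p" for x
    using f(1)[of "app (- h) x"] that by (metis app_diff app_mono(2) app_plus app_uminus_cancel(2))
  ultimately show ?thesis unfolding lead_def using f by blast
qed

lemma lead_plus:
  assumes "lead f p m" "lead g p n" "m + n \<noteq> 0" shows "lead (f + g) p (m + n)"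
  using assms rg_plus[of f g p m n] unfolding lead_def by simp

lemma lead_plus_left:
  assumes "lead f p m" "\<And>x. x \<le> q \<Longrightarrow> app g x = x" "p < q"
  shows "lead (f + g) p m" "lead (g + f) p m"
proof -
  have g: "rg (app g) p 0" using assms(2,3) by (intro rg_ident[of p q]) auto
  show "lead (f + g) p m"
    using assms rg_plus[of f g p m 0] g unfolding lead_def by simp
  show "lead (g + f) p m"
    using assms rg_plus[of g f p 0 m] g unfolding lead_def by simp
qed

lemma lead_change:
  assumes f: "lead f p m" and a: "p < a" and agree: "\<And>x. x \<le> a \<Longrightarrow> app g x = app f x"
  shows "lead g p m"
proof -
  have "rg (app g) p m" using f a agree by (subst rg_cong[of p a _ "app f"]) (auto simp: lead_def)
  then show ?thesis using f a agree by (auto simp: lead_def)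
qed

lemma lead_eventually_agree:
  assumes "lead f p m" "lead g p m" "b > p"
  obtains a where "dyadic a" "p < a" "a < b" "\<And>x. x \<le> a \<Longrightarrow> app f x = app g x"
proof -
  have f: "\<And>x. x \<le> p \<Longrightarrow> app f x = x" "rg (app f) p m" and g: "\<And>x. x \<le> p \<Longrightarrow> app g x = x" "rg (app g) p m"
    using assms unfolding lead_def by blast+
  obtain c where c: "p < c" "c < b" "\<And>y. p < y \<Longrightarrow> y \<le> c \<Longrightarrow> app f y = app f p + 2 powi m * (y - p)"
    using rgE[OF f(2) assms(3)] by metis
  obtain d where d: "p < d" "d < b" "\<And>y. p < y \<Longrightarrow> y \<le> d \<Longrightarrow> app g y = app g p + 2 powi m * (y - p)"
    using rgE[OF g(2) assms(3)] by metis
  obtain a where a: "dyadic a" "p < a" "a < min c d" using dyadic_dense[of p "min c d"] c d by auto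
  show thesis
  proof (rule that[OF a(1,2)])
    fix x assume "x \<le> a"
    then show "app f x = app g x" using f(1) g(1) c(3)[of x] d(3)[of x] a by (cases "x \<le> p") auto
  qed (use a c in auto)
qed

subsection \<open>Reversal of the interval\<close>

definition flip :: "thompson \<Rightarrow> thompson" where
  "flip f = Abs_thompson (\<lambda>x. 1 - app f (1 - x))"

lemma app_flip: "app (flip f) = (\<lambda>x. 1 - app f (1 - x))"
proof -
  have "(\<lambda>x. 1 - app f (1 - x)) \<in> thompsonF"
    by (auto simp: thompsonF_iff pl2_flip not_le)
  then show ?thesis by (simp add: flip_def Abs_thompson_inverse)
qed

lemma flip_flip [simp]: "flip (flip f) = f"
  by (rule thompson_eqI) (simp add: app_flip)

lemma flip_plus: "flip (f + g) = flip f + flip g"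
  by (rule thompson_eqI) (simp add: app_flip)

lemma flip_zero [simp]: "flip 0 = 0"
  by (rule thompson_eqI) (simp add: app_flip)

lemma flip_uminus: "flip (- f) = - flip f"
  by (rule minus_unique[symmetric]) (simp flip: flip_plus)

lemma flip_diff: "flip (f - g) = flip f - flip g"
  by (simp add: diff_conv_add_uminus flip_plus flip_uminus del: add_uminus_conv_diff)

lemma flip_eq_0_iff [simp]: "flip f = 0 \<longleftrightarrow> f = 0"
  by (metis flip_flip flip_zero)

text \<open>Reflection of the graph through its centre keeps slopes, so left ends become right ends
  with the same exponent. Most facts about \<open>trail\<close> and \<open>slope1\<close> are
  obtained in this way.\<close>

lemma lead_flip: "lead (flip f) p m \<longleftrightarrow> trail f (1 - p) m"
proof -
  have "(\<forall>x\<le>p. app (flip f) x = x) \<longleftrightarrow> (\<forall>x\<ge>1 - p. app f x = x)"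
  proof (intro iffI allI impI)
    fix x assume "\<forall>x\<le>p. app (flip f) x = x" "1 - p \<le> x"
    then have "app (flip f) (1 - x) = 1 - x" by simp
    then show "app f x = x" by (simp add: app_flip)
  qed (simp add: app_flip)
  then show ?thesis unfolding lead_def trail_def app_flip rg_flip by simp
qed

lemma trail_exists:
  assumes "f \<noteq> 0" obtains q n where "trail f q n"
  using assms by (metis flip_eq_0_iff lead_exists lead_flip)

lemma trail_range:
  assumes "trail f p m" shows "0 < p" "p \<le> 1" "dyadic p"
  using lead_range[of "flip f" "1 - p" m] assms dyadic_diff[of 1 "1 - p"] by (auto simp: lead_flip)

lemma trail_uminus: "trail f p m \<Longrightarrow> trail (- f) p (- m)"
  using lead_uminus[of "flip f" "1 - p" m] by (simp add: lead_flip flip: flip_uminus)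

lemma trail_conj:
  assumes "trail f p m" shows "trail (h + f - h) (app h p) m"
proof -
  have "lead (flip h + flip f - flip h) (app (flip h) (1 - p)) m"
    by (rule lead_conj) (simp add: lead_flip assms)
  then show ?thesis by (simp add: lead_flip app_flip flip: flip_plus flip_diff)
qed

lemma trail_plus:
  assumes "trail f p m" "trail g p n" "m + n \<noteq> 0" shows "trail (f + g) p (m + n)"
  using lead_plus[of "flip f" "1 - p" m "flip g" n] assms by (simp add: lead_flip flip: flip_plus)

lemma trail_plus_right:
  assumes "trail f p m" "\<And>x. q \<le> x \<Longrightarrow> app g x = x" "q < p"
  shows "trail (f + g) p m" "trail (g + f) p m"
proof -
  have "app (flip g) x = x" if "x \<le> 1 - q" for x using assms(2)[of "1 - x"] that by (simp add: app_flip)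
  then show "trail (f + g) p m" "trail (g + f) p m"
    using lead_plus_left[of "flip f" "1 - p" m "1 - q" "flip g"] assms
    by (simp_all add: lead_flip flip: flip_plus)
qed

lemma lead_trail_supported:
  "lead f p m \<Longrightarrow> trail f q n \<Longrightarrow> supported f p q"
  by (auto simp: lead_def trail_def supported_def)

lemma lead_less_trail:
  assumes "lead f p m" "trail f q n" shows "p < q"
proof (rule ccontr)
  assume "\<not> p < q"
  then have "app f x = x" for x using assms by (cases "x \<le> p") (auto simp: lead_def trail_def)
  then have "f = 0" by (intro thompson_eqI) simp
  then show False using assms lead_nonzero by blast
qed

subsection \<open>Slopes at the end points\<close>

definition slope0 :: "thompson \<Rightarrow> int" where
  "slope0 f = (THE k. rg (app f) 0 k)"

definition slope1 :: "thompson \<Rightarrow> int" where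
  "slope1 f = (THE k. lg (app f) 1 k)"

lemma rg_slope0: "rg (app f) 0 (slope0 f)"
proof -
  obtain k where k: "rg (app f) 0 k" using pl2_germs[OF app_pl2] by metis
  show ?thesis unfolding slope0_def by (rule theI[of _ k]) (use k rg_unique in blast)+
qed

lemma lg_slope1: "lg (app f) 1 (slope1 f)"
proof -
  obtain k where k: "lg (app f) 1 k" using pl2_germs[OF app_pl2] by metis
  show ?thesis unfolding slope1_def by (rule theI[of _ k]) (use k lg_unique in blast)+
qed

lemma slope0_eqI: "rg (app f) 0 k \<Longrightarrow> slope0 f = k"
  using rg_slope0 rg_unique by blast

lemma slope1_eqI: "lg (app f) 1 k \<Longrightarrow> slope1 f = k"
  using lg_slope1 lg_unique by blast

lemma slope0_plus [simp]: "slope0 (f + g) = slope0 f + slope0 g"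
  by (rule slope0_eqI) (use rg_plus[of f g 0] rg_slope0 in simp)

lemma slope0_zero [simp]: "slope0 0 = 0"
  using slope0_plus[of 0 0] by simp

lemma slope0_uminus [simp]: "slope0 (- f) = - slope0 f"
  using slope0_plus[of f "- f"] by (simp del: slope0_plus)

lemma slope0_diff [simp]: "slope0 (f - g) = slope0 f - slope0 g"
  using slope0_plus[of f "- g"] by simp

lemma slope0_flip [simp]: "slope0 (flip f) = slope1 f"
  by (rule slope0_eqI) (simp add: app_flip rg_flip lg_slope1)

lemma slope1_flip [simp]: "slope1 (flip f) = slope0 f"
  using slope0_flip[of "flip f"] by simp

lemma slope1_plus [simp]: "slope1 (f + g) = slope1 f + slope1 g"
  using slope0_plus[of "flip f" "flip g"] by (simp flip: flip_plus)

lemma slope1_zero [simp]: "slope1 0 = 0"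
  using slope1_plus[of 0 0] by simp

lemma slope1_uminus [simp]: "slope1 (- f) = - slope1 f"
  using slope1_plus[of f "- f"] by (simp del: slope1_plus)

lemma slope1_diff [simp]: "slope1 (f - g) = slope1 f - slope1 g"
  using slope1_plus[of f "- g"] by simp

lemma lead_0_iff: "lead f 0 m \<longleftrightarrow> slope0 f = m \<and> m \<noteq> 0"
  using rg_slope0[of f] rg_unique[of "app f" 0] unfolding lead_def by auto

lemma trail_1_iff: "trail f 1 m \<longleftrightarrow> slope1 f = m \<and> m \<noteq> 0"
  using lead_0_iff[of "flip f" m] by (simp add: lead_flip)

lemma lead_pos_iff: "lead f p m \<Longrightarrow> 0 < p \<longleftrightarrow> slope0 f = 0"
  using lead_range(1)[of f p m] lead_0_iff[of f "slope0 f"] lead_0_iff[of f m] lead_point_unique(1)[of f p m 0]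
  by (cases "p = 0") force+

lemma trail_less_iff: "trail f q n \<Longrightarrow> q < 1 \<longleftrightarrow> slope1 f = 0"
  using lead_pos_iff[of "flip f" "1 - q" n] by (simp add: lead_flip)

text \<open>The counterpart of \<open>commF\<close>: the kernel of the two slope homomorphisms. The
  perfectness used later is \<open>normal_subgroup_perfect\<close>.\<close>

definition derived :: "thompson set" where
  "derived = {f. slope0 f = 0 \<and> slope1 f = 0}"

lemma derived_simps [simp]:
  "0 \<in> derived" "f \<in> derived \<Longrightarrow> g \<in> derived \<Longrightarrow> f + g \<in> derived"
  "- f \<in> derived \<longleftrightarrow> f \<in> derived" "f \<in> derived \<Longrightarrow> g \<in> derived \<Longrightarrow> f - g \<in> derived"
  "h + f - h \<in> derived \<longleftrightarrow> f \<in> derived" "flip f \<in> derived \<longleftrightarrow> f \<in> derived"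
  by (auto simp: derived_def)

lemma derived_supported:
  assumes "f \<in> derived" obtains a b where "dyadic a" "dyadic b" "0 < a" "a < b" "b < 1" "supported f a b"
proof (cases "f = 0")
  case True
  obtain a where "dyadic a" "0 < a" "a < 1" using dyadic_dense[of 0 1] by auto
  moreover obtain b where "dyadic b" "a < b" "b < 1" using dyadic_dense[of a 1] \<open>a < 1\<close> by auto
  ultimately show thesis using that True by (auto simp: supported_def)
next
  case False
  obtain p m where p: "lead f p m" using lead_exists[OF False] .
  obtain q n where q: "trail f q n" using trail_exists[OF False] .
  show thesis
    by (rule that[of p q])
      (use p q lead_range trail_range lead_pos_iff[OF p] trail_less_iff[OF q] lead_less_trail[OF p q]
        lead_trail_supported[OF p q] assms in \<open>auto simp: derived_def\<close>)
qed

lemma supported_derived: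
  assumes "supported f a b" "0 < a" "b < 1" shows "f \<in> derived"
proof -
  have "rg (app f) 0 0" by (rule rg_ident[of 0 a]) (use assms in \<open>auto simp: supported_def\<close>)
  moreover have "lg (app f) 1 0" by (rule lg_ident[of b 1]) (use assms in \<open>auto simp: supported_def\<close>)
  ultimately show ?thesis using slope0_eqI slope1_eqI by (auto simp: derived_def)
qed

subsection \<open>Normal subgroups and congruence\<close>

definition normal_subgroup :: "'a::group_add set \<Rightarrow> bool" where
  "normal_subgroup D \<longleftrightarrow> 0 \<in> D \<and> (\<forall>x\<in>D. \<forall>y\<in>D. x + y \<in> D) \<and> (\<forall>x\<in>D. - x \<in> D) \<and>
     (\<forall>x\<in>D. \<forall>h. h + x - h \<in> D)"

lemma normal_subgroupD:
  assumes "normal_subgroup D"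
  shows "0 \<in> D" "x \<in> D \<Longrightarrow> y \<in> D \<Longrightarrow> x + y \<in> D" "x \<in> D \<Longrightarrow> - x \<in> D" "x \<in> D \<Longrightarrow> h + x - h \<in> D"
  using assms unfolding normal_subgroup_def by blast+

lemma normal_cong_sym:
  assumes "normal_subgroup D" "x - y \<in> D" shows "y - x \<in> D"
  using normal_subgroupD(3)[OF assms] by simp

lemma normal_cong_trans:
  assumes "normal_subgroup D" "x - y \<in> D" "y - z \<in> D" shows "x - z \<in> D"
  using normal_subgroupD(2)[OF assms] by (simp add: algebra_simps flip: add.assoc)

lemma normal_cong_add:
  assumes D: "normal_subgroup D" and "x - y \<in> D" "x' - y' \<in> D"
  shows "(x + x') - (y + y') \<in> D"
proof -
  have "(x + (x' - y') - x) + (x - y) \<in> D"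
    using normal_subgroupD[OF D] assms by blast
  moreover have "(x + (x' - y') - x) + (x - y) = (x + x') - (y + y')"
    by (simp add: diff_add_eq_diff_diff_swap add_diff_eq)
  ultimately show ?thesis by simp
qed

primrec nmul :: "nat \<Rightarrow> 'a::monoid_add \<Rightarrow> 'a" where
  "nmul 0 x = 0"
| "nmul (Suc n) x = x + nmul n x"

lemma nmul_add: "nmul (m + n) x = nmul m x + nmul n x"
  by (induction m) (simp_all add: add.assoc)

lemma nmul_1 [simp]: "nmul 1 x = x"
  by simp

lemma nmul_commute: "x + nmul n x = nmul n x + x"
  using nmul_add[of 1 n x] nmul_add[of n 1 x] by simp

lemma nmul_nmul: "nmul m (nmul n x) = nmul (m * n) x"
  by (induction m) (simp_all add: nmul_add)

lemma nmul_conj: "nmul j (h + x - h) = h + nmul j x - (h :: 'a :: group_add)"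
  by (induction j) (simp_all add: add_diff_eq flip: add.assoc)

lemma nmul_plus_commute:
  fixes x y :: "'a::group_add"
  assumes "x + y = y + x" shows "nmul j (x + y) = nmul j x + nmul j y"
proof (induction j)
  case (Suc j)
  have c: "y + nmul j x = nmul j x + y"
  proof (induction j)
    case (Suc j)
    then show ?case using assms by (metis add.assoc nmul.simps(2))
  qed simp
  have "nmul (Suc j) (x + y) = x + (y + nmul j x) + nmul j y"
    by (simp only: nmul.simps add.assoc Suc.IH)
  also have "\<dots> = nmul (Suc j) x + nmul (Suc j) y" by (simp only: c nmul.simps add.assoc)
  finally show ?case .
qed simp

lemma nmul_uminus: "nmul j (- x) = - nmul j (x :: 'a :: group_add)"
proof (induction j)
  case (Suc j)
  then show ?case using nmul_commute[of x j] by (simp add: minus_add del: add_uminus_conv_diff)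
qed simp

lemma supported_nmul: "supported v a b \<Longrightarrow> supported (nmul j v) a b"
  by (induction j) (auto simp: supported_def)

lemma slope_nmul: "slope0 (nmul j f) = int j * slope0 f" "slope1 (nmul j f) = int j * slope1 f"
  by (induction j) (simp_all add: algebra_simps)

subsection \<open>The derived subgroup is perfect\<close>

text \<open>The elements \<open>yy c\<close> stretch \<open>[c, c + \<delta>]\<close> by 2 and then shift by \<open>\<delta>\<close> until the common
  tail \<open>tau\<close> closes up at \<open>R + 2\<delta>\<close>. They are all conjugate, and an arbitrary element supported in
  \<open>[p, R]\<close> is a quotient of two products of equally many of them.\<close>

locale staircase =
  fixes p \<delta> R :: real
  assumes dy: "dyadic p" "dyadic \<delta>" "dyadic R"
    and pos: "0 < \<delta>" "0 < p - \<delta>" and room: "R + 2 * \<delta> < 1" "p + \<delta> \<le> R"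
begin

text \<open>Slope 1/2 on \<open>[R, R + 2 * \<delta>]\<close> absorbs the translation:
  \<open>R\<close> goes to \<open>R + \<delta>\<close> and \<open>R + 2 * \<delta>\<close> stays
  fixed.\<close>

definition tau :: "real \<Rightarrow> real" where
  "tau x = (if x \<le> R then x + \<delta> else if x \<le> R + 2 * \<delta> then (x + R + 2 * \<delta>) / 2 else x)"

definition y :: "real \<Rightarrow> real \<Rightarrow> real" where
  "y c x = (if x \<le> c then x else if x \<le> c + \<delta> then 2 * x - c else tau x)"

definition yy :: "real \<Rightarrow> thompson" where
  "yy c = Abs_thompson (y c)"

lemma tau_pl2: "tau \<in> pl2"
proof -
  define g where "g = (\<lambda>x. if x \<le> R + 2 * \<delta> then 2 powi (- 1) * x + (R + 2 * \<delta>) / 2 else id x)"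
  have "g \<in> pl2" unfolding g_def
    by (rule pl2_glue[OF pl2_affine pl2_id]) (auto intro!: dyadic_div2 dyadic_add dyadic_mult dy)
  then have "(\<lambda>x. if x \<le> R then 2 powi 0 * x + \<delta> else g x) \<in> pl2"
    by (rule pl2_glue[OF pl2_affine[OF dy(2)]]) (use dy pos in \<open>auto simp: g_def field_simps\<close>)
  moreover have "(\<lambda>x. if x \<le> R then 2 powi 0 * x + \<delta> else g x) = tau"
    by (rule ext) (auto simp: tau_def g_def field_simps)
  ultimately show ?thesis by simp
qed

lemma y_pl2:
  assumes "dyadic c" "c + \<delta> \<le> R" shows "y c \<in> pl2"
proof -
  define g where "g = (\<lambda>x. if x \<le> c + \<delta> then 2 powi 1 * x + - c else tau x)"
  have "g \<in> pl2" unfolding g_def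
    by (rule pl2_glue[OF pl2_affine tau_pl2]) (use assms in \<open>auto intro!: dyadic_add dy simp: tau_def\<close>)
  then have "(\<lambda>x. if x \<le> c then id x else g x) \<in> pl2"
    by (rule pl2_glue[OF pl2_id]) (use assms pos in \<open>auto simp: g_def\<close>)
  moreover have "(\<lambda>x. if x \<le> c then id x else g x) = y c"
    by (rule ext) (auto simp: y_def g_def)
  ultimately show ?thesis by simp
qed

lemma app_yy:
  assumes "dyadic c" "0 \<le> c" "c + \<delta> \<le> R" shows "app (yy c) x = y c x"
proof -
  have "y c \<in> thompsonF" unfolding thompsonF_iff
    using y_pl2[OF assms(1,3)] assms pos room by (auto simp: y_def tau_def)
  then show ?thesis by (simp add: yy_def Abs_thompson_inverse)
qed

lemma y_simps:
  "x \<le> c \<Longrightarrow> y c x = x" "c \<le> x \<Longrightarrow> x \<le> c + \<delta> \<Longrightarrow> y c x = 2 * x - c"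
  "c + \<delta> \<le> x \<Longrightarrow> c + \<delta> \<le> R \<Longrightarrow> y c x = tau x"
  using pos by (auto simp: y_def tau_def)

lemma tau_simps:
  "x \<le> R \<Longrightarrow> tau x = x + \<delta>" "c + \<delta> \<le> R \<Longrightarrow> c \<le> x \<Longrightarrow> c + \<delta> \<le> tau x" "x \<le> tau x"
  using pos by (auto simp: tau_def field_simps)

text \<open>To the right of \<open>p\<close> the conjugating element is \<open>tau\<close>, which
  translates by \<open>\<delta>\<close> up to \<open>R\<close>; hence it moves the doubling cell of
  \<open>yy c\<close> to that of \<open>yy (c + \<delta>)\<close>. Up to conventions these are the
  relations of the infinite presentation of Thompson's group.\<close>

lemma yy_shift:
  assumes c: "dyadic c" "p \<le> c" "c + 2 * \<delta> \<le> R"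
  shows "yy (p - \<delta>) + yy c - yy (p - \<delta>) = yy (c + \<delta>)"
proof -
  have "yy (c + \<delta>) + yy (p - \<delta>) = yy (p - \<delta>) + yy c"
  proof (rule thompson_eqI)
    fix x
    have "y (c + \<delta>) (y (p - \<delta>) x) = y (p - \<delta>) (y c x)"
    proof -
      consider "x \<le> p - \<delta>" | "p - \<delta> \<le> x" "x \<le> p" | "p \<le> x" "x \<le> c" | "c \<le> x" "x \<le> c + \<delta>" | "c + \<delta> \<le> x"
        by linarith
      then show ?thesis
      proof cases
        case 1 then show ?thesis using c pos by (simp add: y_simps)
      next
        case 2 then show ?thesis using c pos by (simp add: y_simps)
      next
        case 3 then show ?thesis using c pos by (simp add: y_simps tau_simps)
      next
        case 4 then show ?thesis using c pos by (simp add: y_simps tau_simps)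
      next
        \<comment> \<open>Both sides are equal to \<open>tau (tau x)\<close> here.\<close>
        case 5
        then have "c + 2 * \<delta> \<le> tau x" "c + \<delta> \<le> tau x" using tau_simps(2)[of "c + \<delta>" x] c pos by auto
        then show ?thesis using c pos 5 by (simp add: y_simps)
      qed
    qed
    then show "app (yy (c + \<delta>) + yy (p - \<delta>)) x = app (yy (p - \<delta>) + yy c) x"
      using c pos room dy by (simp add: app_yy dyadic_add dyadic_diff)
  qed
  then show ?thesis by (metis add_diff_cancel)
qed

lemma yy_derived:
  assumes "dyadic c" "0 < c" "c + \<delta> \<le> R" shows "yy c \<in> derived"
  by (rule supported_derived[of _ c "R + 2 * \<delta>"])
    (use assms pos room in \<open>auto simp: supported_def app_yy y_def tau_def\<close>)

lemma tau_pow: "x + real n * \<delta> \<le> R + \<delta> \<Longrightarrow> (tau ^^ n) x = x + real n * \<delta>"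
proof (induction n)
  case (Suc n)
  then have "x + real n * \<delta> \<le> R" by (simp add: algebra_simps)
  then show ?case using Suc pos by (simp add: tau_simps algebra_simps)
qed simp

lemma tau_pow_ge: "x \<le> (tau ^^ n) x"
proof (induction n)
  case (Suc n) then show ?case using tau_simps(3)[of "(tau ^^ n) x"] by simp
qed simp

definition pt :: "nat \<Rightarrow> real" where
  "pt i = p + real i * \<delta>"

lemma pt_props [simp]: "dyadic (pt i)" "p \<le> pt i" "0 < pt i" "0 \<le> pt i" "pt (Suc i) = pt i + \<delta>"
proof -
  show "dyadic (pt i)" unfolding pt_def by (intro dyadic_add dyadic_mult dy) simp
  show "p \<le> pt i" unfolding pt_def using pos by simp
  then show "0 < pt i" "0 \<le> pt i" using pos by linarith+
  show "pt (Suc i) = pt i + \<delta>" by (simp add: pt_def algebra_simps)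
qed

context
  fixes D :: "thompson set"
  assumes D: "normal_subgroup D" and comm: "\<And>z v. v \<in> derived \<Longrightarrow> z + v - z - v \<in> D"
begin

text \<open>By \<open>yy_shift\<close> neighbouring basic elements differ by a commutator with an
  element of F', hence by an element of \<open>D\<close>. Modulo \<open>D\<close> only the number of
  basic factors in a product counts.\<close>

lemma yy_cong: "pt i + \<delta> \<le> R \<Longrightarrow> yy (pt i) - yy p \<in> D"
proof (induction i)
  case 0 then show ?case using normal_subgroupD(1)[OF D] by (simp add: pt_def)
next
  case (Suc i)
  have "yy (p - \<delta>) + yy (pt i) - yy (p - \<delta>) = yy (pt (Suc i))"
    using yy_shift[of "pt i"] Suc.prems by simp
  moreover have "yy (pt i) \<in> derived" by (rule yy_derived) (use Suc.prems pos in auto)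
  ultimately have "yy (pt (Suc i)) - yy (pt i) \<in> D" using comm by metis
  then show ?case using Suc pos normal_cong_trans[OF D] by simp
qed

text \<open>Stretching one cell by \<open>2 ^ k\<close> costs \<open>2 ^ k - 1\<close> basic
  elements. For the next power the cell is first doubled by one basic element; its two halves, which
  now fill two adjacent cells, are then stretched by \<open>v\<close> (right) and \<open>w\<close>
  (left). The count is \<open>2 * (2 ^ k - 1) + 1 = 2 ^ (k + 1) - 1\<close>, and as many copies of
  \<open>tau\<close> act to the right of the cell.\<close>

lemma stretch_one:
  assumes "pt i + \<delta> * 2 ^ k \<le> R"
  shows "\<exists>w. w - nmul (2 ^ k - 1) (yy p) \<in> D \<and> (\<forall>x\<le>pt i. app w x = x) \<and>
    (\<forall>x\<in>{pt i..pt i + \<delta>}. app w x = pt i + 2 ^ k * (x - pt i)) \<and>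
    (\<forall>x\<ge>pt i + \<delta>. app w x = (tau ^^ (2 ^ k - 1)) x)"
  using assms
proof (induction k arbitrary: i)
  case 0
  show ?case by (rule exI[of _ 0]) (use normal_subgroupD(1)[OF D] in simp)
next
  case (Suc k)
  have k1: "\<delta> \<le> \<delta> * 2 ^ k" using pos by simp
  have R2: "pt i + \<delta> + \<delta> * 2 ^ k \<le> R" using Suc.prems k1 by simp
  then have R1: "pt i + \<delta> * 2 ^ k \<le> R" "pt i + 2 * \<delta> \<le> R" using pos k1 by linarith+
  obtain w where w: "w - nmul (2 ^ k - 1) (yy p) \<in> D" "\<And>x. x \<le> pt i \<Longrightarrow> app w x = x"
    "\<And>x. pt i \<le> x \<Longrightarrow> x \<le> pt i + \<delta> \<Longrightarrow> app w x = pt i + 2 ^ k * (x - pt i)"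
    "\<And>x. pt i + \<delta> \<le> x \<Longrightarrow> app w x = (tau ^^ (2 ^ k - 1)) x"
    using Suc.IH[OF R1(1)] by auto
  obtain v where v: "v - nmul (2 ^ k - 1) (yy p) \<in> D" "\<And>x. x \<le> pt i + \<delta> \<Longrightarrow> app v x = x"
    "\<And>x. pt i + \<delta> \<le> x \<Longrightarrow> x \<le> pt i + 2 * \<delta> \<Longrightarrow> app v x = pt i + \<delta> + 2 ^ k * (x - (pt i + \<delta>))"
    "\<And>x. pt i + 2 * \<delta> \<le> x \<Longrightarrow> app v x = (tau ^^ (2 ^ k - 1)) x"
    using Suc.IH[of "Suc i"] R2 by (auto simp: algebra_simps)
  have yx: "app (yy (pt i)) x = y (pt i) x" for x using R1 pos by (intro app_yy) auto
  have e: "(2::nat) ^ Suc k - 1 = (2 ^ k - 1) + ((2 ^ k - 1) + 1)"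
    using one_le_power[of "2::nat" k] by simp
  have "yy (pt i) - nmul 1 (yy p) \<in> D" using yy_cong[of i] R1 pos by simp
  then have "(w + (v + yy (pt i))) - nmul (2 ^ Suc k - 1) (yy p) \<in> D"
    unfolding e nmul_add by (intro normal_cong_add[OF D] w v)
  moreover have "app (w + (v + yy (pt i))) x = x" if "x \<le> pt i" for x
    using that w(2) v(2) pos by (simp add: yx y_simps)
  moreover have "app (w + (v + yy (pt i))) x = pt i + 2 ^ Suc k * (x - pt i)"
    if x: "pt i \<le> x" "x \<le> pt i + \<delta>" for x
  \<comment> \<open>Doubling sends the left half of the cell onto cell \<open>i\<close>, which
    \<open>v\<close> fixes, and the right half onto cell \<open>i + 1\<close>, where
    \<open>w\<close> merely translates the result of \<open>v\<close> by
    \<open>(2 ^ k - 1) * \<delta>\<close>.\<close>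
  proof (cases "x \<le> pt i + \<delta> / 2")
    case True
    then have "app (w + (v + yy (pt i))) x = pt i + 2 ^ k * (2 * x - pt i - pt i)"
      using x v(2)[of "2 * x - pt i"] w(3)[of "2 * x - pt i"] by (simp add: yx y_simps)
    then show ?thesis by (simp add: algebra_simps)
  next
    case False
    define u where "u = app v (2 * x - pt i)"
    have u: "u = pt i + \<delta> + 2 ^ k * (2 * x - pt i - (pt i + \<delta>))"
      unfolding u_def by (rule v(3)) (use False x in auto)
    have "2 ^ k * (2 * x - pt i - (pt i + \<delta>)) \<le> 2 ^ k * \<delta>" "0 \<le> 2 ^ k * (2 * x - pt i - (pt i + \<delta>))"
      using x False by auto
    then have u1: "pt i + \<delta> \<le> u" "u \<le> pt i + \<delta> + \<delta> * 2 ^ k" unfolding u by (simp_all add: mult.commute)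
    have r: "real (2 ^ k - 1) = 2 ^ k - 1" by (simp add: of_nat_diff)
    have "u + real (2 ^ k - 1) * \<delta> \<le> R + \<delta>"
      using u1(2) Suc.prems pos unfolding r by (simp add: algebra_simps)
    then have "app w u = u + real (2 ^ k - 1) * \<delta>" using w(4)[OF u1(1)] tau_pow by simp
    then have "app (w + (v + yy (pt i))) x = u + real (2 ^ k - 1) * \<delta>"
      using x by (simp add: yx y_simps u_def)
    then show ?thesis unfolding u r by (simp add: algebra_simps)
  qed
  moreover have "app (w + (v + yy (pt i))) x = (tau ^^ (2 ^ Suc k - 1)) x" if x: "pt i + \<delta> \<le> x" for x
  proof -
    have a: "pt i + 2 * \<delta> \<le> tau x" using tau_simps(2)[of "pt i + \<delta>" x] x R1 by simp
    have b: "pt i + \<delta> \<le> (tau ^^ (2 ^ k - 1)) (tau x)" using a pos tau_pow_ge[of "tau x" "2 ^ k - 1"] by linarith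
    have "app (yy (pt i)) x = tau x" using x R1 pos by (simp add: yx y_simps)
    then have "app (w + (v + yy (pt i))) x = (tau ^^ (2 ^ k - 1)) ((tau ^^ (2 ^ k - 1)) (tau x))"
      using v(4)[OF a] w(4)[OF b] by simp
    also have "\<dots> = (tau ^^ (2 ^ Suc k - 1)) x" unfolding e funpow_add by simp
    finally show ?thesis .
  qed
  ultimately show ?case by (intro exI[of _ "w + (v + yy (pt i))"]) auto
qed

text \<open>The cells are stretched from right to left: each new factor acts on the images of the
  later cells by translation, so that the images stay adjacent. As one cell costs
  \<open>2 ^ a - 1\<close>, the number \<open>n\<close> depends only on the number of cells and the
  total length of the images.\<close>

lemma stretch_list:
  assumes "pt i + \<delta> * (\<Sum>a\<leftarrow>as. 2 ^ a) \<le> R"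
  shows "\<exists>w n. n + length as = (\<Sum>a\<leftarrow>as. 2 ^ a) \<and> w - nmul n (yy p) \<in> D \<and> (\<forall>x\<le>pt i. app w x = x) \<and>
    (\<forall>j<length as. \<forall>x\<in>{pt (i + j)..pt (i + j) + \<delta>}.
       app w x = pt i + \<delta> * (\<Sum>a\<leftarrow>take j as. 2 ^ a) + 2 ^ (as ! j) * (x - pt (i + j))) \<and>
    (\<forall>x\<ge>pt (i + length as). app w x = (tau ^^ n) x)"
  using assms
proof (induction as arbitrary: i)
  case Nil
  show ?case by (intro exI[of _ 0]) (use normal_subgroupD(1)[OF D] in simp)
next
  case (Cons a as)
  define S :: real where "S = (\<Sum>a\<leftarrow>as. 2 ^ a)"
  have S0: "0 \<le> S" unfolding S_def by (rule sum_list_nonneg) auto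
  have RS: "pt i + \<delta> * 2 ^ a + \<delta> * S \<le> R" using Cons.prems by (simp add: S_def algebra_simps)
  have a1: "\<delta> \<le> \<delta> * 2 ^ a" using pos by simp
  have "pt (Suc i) + \<delta> * (\<Sum>a\<leftarrow>as. 2 ^ a) \<le> R" using RS a1 by (simp flip: S_def)
  from Cons.IH[OF this] obtain v n where v: "n + length as = (\<Sum>a\<leftarrow>as. 2 ^ a)" "v - nmul n (yy p) \<in> D"
    "\<And>x. x \<le> pt i + \<delta> \<Longrightarrow> app v x = x"
    "\<And>j x. j < length as \<Longrightarrow> pt (Suc i + j) \<le> x \<Longrightarrow> x \<le> pt (Suc i + j) + \<delta> \<Longrightarrow>
       app v x = pt i + \<delta> + \<delta> * (\<Sum>a\<leftarrow>take j as. 2 ^ a) + 2 ^ (as ! j) * (x - pt (Suc i + j))"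
    "\<And>x. pt (Suc i + length as) \<le> x \<Longrightarrow> app v x = (tau ^^ n) x"
    by auto
  have "pt i + \<delta> * 2 ^ a \<le> R" using RS S0 pos mult_nonneg_nonneg[of \<delta> S] by linarith
  then obtain w where w: "w - nmul (2 ^ a - 1) (yy p) \<in> D" "\<And>x. x \<le> pt i \<Longrightarrow> app w x = x"
    "\<And>x. pt i \<le> x \<Longrightarrow> x \<le> pt i + \<delta> \<Longrightarrow> app w x = pt i + 2 ^ a * (x - pt i)"
    "\<And>x. pt i + \<delta> \<le> x \<Longrightarrow> app w x = (tau ^^ (2 ^ a - 1)) x"
    using stretch_one[of i a] by auto
  have r: "real (2 ^ a - 1) = 2 ^ a - 1" by (simp add: of_nat_diff)
  have "(2 ^ a - 1 + n) + length (a # as) = (\<Sum>a\<leftarrow>a # as. 2 ^ a)"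
  proof -
    have "(2::nat) ^ a \<ge> 1" by simp
    then show ?thesis using v(1) unfolding list.size list.map sum_list.Cons by linarith
  qed
  moreover have "(w + v) - nmul (2 ^ a - 1 + n) (yy p) \<in> D"
    unfolding nmul_add by (intro normal_cong_add[OF D] w v)
  moreover have "app (w + v) x = x" if "x \<le> pt i" for x
    using that w(2) v(3) pos by simp
  moreover have "app (w + v) x = pt i + \<delta> * (\<Sum>a\<leftarrow>take j (a # as). 2 ^ a) + 2 ^ ((a # as) ! j) * (x - pt (i + j))"
    if j: "j < length (a # as)" and x: "pt (i + j) \<le> x" "x \<le> pt (i + j) + \<delta>" for j x
  proof (cases j)
    case 0
    then show ?thesis using x v(3) w(3) by simp
  next
    case (Suc l)
    then have l: "l < length as" using j by simp
    define T :: real where "T = (\<Sum>a\<leftarrow>take l as. 2 ^ a)"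
    have T0: "0 \<le> T" unfolding T_def by (rule sum_list_nonneg) auto
    have "S = (\<Sum>a\<leftarrow>take l as @ as ! l # drop (Suc l) as. 2 ^ a)" unfolding S_def using id_take_nth_drop[OF l] by simp
    then have "S = T + 2 ^ (as ! l) + (\<Sum>a\<leftarrow>drop (Suc l) as. 2 ^ a)" by (simp add: T_def)
    moreover have "(\<Sum>a\<leftarrow>drop (Suc l) as. 2 ^ a) \<ge> (0::real)" by (rule sum_list_nonneg) auto
    ultimately have TS: "T + 2 ^ (as ! l) \<le> S" by linarith
    define u where "u = app v x"
    define t where "t = x - pt (Suc i + l)"
    have t: "0 \<le> t" "t \<le> \<delta>" using x Suc by (auto simp: t_def)
    have u: "u = pt i + \<delta> + \<delta> * T + 2 ^ (as ! l) * t"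
      unfolding u_def T_def t_def by (rule v(4)[OF l]) (use x Suc in auto)
    have "0 \<le> \<delta> * T" "0 \<le> 2 ^ (as ! l) * t" "2 ^ (as ! l) * t \<le> 2 ^ (as ! l) * \<delta>" using t T0 pos by auto
    then have u1: "pt i + \<delta> \<le> u" "u \<le> pt i + \<delta> + \<delta> * (T + 2 ^ (as ! l))"
      unfolding u by (simp_all add: algebra_simps)
    \<comment> \<open>The bound on the total length leaves enough room below \<open>R\<close> for
      the powers of \<open>tau\<close> in \<open>w\<close> to act on \<open>u\<close> as
      translations.\<close>
    have "\<delta> * (T + 2 ^ (as ! l)) \<le> \<delta> * S" using TS pos by (intro mult_left_mono) auto
    then have "u + real (2 ^ a - 1) * \<delta> \<le> R + \<delta>"
      using u1(2) RS pos unfolding r by (simp add: algebra_simps)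
    then have "app (w + v) x = u + real (2 ^ a - 1) * \<delta>" using w(4)[OF u1(1)] tau_pow by (simp add: u_def)
    then show ?thesis unfolding u r using Suc by (simp add: T_def t_def algebra_simps)
  qed
  moreover have "app (w + v) x = (tau ^^ (2 ^ a - 1 + n)) x" if x: "pt (i + length (a # as)) \<le> x" for x
  proof -
    have "pt i + \<delta> \<le> pt (Suc i + length as)" using pos by (simp add: pt_def algebra_simps)
    then have "pt i + \<delta> \<le> (tau ^^ n) x" using x tau_pow_ge[of x n] by simp
    then have "app w ((tau ^^ n) x) = (tau ^^ (2 ^ a - 1)) ((tau ^^ n) x)" by (rule w(4))
    moreover have "app v x = (tau ^^ n) x" using v(5)[of x] x by simp
    ultimately show ?thesis by (simp only: app_plus funpow_add o_apply)
  qed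
  ultimately show ?case by (intro exI[of _ "w + v"] exI[of _ "2 ^ a - 1 + n"] conjI) auto
qed

end

end

text \<open>\<open>g\<close> is written as \<open>V - U\<close>: \<open>U\<close> spreads
  \<open>L\<close> cells of width \<open>\<delta>\<close> uniformly over \<open>[p,q]\<close>, and
  \<open>V\<close> spreads them with the additional slopes of \<open>g\<close>, so that
  \<open>V\<close> is \<open>U\<close> followed by \<open>g\<close>. Both images fill
  \<open>[p,q]\<close>; hence both products have equally many basic factors and are congruent modulo
  \<open>D\<close>.\<close>

theorem normal_subgroup_perfect:
  assumes D: "normal_subgroup D" and comm: "\<And>z v. v \<in> derived \<Longrightarrow> z + v - z - v \<in> D"
    and g: "g \<in> derived"
  shows "g \<in> D"
proof -
  obtain p q where pq: "dyadic p" "dyadic q" "0 < p" "p < q" "q < 1" and sup: "supported g p q"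
    using derived_supported[OF g] .
  obtain N1 where N1: "\<forall>n\<ge>N1. \<forall>m::int. p \<le> of_int m / 2 ^ n \<longrightarrow> of_int (m + 1) / 2 ^ n \<le> q \<longrightarrow>
    (\<exists>k c. \<forall>x\<in>{of_int m / 2 ^ n .. of_int (m + 1) / 2 ^ n}. app g x = 2 powi k * x + c)"
    using pl2_grid[OF app_pl2] by blast
  obtain N2 where N2: "\<forall>n\<ge>N2. \<forall>x\<in>{p, q}. \<exists>j::int. x = of_int j / 2 ^ n"
    using finite_dyadic_common_denominator[of "{p, q}"] pq by auto
  define n where "n = max N1 N2"
  define \<eta> :: real where "\<eta> = 1 / 2 ^ n"
  have \<eta>: "0 < \<eta>" by (simp add: \<eta>_def)
  obtain P Q :: int where PQ: "p = of_int P / 2 ^ n" "q = of_int Q / 2 ^ n"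
    using N2 unfolding n_def by (metis insertI1 insertI2 max.cobounded2)
  have "P < Q" using pq(4) unfolding PQ by (simp add: divide_less_cancel)
  define L where "L = nat (Q - P)"
  have L: "L > 0" "Q = P + int L" using \<open>P < Q\<close> by (simp_all add: L_def)
  have qL: "q = p + real L * \<eta>" by (simp add: PQ L \<eta>_def add_divide_distrib)
  have cells: "\<exists>k c. \<forall>x\<in>{p + real j * \<eta>..p + real (Suc j) * \<eta>}. app g x = 2 powi k * x + c" if "j < L" for j
  proof -
    have e: "of_int (P + int j) / 2 ^ n = p + real j * \<eta>" "of_int (P + int j + 1) / 2 ^ n = p + real (Suc j) * \<eta>"
      by (simp_all add: PQ \<eta>_def add_divide_distrib)
    have "real (Suc j) * \<eta> \<le> real L * \<eta>" using that \<eta> by (intro mult_right_mono) auto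
    moreover have "0 \<le> real j * \<eta>" using \<eta> by simp
    ultimately show ?thesis
      using N1[rule_format, of n "P + int j"] unfolding e qL by (simp add: n_def)
  qed
  then obtain \<kappa> c where \<kappa>: "\<And>j x. j < L \<Longrightarrow> p + real j * \<eta> \<le> x \<Longrightarrow> x \<le> p + real (Suc j) * \<eta> \<Longrightarrow>
    app g x = 2 powi (\<kappa> j) * x + c j"
    by (metis atLeastAtMost_iff)
  \<comment> \<open>\<open>K\<close> will be at least \<open>M\<close>, so that all exponents
    \<open>K + \<kappa> j\<close> of the stretching factors of \<open>V\<close> are
    nonnegative.\<close>
  define M where "M = (\<Sum>j<L. nat \<bar>\<kappa> j\<bar>)"
  have M: "- \<kappa> j \<le> int M" if "j < L" for j
  proof -
    have "nat \<bar>\<kappa> j\<bar> \<le> M" unfolding M_def by (rule member_le_sum) (use that in auto)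
    then show ?thesis by linarith
  qed
  \<comment> \<open>\<open>K\<close> will also be at least \<open>K1\<close>, which makes
    \<open>\<delta>\<close> small enough to leave room for the staircase on both sides of
    \<open>[p,q]\<close>.\<close>
  obtain K1 where K1: "1 / 2 ^ K1 < min p ((1 - q) / 2)"
    using exists_half_power_less[of "min p ((1 - q) / 2)"] pq by auto
  define K where "K = max K1 M"
  define \<delta> where "\<delta> = \<eta> / 2 ^ K"
  have \<delta>: "0 < \<delta>" "dyadic \<delta>" "\<delta> * 2 ^ K = \<eta>"
    using dyadic_mult[of "1 / 2 ^ n" "1 / 2 ^ K"] by (auto simp: \<delta>_def \<eta>_def)
  have "\<delta> \<le> 1 / 2 ^ K1"
  proof -
    have "\<delta> \<le> 1 / 2 ^ K" unfolding \<delta>_def by (rule divide_right_mono) (simp_all add: \<eta>_def)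
    also have "\<dots> \<le> 1 / 2 ^ K1" by (simp add: K_def frac_le power_increasing)
    finally show ?thesis .
  qed
  then have \<delta>2: "\<delta> < p" "q + 2 * \<delta> < 1" using K1 by auto
  have "\<delta> \<le> \<delta> * 2 ^ K" "\<eta> \<le> real L * \<eta>" using \<delta>(1) L \<eta> by auto
  then have "p + \<delta> \<le> q" using \<delta>(3) qL by linarith
  then interpret staircase p \<delta> q
    by unfold_locales (use pq \<delta> \<delta>2 in auto)
  define as bs where "as = replicate L K" "bs = map (\<lambda>j. nat (int K + \<kappa> j)) [0..<L]"
  have las: "length as = L" "length bs = L" by (simp_all add: as_bs_def)
  have bs: "real 2 ^ (bs ! j) * \<delta> = 2 powi \<kappa> j * \<eta>" if "j < L" for j
  proof -
    have "0 \<le> int K + \<kappa> j" using M[OF that] by (simp add: K_def)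
    then have "(2::real) ^ (bs ! j) = 2 powi (int K + \<kappa> j)" using that by (simp add: as_bs_def power_int_def)
    then show ?thesis by (simp add: power_int_add \<delta>_def)
  qed
  have as_sum: "(\<Sum>a\<leftarrow>take j as. 2 ^ a) = real j * 2 ^ K" if "j \<le> L" for j
    using that by (simp add: as_bs_def sum_list_replicate)
  have step: "app g (p + real (Suc j) * \<eta>) = app g (p + real j * \<eta>) + 2 powi \<kappa> j * \<eta>" if "j < L" for j
    using \<kappa>[OF that, of "p + real j * \<eta>"] \<kappa>[OF that, of "p + real (Suc j) * \<eta>"] \<eta> by (simp add: algebra_simps)
  have gp: "app g p = p" "app g q = q" using sup by (auto simp: supported_def)
  have bs_sum: "\<delta> * (\<Sum>a\<leftarrow>take j bs. 2 ^ a) = app g (p + real j * \<eta>) - p" if "j \<le> L" for j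
    using that
  proof (induction j)
    case 0 then show ?case using gp by simp
  next
    case (Suc j)
    then have "j < L" by simp
    then show ?case using Suc.IH bs[of j] step[of j] las
      by (simp add: take_Suc_conv_app_nth algebra_simps)
  qed
  have tot: "\<delta> * (\<Sum>a\<leftarrow>as. 2 ^ a) = q - p" "\<delta> * (\<Sum>a\<leftarrow>bs. 2 ^ a) = q - p"
    using as_sum[of L] bs_sum[of L] las \<delta>(3) gp qL by (simp_all add: algebra_simps)
  have pt0: "pt 0 = p" by (simp add: pt_def)
  obtain U m where U: "m + L = (\<Sum>a\<leftarrow>as. 2 ^ a)" "U - nmul m (yy p) \<in> D" "\<And>x. x \<le> p \<Longrightarrow> app U x = x"
    "\<And>j x. j < L \<Longrightarrow> pt j \<le> x \<Longrightarrow> x \<le> pt j + \<delta> \<Longrightarrow> app U x = p + \<delta> * (\<Sum>a\<leftarrow>take j as. 2 ^ a) + 2 ^ (as ! j) * (x - pt j)"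
    "\<And>x. pt L \<le> x \<Longrightarrow> app U x = (tau ^^ m) x"
    using stretch_list[OF D comm, of 0 as] tot pt0 las by (auto simp del: pt_props)
  obtain V m' where V: "m' + L = (\<Sum>a\<leftarrow>bs. 2 ^ a)" "V - nmul m' (yy p) \<in> D" "\<And>x. x \<le> p \<Longrightarrow> app V x = x"
    "\<And>j x. j < L \<Longrightarrow> pt j \<le> x \<Longrightarrow> x \<le> pt j + \<delta> \<Longrightarrow> app V x = p + \<delta> * (\<Sum>a\<leftarrow>take j bs. 2 ^ a) + 2 ^ (bs ! j) * (x - pt j)"
    "\<And>x. pt L \<le> x \<Longrightarrow> app V x = (tau ^^ m') x"
    using stretch_list[OF D comm, of 0 bs] tot pt0 las by (auto simp del: pt_props)
  have real_sum: "real (\<Sum>a\<leftarrow>xs. 2 ^ a) = (\<Sum>a\<leftarrow>xs. 2 ^ a)" for xs :: "nat list"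
    by (induction xs) auto
  have "\<delta> * real (m + L) = q - p" "\<delta> * real (m' + L) = q - p"
    unfolding U(1) V(1) real_sum by (fact tot)+
  then have mm: "m' = m" and mq: "real m * \<delta> = q - p - real L * \<delta>" using \<delta>(1) by (auto simp: algebra_simps)
  have ptL: "(tau ^^ m) (pt L) = q"
    by (subst tau_pow) (use mq \<delta>(1) in \<open>simp_all add: pt_def\<close>)
  have "g + U = V"
  proof (rule thompson_eqI)
    fix x
    consider "x \<le> p" | "pt L \<le> x" | "p < x" "x < pt L" by linarith
    then show "app (g + U) x = app V x"
    proof cases
      case 1 then show ?thesis using U(3) V(3) sup by (simp add: supported_def)
    next
      \<comment> \<open>Beyond the cells both products are \<open>tau ^^ m\<close> with values at
        least \<open>q\<close>, where \<open>g\<close> is the identity.\<close>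
      case 2
      have "q \<le> app U x" using U(5)[of "pt L"] ptL 2 app_mono(2)[of U "pt L" x] by simp
      then show ?thesis using U(5)[OF 2] V(5)[OF 2] sup mm by (simp add: supported_def)
    next
      case 3
      define j where "j = nat \<lfloor>(x - p) / \<delta>\<rfloor>"
      have "0 \<le> (x - p) / \<delta>" using 3 \<delta>(1) by simp
      then have "real j \<le> (x - p) / \<delta>" "(x - p) / \<delta> < real j + 1" unfolding j_def by linarith+
      then have j1: "pt j \<le> x" "x \<le> pt j + \<delta>" using \<delta>(1) by (auto simp: pt_def field_simps)
      have "real j * \<delta> < real L * \<delta>" using j1(1) 3 unfolding pt_def by linarith
      then have "j < L" using \<delta>(1) by simp
      define t where "t = 2 ^ K * (x - pt j)"
      have "2 ^ K * (x - pt j) \<le> 2 ^ K * \<delta>" using j1 by (intro mult_left_mono) auto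
      then have t: "0 \<le> t" "t \<le> \<eta>" using j1 \<delta>(3) by (auto simp: t_def mult.commute)
      have Ux: "app U x = p + real j * \<eta> + t"
        using U(4)[OF \<open>j < L\<close> j1] as_sum[of j] \<open>j < L\<close> \<delta>(3) by (simp add: as_bs_def t_def algebra_simps)
      have Vx: "app V x = app g (p + real j * \<eta>) + 2 powi \<kappa> j * t"
      proof -
        have "2 ^ (bs ! j) * (x - pt j) = real 2 ^ (bs ! j) * \<delta> * ((x - pt j) / \<delta>)" using \<delta>(1) by simp
        also have "\<dots> = 2 powi \<kappa> j * \<eta> * ((x - pt j) / \<delta>)" unfolding bs[OF \<open>j < L\<close>] ..
        also have "\<dots> = 2 powi \<kappa> j * t" using \<delta>(1) by (simp add: t_def flip: \<delta>(3))
        finally show ?thesis using V(4)[OF \<open>j < L\<close> j1] bs_sum[of j] \<open>j < L\<close> by simp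
      qed
      have "app g (p + real j * \<eta> + t) = app g (p + real j * \<eta>) + 2 powi \<kappa> j * t"
        using \<kappa>[OF \<open>j < L\<close>, of "p + real j * \<eta>"] \<kappa>[OF \<open>j < L\<close>, of "p + real j * \<eta> + t"] t \<eta>
        by (simp add: algebra_simps)
      then show ?thesis using Ux Vx by simp
    qed
  qed
  moreover have "V - U \<in> D"
    using normal_cong_trans[OF D V(2)[unfolded mm] normal_cong_sym[OF D U(2)]] .
  ultimately show ?thesis by (metis add_diff_cancel)
qed

subsection \<open>Positive cones of bi-orderings\<close>

text \<open>Stated for an arbitrary group, because it serves for Thompson's group and for the
  lattice of slope exponents alike.\<close>

definition bi_cone :: "'a::group_add set \<Rightarrow> bool" where
  "bi_cone P \<longleftrightarrow> 0 \<notin> P \<and> (\<forall>x\<in>P. \<forall>y\<in>P. x + y \<in> P) \<and> (\<forall>x. x \<noteq> 0 \<longrightarrow> x \<in> P \<or> - x \<in> P) \<and>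
     (\<forall>x\<in>P. \<forall>h. h + x - h \<in> P)"

lemmas group_norm = diff_add_eq_diff_diff_swap add_diff_eq minus_diff_eq diff_diff_eq2 add.assoc[symmetric]

lemma commute_uminus: "x + y = y + x \<Longrightarrow> - x + y = y + - (x :: 'a :: group_add)"
proof -
  assume "x + y = y + x"
  then have "- x + (x + y) + - x = - x + (y + x) + - x" by (simp only:)
  then show ?thesis by (simp flip: add.assoc)
qed

locale bicone =
  fixes P :: "'a::group_add set"
  assumes bi_cone: "bi_cone P"
begin

lemma zero_notin: "0 \<notin> P"
  and add_closed: "x \<in> P \<Longrightarrow> y \<in> P \<Longrightarrow> x + y \<in> P"
  and total: "x \<noteq> 0 \<Longrightarrow> x \<in> P \<or> - x \<in> P"
  and conj_closed: "x \<in> P \<Longrightarrow> h + x - h \<in> P"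
  using bi_cone unfolding bi_cone_def by blast+

lemma not_both: "x \<in> P \<Longrightarrow> - x \<notin> P"
  using add_closed[of x "- x"] zero_notin by auto

lemma conj_in_iff: "h + x - h \<in> P \<longleftrightarrow> x \<in> P"
proof
  assume "h + x - h \<in> P"
  then have "- h + (h + x - h) - (- h) \<in> P" by (rule conj_closed)
  then show "x \<in> P" by (simp add: add.assoc add_diff_eq[symmetric] flip: add.assoc)
qed (rule conj_closed)

definition lt :: "'a \<Rightarrow> 'a \<Rightarrow> bool" (infix "\<sqsubset>" 50) where
  "x \<sqsubset> y \<longleftrightarrow> y - x \<in> P"

definition le :: "'a \<Rightarrow> 'a \<Rightarrow> bool" (infix "\<sqsubseteq>" 50) where
  "x \<sqsubseteq> y \<longleftrightarrow> x = y \<or> x \<sqsubset> y"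

lemma pos_iff: "x \<in> P \<longleftrightarrow> 0 \<sqsubset> x"
  by (simp add: lt_def)

lemma lt_irrefl [simp]: "\<not> x \<sqsubset> x"
  using zero_notin by (simp add: lt_def)

lemma lt_trans [trans]: "x \<sqsubset> y \<Longrightarrow> y \<sqsubset> z \<Longrightarrow> x \<sqsubset> z"
  using add_closed[of "z - y" "y - x"] by (simp add: lt_def add_diff_eq)

lemma lt_total: "x \<sqsubset> y \<or> x = y \<or> y \<sqsubset> x"
  using total[of "x - y"] by (auto simp: lt_def)

lemma lt_add_right: "x + z \<sqsubset> y + z \<longleftrightarrow> x \<sqsubset> y"
  by (simp add: lt_def diff_add_eq_diff_diff_swap)

lemma lt_add_left: "z + x \<sqsubset> z + y \<longleftrightarrow> x \<sqsubset> y"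
  using conj_in_iff[of z "y - x"] by (simp add: lt_def diff_add_eq_diff_diff_swap add_diff_eq)

lemma lt_conj: "h + x - h \<sqsubset> h + y - h \<longleftrightarrow> x \<sqsubset> y"
  using lt_add_right[of "h + x" "- h" "h + y"] lt_add_left[of h x y] by simp

lemma le_refl [simp]: "x \<sqsubseteq> x"
  by (simp add: le_def)

lemma le_lt_trans [trans]: "x \<sqsubseteq> y \<Longrightarrow> y \<sqsubset> z \<Longrightarrow> x \<sqsubset> z"
  and lt_le_trans [trans]: "x \<sqsubset> y \<Longrightarrow> y \<sqsubseteq> z \<Longrightarrow> x \<sqsubset> z"
  and le_trans [trans]: "x \<sqsubseteq> y \<Longrightarrow> y \<sqsubseteq> z \<Longrightarrow> x \<sqsubseteq> z"
  using lt_trans by (auto simp: le_def)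

lemma le_or_lt: "x \<sqsubseteq> y \<or> y \<sqsubset> x"
  using lt_total by (auto simp: le_def)

lemma le_add_right: "x \<sqsubseteq> y \<Longrightarrow> x + z \<sqsubseteq> y + z" and le_add_left: "x \<sqsubseteq> y \<Longrightarrow> z + x \<sqsubseteq> z + y"
  using lt_add_right lt_add_left by (auto simp: le_def)

lemma le_add_mono: "x \<sqsubseteq> y \<Longrightarrow> x' \<sqsubseteq> y' \<Longrightarrow> x + x' \<sqsubseteq> y + y'"
  using le_trans[OF le_add_right le_add_left] .

lemma nmul_le_mono: "x \<sqsubseteq> y \<Longrightarrow> nmul n x \<sqsubseteq> nmul n y"
  by (induction n) (auto intro: le_add_mono)

lemma nmul_in: "x \<in> P \<Longrightarrow> n > 0 \<Longrightarrow> nmul n x \<in> P"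
proof (induction n)
  case (Suc n) then show ?case using add_closed[of x "nmul n x"] by (cases n) auto
qed simp

lemma uminus_lt: "x \<in> P \<Longrightarrow> - x + y \<sqsubset> y"
  using lt_add_right[of "- x" y 0] by (simp add: lt_def del: add_uminus_conv_diff)

text \<open>Conjugation by \<open>u\<close> fixes \<open>g\<close>, hence keeps the conjugate of
  \<open>f\<close> below \<open>g\<close>; adding \<open>- f\<close> on the left only lowers it
  further.\<close>

lemma lt_commutator:
  assumes f: "f \<in> P" "f \<sqsubset> g" and u: "u + g = g + u"
  shows "- f + u + f - u \<sqsubset> g"
proof -
  have "u + g - u = g" unfolding u by simp
  then have "u + f - u \<sqsubset> g" using lt_conj[of u f g] f by simp
  then have "- f + (u + f - u) \<sqsubset> g" using uminus_lt[OF f(1)] lt_trans by blast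
  then show ?thesis by (simp add: add_diff_eq flip: add.assoc)
qed

text \<open>Either sign of \<open>\<phi>\<close> is allowed, so that \<open>\<phi>\<close> can be
  chosen among \<open>f\<close> and \<open>- f\<close> as the one that moves points to the right.
  The estimate is applied to \<open>t\<close> if \<open>\<phi> = - f\<close> and to
  \<open>- s\<close> if \<open>\<phi> = f\<close>.\<close>

lemma lt_commutator':
  assumes f: "f \<in> P" "f \<sqsubset> g" and \<phi>: "\<phi> = f \<or> \<phi> = - f" and s: "s = \<phi> + t - \<phi>"
    and comm: "t + g = g + t" "s + g = g + s" "s + t = t + s"
  shows "s - t \<sqsubset> g"
  using \<phi>
proof
  assume "\<phi> = - f"
  then show ?thesis using lt_commutator[OF f comm(1)] s by simp
next
  assume "\<phi> = f"
  then have s': "s = f + t - f" using s by simp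
  have "- s + g = g + - s" using comm(2) by (rule commute_uminus)
  from lt_commutator[OF f this] have "- f + - s + f + s \<sqsubset> g" by simp
  moreover have "- f + - s + f = - t" unfolding s' by (simp add: group_norm)
  ultimately have "- t + s \<sqsubset> g" by simp
  moreover have "- t + s = s - t" using commute_uminus[OF comm(3)[symmetric]] by simp
  ultimately show ?thesis by simp
qed

end

subsection \<open>Elements dominate what lies strictly inside their support\<close>

text \<open>With slope at least 2 next to \<open>p\<close>, the point \<open>p + \<delta>\<close> is
  moved at least to \<open>p + 2 * \<delta>\<close>, past \<open>p + 3 * \<delta> / 2\<close>. So
  the interval between these first two points is moved off itself.\<close>

lemma expand_near_lead:
  assumes f: "lead f p m" "m > 0" and p': "p < p'"
  obtains a b where "dyadic a" "dyadic b" "p < a" "a < b" "b < app f a" "app f b < p'"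
proof -
  have g: "app f p = p" "rg (app f) p m" using f by (auto simp: lead_def)
  obtain c where c: "p < c" "c < p'" "\<And>y. p < y \<Longrightarrow> y \<le> c \<Longrightarrow> app f y = p + 2 powi m * (y - p)"
    using rgE[OF g(2) p'] g(1) by metis
  have m2: "(2::real) \<le> 2 powi m" using power_int_increasing[of 1 m "2::real"] f(2) by simp
  obtain N where N: "1 / 2 ^ N < (c - p) / (2 powi m * 2)"
    using exists_half_power_less[of "(c - p) / (2 powi m * 2)"] c by auto
  define \<delta> :: real where "\<delta> = 1 / 2 ^ N"
  have \<delta>: "0 < \<delta>" "dyadic \<delta>" by (simp_all add: \<delta>_def)
  have "\<delta> * (2 powi m * 2) < c - p"
    using N pos_less_divide_eq[of "2 powi m * 2" \<delta> "c - p"] by (simp add: \<delta>_def)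
  then have small: "2 powi m * (2 * \<delta>) < c - p" by (simp add: mult_ac)
  have "2 * (2 * \<delta>) \<le> 2 powi m * (2 * \<delta>)" using m2 \<delta> by (intro mult_right_mono) auto
  then have d4: "4 * \<delta> < c - p" using small by linarith
  have "2 * \<delta> \<le> 2 powi m * \<delta>" using m2 \<delta> by (intro mult_right_mono) auto
  have e: "app f (p + \<delta>) = p + 2 powi m * \<delta>" "app f (p + 3 * \<delta> / 2) = p + 2 powi m * (3 * \<delta> / 2)"
    using c(3)[of "p + \<delta>"] c(3)[of "p + 3 * \<delta> / 2"] d4 \<delta>(1) by simp_all
  have "2 powi m * (3 * \<delta> / 2) \<le> 2 powi m * (2 * \<delta>)" using \<delta> by (intro mult_left_mono) auto
  then have "app f (p + 3 * \<delta> / 2) < p'" using e(2) small c(2) by linarith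
  moreover have "p + 3 * \<delta> / 2 < app f (p + \<delta>)" using e(1) \<open>2 * \<delta> \<le> 2 powi m * \<delta>\<close> \<delta>(1) by simp
  moreover have "dyadic (p + 3 * \<delta> / 2)" "dyadic (p + \<delta>)"
    using lead_range(3)[OF f(1)] \<delta>(2) by (auto intro!: dyadic_add dyadic_div2 dyadic_mult)
  ultimately show thesis using that[of "p + \<delta>" "p + 3 * \<delta> / 2"] \<delta>(1) by simp
qed

lemma shift_near_lead:
  assumes f: "lead f p m" and p': "p < p'"
  obtains \<phi> a b where "\<phi> = f \<or> \<phi> = - f" "dyadic a" "dyadic b" "p < a" "a < b" "b < app \<phi> a" "app \<phi> b < p'"
proof (cases "m > 0")
  case True then show thesis using expand_near_lead[OF f _ p'] that by metis
next
  case False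
  then have "- m > 0" using f by (simp add: lead_def)
  then show thesis using expand_near_lead[OF lead_uminus[OF f] _ p'] that by metis
qed

lemma shift_near_trail:
  assumes f: "trail f q n" and q': "q' < q"
  obtains \<phi> a b where "\<phi> = f \<or> \<phi> = - f" "dyadic a" "dyadic b" "q' < a" "a < b" "b < app \<phi> a" "app \<phi> b < q"
proof -
  have "lead (flip f) (1 - q) n" using f by (simp add: lead_flip)
  then obtain \<psi> a b where \<psi>: "\<psi> = flip f \<or> \<psi> = - flip f" "dyadic a" "dyadic b" "1 - q < a" "a < b"
    "b < app \<psi> a" "app \<psi> b < 1 - q'"
    by (rule shift_near_lead[of _ _ _ "1 - q'"]) (use q' in auto)
  \<comment> \<open>Reflection reverses the direction of motion. Therefore the inverse is used, and
    the interval starts from the reflected image of the one given by \<open>\<psi>\<close>.\<close>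
  have 1: "app (- flip \<psi>) (1 - app \<psi> x) = 1 - x" for x
    by (simp add: app_flip app_uminus_eq_iff)
  show thesis
  proof (rule that[of "- flip \<psi>" "1 - app \<psi> b" "1 - app \<psi> a"])
    show "- flip \<psi> = f \<or> - flip \<psi> = - f" using \<psi>(1) by (auto simp: flip_uminus)
    show "dyadic (1 - app \<psi> b)" "dyadic (1 - app \<psi> a)" using \<psi> by (auto intro!: dyadic_diff)
  qed (use \<psi> in \<open>simp_all add: 1\<close>)
qed

locale thompson_bicone = bicone P for P :: "thompson set"
begin

text \<open>The inequality \<open>s - t \<sqsubset> g\<close> is transported by \<open>h\<close>,
  which turns \<open>\<phi>\<close> into \<open>z\<close> on the support of \<open>v\<close> and
  agrees with \<open>k\<close> on the support of \<open>g\<close>. In this way the single element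
  \<open>f\<close> controls commutators with arbitrary \<open>z\<close>.\<close>

lemma commutator_lt_conj:
  assumes f: "f \<in> P" "f \<sqsubset> g" and \<phi>: "\<phi> = f \<or> \<phi> = - f"
    and g: "supported g p' q'" and ab: "a' < b'" "b' < app \<phi> a'"
    and disj: "app \<phi> b' \<le> p' \<or> q' \<le> a'"
    and v: "supported v (app h a') (app h b')"
    and hz: "\<And>x. a' \<le> x \<Longrightarrow> x \<le> b' \<Longrightarrow> app h (app \<phi> x) = app z (app h x)"
    and hk: "\<And>x. p' \<le> x \<Longrightarrow> x \<le> q' \<Longrightarrow> app h x = app k x"
  shows "z + v - z - v \<sqsubset> k + g - k"
proof -
  define t where "t = - h + v - (- h)"
  define s where "s = \<phi> + t - \<phi>"
  have t: "supported t a' b'" using supported_conj[OF v, of "- h"] by (simp add: t_def)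
  then have s: "supported s (app \<phi> a') (app \<phi> b')" unfolding s_def by (rule supported_conj)
  have "app \<phi> a' < app \<phi> b'" using ab by simp
  have "s + t = t + s" using disjoint_supports_commute[OF t s] ab by simp
  moreover have "b' \<le> p' \<or> q' \<le> a'" "app \<phi> b' \<le> p' \<or> q' \<le> app \<phi> a'"
    using disj ab \<open>app \<phi> a' < app \<phi> b'\<close> by linarith+
  then have "t + g = g + t" "s + g = g + s"
    using disjoint_supports_commute[OF t g] disjoint_supports_commute[OF s g]
      disjoint_supports_commute[OF g t] disjoint_supports_commute[OF g s] by metis+
  ultimately have "s - t \<sqsubset> g" using lt_commutator'[OF f \<phi> s_def] by blast
  then have "h + (s - t) - h \<sqsubset> h + g - h" by (simp only: lt_conj)
  also have "h + g - h = k + g - k" by (rule conj_eq_if_agree[OF g hk])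
  finally have "h + (s - t) - h \<sqsubset> k + g - k" .
  moreover have "h + (s - t) - h = (h + \<phi> - h) + v - (h + \<phi> - h) - v"
    unfolding s_def t_def
    by (simp add: group_norm)
  moreover have "(h + \<phi> - h) + v - (h + \<phi> - h) = z + v - z"
  proof (rule conj_eq_if_agree[OF v])
    fix y assume "app h a' \<le> y" "y \<le> app h b'"
    then have "a' \<le> app (- h) y" "app (- h) y \<le> b'"
      using app_mono(2)[of h a' "app (- h) y"] app_mono(2)[of h "app (- h) y" b'] by simp_all
    then show "app (h + \<phi> - h) y = app z y" using hz[of "app (- h) y"] by simp
  qed
  ultimately show ?thesis by simp
qed

text \<open>These assumptions contradict each other, as \<open>inner_dominated_aux\<close> shows.
  The statements in between draw ever stronger consequences from an \<open>f\<close> that lies below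
  some \<open>g\<close> supported strictly inside its hull.\<close>

context
  fixes f g :: thompson and p q p' q' :: real and m n :: int
  assumes f: "f \<in> P" "f \<sqsubset> g" "lead f p m" "trail f q n"
    and g: "supported g p' q'" and pq: "dyadic p'" "dyadic q'" "p < p'" "p' < q'" "q' < q"
begin

lemma commutator_lt_left:
  assumes v: "supported v a b" "dyadic a" "dyadic b" "0 < a" "a < b" "b < app z a" "app z b < app k p'"
  shows "z + v - z - v \<sqsubset> k + g - k"
proof -
  obtain \<phi> a' b' where \<phi>: "\<phi> = f \<or> \<phi> = - f" "dyadic a'" "dyadic b'" "p < a'" "a' < b'"
    "b' < app \<phi> a'" "app \<phi> b' < p'"
    using shift_near_lead[OF f(3) pq(3)] by metis
  obtain h1 where h1: "h1 \<in> pl2" "h1 a' = a" "h1 b' = b" using pl2_interval[of a' b' a b] \<phi> v by blast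
  \<comment> \<open>Prescribing this map on the image of \<open>[a',b']\<close> under
    \<open>\<phi>\<close> forces \<open>h\<close> to intertwine \<open>\<phi>\<close> and
    \<open>z\<close>.\<close>
  have h2: "app z \<circ> (h1 \<circ> app (- \<phi>)) \<in> pl2" by (intro pl2_comp h1 app_pl2)
  have "0 \<le> p" "q \<le> 1" using lead_range[OF f(3)] trail_range[OF f(4)] by auto
  have "app \<phi> a' < app \<phi> b'" using \<phi> by simp
  obtain h where h: "\<And>x. a' \<le> x \<Longrightarrow> x \<le> b' \<Longrightarrow> app h x = h1 x"
    "\<And>x. app \<phi> a' \<le> x \<Longrightarrow> x \<le> app \<phi> b' \<Longrightarrow> app h x = (app z \<circ> (h1 \<circ> app (- \<phi>))) x"
    "\<And>x. p' \<le> x \<Longrightarrow> x \<le> q' \<Longrightarrow> app h x = app k x"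
    using thompson_extend3[OF h1(1) h2 app_pl2[of k], of a' b' "app \<phi> a'" "app \<phi> b'" p' q']
      \<phi> pq v h1 \<open>0 \<le> p\<close> \<open>q \<le> 1\<close> \<open>app \<phi> a' < app \<phi> b'\<close> by auto
  show ?thesis
  proof (rule commutator_lt_conj[OF f(1,2) \<phi>(1) g \<phi>(5,6)])
    show "supported v (app h a') (app h b')" using h(1) h1 \<phi> v by simp
    show "app h (app \<phi> x) = app z (app h x)" if "a' \<le> x" "x \<le> b'" for x using h(1,2) that by simp
  qed (use h \<phi> in auto)
qed

lemma commutator_lt_right:
  assumes v: "supported v a b" "dyadic a" "dyadic b" "app k q' < a" "a < b" "b < app z a" "b < 1"
  shows "z + v - z - v \<sqsubset> k + g - k"
proof -
  obtain \<phi> a' b' where \<phi>: "\<phi> = f \<or> \<phi> = - f" "dyadic a'" "dyadic b'" "q' < a'" "a' < b'"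
    "b' < app \<phi> a'" "app \<phi> b' < q"
    using shift_near_trail[OF f(4) pq(5)] by metis
  obtain h1 where h1: "h1 \<in> pl2" "h1 a' = a" "h1 b' = b" using pl2_interval[of a' b' a b] \<phi> v by blast
  have h2: "app z \<circ> (h1 \<circ> app (- \<phi>)) \<in> pl2" by (intro pl2_comp h1 app_pl2)
  have "0 \<le> p" "q \<le> 1" using lead_range[OF f(3)] trail_range[OF f(4)] by auto
  have "app \<phi> a' < app \<phi> b'" using \<phi> by simp
  obtain h where h: "\<And>x. p' \<le> x \<Longrightarrow> x \<le> q' \<Longrightarrow> app h x = app k x"
    "\<And>x. a' \<le> x \<Longrightarrow> x \<le> b' \<Longrightarrow> app h x = h1 x"
    "\<And>x. app \<phi> a' \<le> x \<Longrightarrow> x \<le> app \<phi> b' \<Longrightarrow> app h x = (app z \<circ> (h1 \<circ> app (- \<phi>))) x"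
    using thompson_extend3[OF app_pl2[of k] h1(1) h2, of p' q' a' b' "app \<phi> a'" "app \<phi> b'"]
      \<phi> pq v h1 \<open>0 \<le> p\<close> \<open>q \<le> 1\<close> \<open>app \<phi> a' < app \<phi> b'\<close> by auto
  show ?thesis
  proof (rule commutator_lt_conj[OF f(1,2) \<phi>(1) g \<phi>(5,6)])
    show "supported v (app h a') (app h b')" using h(2) h1 \<phi> v by simp
    show "app h (app \<phi> x) = app z (app h x)" if "a' \<le> x" "x \<le> b'" for x using h(2,3) that by simp
  qed (use h \<phi> in auto)
qed

text \<open>\<open>t\<close> carries everything involved to the right of itself. The conjugates of
  \<open>k + g - k\<close> by \<open>t\<close> and by \<open>- t\<close> lie on the two sides of the
  commutator, so both exceed it; by invariance at least one of them is at most
  \<open>k + g - k\<close>.\<close>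

lemma commutator_lt:
  assumes v: "supported v a b" "dyadic a" "dyadic b" "0 < a" "a < b" "b < app z a" "app z b < 1"
  shows "z + v - z - v \<sqsubset> k + g - k"
proof -
  define A where "A = min a (app k p')"
  define B where "B = max (app z b) (app k q')"
  have "0 \<le> p" "q \<le> 1" using lead_range[OF f(3)] trail_range[OF f(4)] by auto
  have ab: "app z a < app z b" "app k p' < app k q'" using v pq by auto
  have AB: "dyadic A" "dyadic B" "0 < A" "A < B" "B < 1"
  proof -
    show "dyadic A" "dyadic B" unfolding A_def B_def using v pq by (simp_all add: min_def max_def)
    show "0 < A" "B < 1" unfolding A_def B_def using v pq \<open>0 \<le> p\<close> \<open>q \<le> 1\<close> by auto
    have "A \<le> a" "app z b \<le> B" by (simp_all add: A_def B_def)
    then show "A < B" using v ab(1) by linarith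
  qed
  obtain c where c: "dyadic c" "B < c" "c < 1" using dyadic_dense[OF AB(5)] by blast
  obtain d where d: "dyadic d" "c < d" "d < 1" using dyadic_dense[OF c(3)] by blast
  obtain t where t: "app t A = c" "app t B = d" using thompson_move_interval[OF AB c(1) d(1)] AB c d by auto
  have tA: "B < app t A" using t c by simp
  then have tB: "app (- t) B < A" using app_mono(1)[of t "app (- t) B" A] by simp
  have "z + v - z - v \<sqsubset> (t + k) + g - (t + k)"
  proof (rule commutator_lt_left[OF v(1-6)])
    have "app t A \<le> app t (app k p')" by (simp add: A_def)
    moreover have "app z b < app t A" using tA by (simp add: B_def)
    ultimately show "app z b < app (t + k) p'" by (metis app_plus less_le_trans)
  qed
  also have "(t + k) + g - (t + k) = t + (k + g - k) - t"
    by (simp add: group_norm)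
  finally have L: "z + v - z - v \<sqsubset> t + (k + g - k) - t" .
  have "z + v - z - v \<sqsubset> (- t + k) + g - (- t + k)"
  proof (rule commutator_lt_right[OF v(1-3) _ v(5,6)])
    have "app (- t) (app k q') \<le> app (- t) B" by (simp add: B_def)
    moreover have "app (- t) B < a" using tB by (simp add: A_def)
    ultimately show "app (- t + k) q' < a" by (metis app_plus le_less_trans)
    show "b < 1" using v by (meson app_01(2) less_trans)
  qed
  also have "(- t + k) + g - (- t + k) = - t + (k + g - k) - (- t)"
    by (simp add: group_norm)
  finally have R: "z + v - z - v \<sqsubset> - t + (k + g - k) - (- t)" .
  show ?thesis
  proof (cases "k + g - k \<sqsubset> t + (k + g - k) - t")
    case True
    then have "- t + (k + g - k) - (- t) \<sqsubset> - t + (t + (k + g - k) - t) - (- t)" by (simp only: lt_conj)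
    also have "- t + (t + (k + g - k) - t) - (- t) = k + g - k" by (simp add: add_diff_eq flip: add.assoc)
    finally show ?thesis using R lt_trans by blast
  next
    case False
    then show ?thesis using L le_or_lt lt_le_trans by blast
  qed
qed

text \<open>All conjugates of \<open>g\<close> are taken as upper bounds to make the set invariant
  under conjugation, and all multiples to make it closed under addition: a sum is at most twice its
  larger summand.\<close>

definition "small = {x. \<forall>k j. nmul j x \<sqsubset> k + g - k}"

lemma g_pos: "g \<in> P"
  using f pos_iff lt_trans by blast

lemma small_plus:
  assumes "x \<in> small" "y \<in> small" shows "x + y \<in> small"
  unfolding small_def
proof (intro CollectI allI)
  fix k j
  have "\<exists>w\<in>{x, y}. x + y \<sqsubseteq> nmul 2 w"
    using le_or_lt[of x y] le_add_right[of x y y] le_add_left[of y x x] by (auto simp: numeral_2_eq_2 le_def)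
  then obtain w where w: "w \<in> small" "x + y \<sqsubseteq> nmul 2 w" using assms by blast
  have "nmul j (x + y) \<sqsubseteq> nmul (j * 2) w" using nmul_le_mono[OF w(2)] by (simp add: nmul_nmul)
  also have "nmul (j * 2) w \<sqsubset> k + g - k" using w(1) by (simp add: small_def)
  finally show "nmul j (x + y) \<sqsubset> k + g - k" .
qed

lemma small_conj:
  assumes "x \<in> small" shows "h + x - h \<in> small"
  unfolding small_def
proof (intro CollectI allI)
  fix k j
  have "nmul j x \<sqsubset> (- h + k) + g - (- h + k)" using assms unfolding small_def by blast
  then have "h + nmul j x - h \<sqsubset> h + ((- h + k) + g - (- h + k)) - h" by (simp only: lt_conj)
  also have "h + ((- h + k) + g - (- h + k)) - h = k + g - k"
    by (simp add: group_norm)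
  finally show "nmul j (h + x - h) \<sqsubset> k + g - k" by (simp add: nmul_conj)
qed

lemma small_normal: "normal_subgroup {x. x \<in> small \<and> - x \<in> small}"
proof -
  have nmul_0: "nmul j (0::thompson) = 0" for j by (induction j) auto
  have "0 \<in> small" unfolding small_def using conj_closed[OF g_pos] pos_iff by (simp add: nmul_0)
  moreover have "- (x + y) \<in> small" if "- x \<in> small" "- y \<in> small" for x y
    using small_plus[OF that(2,1)] by (simp add: minus_add del: add_uminus_conv_diff)
  moreover have "- (h + x - h) \<in> small" if "- x \<in> small" for h x
    using small_conj[OF that, of h] by (simp add: group_norm)
  ultimately show ?thesis unfolding normal_subgroup_def
    using small_plus small_conj by (intro conjI ballI allI CollectI) (simp_all del: minus_add)
qed

text \<open>The factors \<open>z + v - z\<close> and \<open>- v\<close> have disjoint supports and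
  commute. Hence multiples of the commutator are commutators of \<open>z\<close> with multiples of
  \<open>v\<close>, and its inverse is the commutator with \<open>- v\<close>; the estimate for
  single commutators covers all of them.\<close>

lemma disjoint_commutator_small:
  assumes v: "supported v a b" "dyadic a" "dyadic b" "0 < a" "a < b" "b < app z a" "app z b < 1"
  shows "z + v - z - v \<in> small" "- (z + v - z - v) \<in> small"
proof -
  have main: "z + v - z - v \<in> small" if v: "supported v a b" for v
    unfolding small_def
  proof (intro CollectI allI)
    fix k j
    have "supported (z + v - z) (app z a) (app z b)" using v by (rule supported_conj)
    then have "(z + v - z) + - v = - v + (z + v - z)"
      using disjoint_supports_commute[of "- v" a b] v assms by simp
    then have "nmul j ((z + v - z) + - v) = nmul j (z + v - z) + nmul j (- v)" by (rule nmul_plus_commute)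
    then have "nmul j (z + v - z - v) = z + nmul j v - z - nmul j v"
      by (simp add: nmul_conj nmul_uminus)
    then show "nmul j (z + v - z - v) \<sqsubset> k + g - k"
      using commutator_lt[OF supported_nmul[OF v] assms(2-7)] by simp
  qed
  show "z + v - z - v \<in> small" by (rule main[OF v(1)])
  define w where "w = z + v - z"
  have "supported w (app z a) (app z b)" unfolding w_def using v by (blast intro: supported_conj)
  then have "v + - w = - w + v"
    using disjoint_supports_commute[OF v(1), of "- w" "app z a" "app z b"] v by simp
  then have "v + - (z + v - z) = - (z + v - z) + v" by (simp only: w_def)
  then have "- (z + v - z - v) = z + (- v) - z - (- v)"
    by (simp add: group_norm)
  then show "- (z + v - z - v) \<in> small" using main[of "- v"] v by simp
qed

text \<open>For arbitrary \<open>z\<close> the supports of \<open>v\<close> and of its conjugate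
  \<open>w\<close> may overlap. An element \<open>t\<close> carrying \<open>v\<close> to the right
  of both turns the commutator into a quotient of two commutators with disjoint supports.\<close>

lemma commutator_small:
  assumes "v \<in> derived" shows "z + v - z - v \<in> {x. x \<in> small \<and> - x \<in> small}"
proof -
  obtain a b where ab: "dyadic a" "dyadic b" "0 < a" "a < b" "b < 1" "supported v a b"
    using derived_supported[OF assms] .
  define B where "B = max b (app z b)"
  have B: "dyadic B" "a < B" "B < 1" using ab by (auto simp: B_def max_def)
  obtain c where c: "dyadic c" "B < c" "c < 1" using dyadic_dense[OF B(3)] by blast
  obtain d where d: "dyadic d" "c < d" "d < 1" using dyadic_dense[OF c(3)] by blast
  obtain t where t: "app t a = c" "app t B = d"
    using thompson_move_interval[of a B c d] ab B c d by auto
  have "app t b \<le> app t B" by (simp add: B_def)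
  then have tb: "app t b < 1" using t d by linarith
  have cb: "b < c" "app z b < c" using c by (auto simp: B_def)
  have 1: "t + v - t - v \<in> small" "- (t + v - t - v) \<in> small"
    using disjoint_commutator_small[OF ab(6,1-4), of t] t cb tb by auto
  define w where "w = z + v - z"
  have w: "supported w (app z a) (app z b)" unfolding w_def by (rule supported_conj[OF ab(6)])
  have "(t - z) + w - (t - z) = t + v - t"
    by (simp add: w_def group_norm)
  then have 2: "t + v - t - w \<in> small" "- (t + v - t - w) \<in> small"
    using disjoint_commutator_small[OF w, of "t - z"] ab t cb tb by auto
  have diff: "x - y = - (s - x) + (s - y)" for s x y :: thompson
    by (simp add: add_diff_eq)
  have e: "z + v - z - v = - (t + v - t - w) + (t + v - t - v)" "- (z + v - z - v) = - (t + v - t - v) + (t + v - t - w)"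
    unfolding w_def[symmetric] minus_diff_eq[of w v] by (rule diff)+
  have "z + v - z - v \<in> small" unfolding e(1) by (rule small_plus[OF 2(2) 1(1)])
  moreover have "- (z + v - z - v) \<in> small" unfolding e(2) by (rule small_plus[OF 1(2) 2(1)])
  ultimately show ?thesis by blast
qed

text \<open>Perfectness puts \<open>g\<close> among the elements that lie below all conjugates of
  \<open>g\<close>, in particular below \<open>g\<close> itself.\<close>

lemma inner_dominated_aux: False
proof -
  have "0 \<le> p" "q \<le> 1" using lead_range[OF f(3)] trail_range[OF f(4)] by auto
  then have "g \<in> derived" using supported_derived[OF g] pq by auto
  then have "g \<in> small" using normal_subgroup_perfect[OF small_normal commutator_small] by blast
  then have "nmul 1 g \<sqsubset> 0 + g - 0" unfolding small_def by blast
  then show False by simp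
qed

end

lemma inner_dominated:
  assumes f: "f \<in> P" "lead f p m" "trail f q n" and g: "supported g a b" "p < a" "b < q"
  shows "g \<sqsubset> f"
proof (rule ccontr)
  assume "\<not> g \<sqsubset> f"
  have "p < q" using lead_less_trail f by blast
  obtain p' where p': "dyadic p'" "p < p'" "p' < min a q" using dyadic_dense[of p "min a q"] g \<open>p < q\<close> by auto
  obtain q' where q': "dyadic q'" "max b p' < q'" "q' < q" using dyadic_dense[of "max b p'" q] g p' by auto
  have g': "supported g p' q'" by (rule supported_mono[OF g(1)]) (use p' q' in auto)
  have "f \<noteq> g"
  proof
    assume "f = g"
    then have "rg (app f) p 0" using g' p' by (intro rg_ident[of p p']) (auto simp: supported_def)
    then show False using f(2) rg_unique unfolding lead_def by blast
  qed
  then have "f \<sqsubset> g" using lt_total \<open>\<not> g \<sqsubset> f\<close> by blast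
  then show False using inner_dominated_aux[OF f(1) _ f(2,3) g'] p' q' by auto
qed

end

subsection \<open>Elements with prescribed germs\<close>

text \<open>\<open>\<delta>\<close> is chosen so small that the two affine end pieces and their
  images each take less than half of \<open>[a,b]\<close>; the gap between them can then be
  joined.\<close>

lemma thompson_with_germs:
  assumes "dyadic a" "dyadic b" "0 \<le> a" "a < b" "b \<le> 1"
  obtains f where "supported f a b" "rg (app f) a m" "lg (app f) b n"
proof -
  define M :: real where "M = max (2 powi m) (2 powi n)"
  have M: "2 powi m \<le> M" "2 powi n \<le> M" "0 < M" by (simp_all add: M_def less_max_iff_disj)
  obtain N where N: "1 / 2 ^ N < min ((b - a) / 2) ((b - a) / (2 * M))"
    using exists_half_power_less[of "min ((b - a) / 2) ((b - a) / (2 * M))"] assms M by auto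
  define \<delta> :: real where "\<delta> = 1 / 2 ^ N"
  have \<delta>: "0 < \<delta>" "dyadic \<delta>" "\<delta> < (b - a) / 2" "\<delta> < (b - a) / (2 * M)"
    using N by (simp_all add: \<delta>_def)
  have "M * \<delta> < (b - a) / 2" using \<delta>(4) M(3) by (simp add: field_simps)
  moreover have "2 powi m * \<delta> \<le> M * \<delta>" "2 powi n * \<delta> \<le> M * \<delta>" using M \<delta> by (auto intro: mult_right_mono)
  ultimately have small: "2 powi m * \<delta> < (b - a) / 2" "2 powi n * \<delta> < (b - a) / 2" by linarith+
  define f1 where "f1 = (\<lambda>x. if x \<le> a then id x else 2 powi m * x + (a - 2 powi m * a))"
  define f2 where "f2 = (\<lambda>x. if x \<le> b then 2 powi n * x + (b - 2 powi n * b) else id x)"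
  have f1: "f1 \<in> pl2" unfolding f1_def
    by (rule pl2_glue[OF pl2_id pl2_affine]) (use assms in \<open>auto intro: dyadic_diff\<close>)
  have f2: "f2 \<in> pl2" unfolding f2_def
    by (rule pl2_glue[OF pl2_affine pl2_id]) (use assms in \<open>auto intro: dyadic_diff\<close>)
  have "f1 (a + \<delta>) = a + 2 powi m * \<delta>" "f2 (b - \<delta>) = b - 2 powi n * \<delta>"
    using \<delta> by (auto simp: f1_def f2_def algebra_simps)
  moreover have "a + x < b - y" if "x < (b - a) / 2" "y < (b - a) / 2" for x y :: real
    using that by (simp add: field_simps)
  ultimately have "f1 (a + \<delta>) < f2 (b - \<delta>)" using small by metis
  moreover have "dyadic (a + \<delta>)" "dyadic (b - \<delta>)" using assms \<delta> by (auto intro: dyadic_add dyadic_diff)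
  moreover have "a + \<delta> < b - \<delta>" using \<delta>(3) by (simp add: field_simps)
  ultimately obtain t where t: "t \<in> pl2" "\<And>x. x \<le> a + \<delta> \<Longrightarrow> t x = f1 x" "\<And>x. b - \<delta> \<le> x \<Longrightarrow> t x = f2 x"
    using pl2_connect[OF f1 f2] by metis
  have ta: "t x = x" if "x \<le> a" for x using t(2)[of x] \<delta> that by (simp add: f1_def)
  have tb: "t x = x" if "b \<le> x" for x using t(3)[of x] \<delta> that by (cases "x = b") (simp_all add: f2_def algebra_simps)
  obtain f where f: "app f = t" by (rule thompson_of_pl2[OF t(1)]) (use ta tb assms in auto)
  show thesis
  proof (rule that[of f])
    show "supported f a b" using ta tb by (simp add: supported_def f)
    have "t y = 2 powi m * y + (a - 2 powi m * a)" if "a \<le> y" "y \<le> a + \<delta>" for y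
      using t(2)[of y] ta[of a] that by (cases "y = a") (simp_all add: f1_def)
    then have "rg t a m" using \<delta> by (subst rg_cong[of a "a + \<delta>" _ "\<lambda>x. 2 powi m * x + (a - 2 powi m * a)"]) auto
    then show "rg (app f) a m" by (simp add: f)
    have "t y = 2 powi n * y + (b - 2 powi n * b)" if "b - \<delta> \<le> y" "y \<le> b" for y
      using t(3)[of y] that by (simp add: f2_def)
    then have "lg t b n" using \<delta> by (subst lg_cong[of "b - \<delta>" b _ "\<lambda>x. 2 powi n * x + (b - 2 powi n * b)"]) auto
    then show "lg (app f) b n" by (simp add: f)
  qed
qed

lemma thompson_with_slopes: obtains f where "slope0 f = i" "slope1 f = j"
  using thompson_with_germs[of 0 1 i j] slope0_eqI slope1_eqI by (metis dyadic_numeral(1,2) order_refl zero_less_one)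

lemma thompson_with_lead_trail:
  assumes "dyadic a" "dyadic b" "0 \<le> a" "a < b" "b \<le> 1" "m \<noteq> 0" "n \<noteq> 0"
  obtains f where "lead f a m" "trail f b n"
proof -
  obtain f where "supported f a b" "rg (app f) a m" "lg (app f) b n"
    using thompson_with_germs[OF assms(1-5)] .
  then show thesis using that[of f] assms by (auto simp: lead_def trail_def supported_def)
qed

lemma thompson_push:
  assumes "dyadic p" "dyadic d" "dyadic c" "0 < p" "p < c" "0 < d" "d < c" "c \<le> 1"
  obtains t where "app t p = d" "supported t 0 c"
proof -
  define f where "f = (\<lambda>x. 2 powi 0 * x + (d - p))"
  have f: "f \<in> pl2" unfolding f_def by (rule pl2_affine) (use assms in \<open>auto intro: dyadic_diff\<close>)
  obtain u where u: "u \<in> pl2" "\<And>x. x \<le> p \<Longrightarrow> u x = f x" "\<And>x. c \<le> x \<Longrightarrow> u x = id x"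
    using pl2_connect[OF f pl2_id assms(1,3)] assms by (auto simp: f_def)
  have "id 0 < u p" using u(2)[of p] assms by (simp add: f_def)
  then obtain v where v: "v \<in> pl2" "\<And>x. x \<le> 0 \<Longrightarrow> v x = id x" "\<And>x. p \<le> x \<Longrightarrow> v x = u x"
    using pl2_connect[OF pl2_id u(1) dyadic_numeral(1) assms(1,4)] by blast
  obtain t where t: "app t = v" by (rule thompson_of_pl2[OF v(1)]) (use u v assms in auto)
  show thesis
    by (rule that[of t]) (use t u v assms in \<open>auto simp: supported_def f_def\<close>)
qed

lemma trail_eventually_agree:
  assumes "trail f q n" "trail g q n" "b < q"
  obtains a where "dyadic a" "b < a" "a < q" "\<And>x. a \<le> x \<Longrightarrow> app f x = app g x"
proof -
  have "lead (flip f) (1 - q) n" "lead (flip g) (1 - q) n" using assms by (simp_all add: lead_flip)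
  then obtain a where a: "dyadic a" "1 - q < a" "a < 1 - b" "\<And>x. x \<le> a \<Longrightarrow> app (flip f) x = app (flip g) x"
    by (rule lead_eventually_agree[of _ _ _ _ "1 - b"]) (use assms in auto)
  have "app f x = app g x" if "1 - a \<le> x" for x
    using a(4)[of "1 - x"] that by (simp add: app_flip)
  then show thesis using that[of "1 - a"] a dyadic_diff[of 1 a] by auto
qed

section \<open>Cones read off at one end of the support\<close>

definition lead_cone :: "int \<Rightarrow> int \<Rightarrow> thompson set" where
  "lead_cone s0 s1 = {f. \<exists>p m. lead f p m \<and> (if p = 0 then s0 else s1) * m > 0}"

text \<open>In both families \<open>s0\<close> governs the elements whose relevant end is an end of
  \<open>[0,1]\<close>, and \<open>s1\<close> the others; opposite signs give the four orderings
  with two indices. A positive exponent means slope greater than 1, so \<open>trail_cone 1 1\<close>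
  is \<open>P_xp_minus\<close> and \<open>trail_cone (- 1) (- 1)\<close> is
  \<open>P_xp_plus\<close>.\<close>

definition trail_cone :: "int \<Rightarrow> int \<Rightarrow> thompson set" where
  "trail_cone s0 s1 = {f. \<exists>q n. trail f q n \<and> (if q = 1 then s0 else s1) * n > 0}"

lemma lead_cone_iff: "lead f p m \<Longrightarrow> f \<in> lead_cone s0 s1 \<longleftrightarrow> (if p = 0 then s0 else s1) * m > 0"
proof -
  assume f: "lead f p m"
  have "p' = p \<and> m' = m" if "lead f p' m'" for p' m' using lead_point_unique[OF that f] by simp
  then show ?thesis using f unfolding lead_cone_def by blast
qed

lemma mem_image_involution: "(\<And>x. f (f x) = x) \<Longrightarrow> y \<in> f ` A \<longleftrightarrow> f y \<in> A"
  by (metis image_iff)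

lemmas mem_flip_image = mem_image_involution[of flip, OF flip_flip]
lemmas mem_uminus_image = mem_image_involution[of uminus, OF minus_minus]

lemma flip_lead_cone: "flip ` lead_cone s0 s1 = trail_cone s0 s1"
proof -
  have "f \<in> trail_cone s0 s1 \<longleftrightarrow> flip f \<in> lead_cone s0 s1" for f
  proof
    assume "f \<in> trail_cone s0 s1"
    then obtain q n where "trail f q n" "(if q = 1 then s0 else s1) * n > 0" unfolding trail_cone_def by blast
    then show "flip f \<in> lead_cone s0 s1" unfolding lead_cone_def
      by (intro CollectI exI[of _ "1 - q"] exI[of _ n]) (auto simp: lead_flip)
  next
    assume "flip f \<in> lead_cone s0 s1"
    then obtain p m where "lead (flip f) p m" "(if p = 0 then s0 else s1) * m > 0" unfolding lead_cone_def by blast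
    then show "f \<in> trail_cone s0 s1" unfolding trail_cone_def
      by (intro CollectI exI[of _ "1 - p"] exI[of _ m]) (auto simp: lead_flip)
  qed
  then show ?thesis unfolding set_eq_iff mem_flip_image by simp
qed

lemma trail_cone_iff:
  assumes "trail f q n" shows "f \<in> trail_cone s0 s1 \<longleftrightarrow> (if q = 1 then s0 else s1) * n > 0"
proof -
  have "f \<in> trail_cone s0 s1 \<longleftrightarrow> flip f \<in> lead_cone s0 s1"
    unfolding flip_lead_cone[symmetric] mem_flip_image ..
  also have "\<dots> \<longleftrightarrow> (if q = 1 then s0 else s1) * n > 0"
    using lead_cone_iff[of "flip f" "1 - q" n] assms by (simp add: lead_flip)
  finally show ?thesis .
qed

lemma zero_notin_lead_cone [simp]: "0 \<notin> lead_cone s0 s1"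
  unfolding lead_cone_def using lead_nonzero by blast

lemma uminus_lead_cone: "uminus ` lead_cone s0 s1 = lead_cone (- s0) (- s1)"
proof -
  have "f \<in> lead_cone (- s0) (- s1) \<longleftrightarrow> - f \<in> lead_cone s0 s1" for f
  proof (cases "f = 0")
    case True
    then show ?thesis by simp
  next
    case False
    then obtain p m where f: "lead f p m" using lead_exists by blast
    show ?thesis using lead_cone_iff[OF f] lead_cone_iff[OF lead_uminus[OF f]] by auto
  qed
  then show ?thesis unfolding set_eq_iff mem_uminus_image by simp
qed

lemma bi_cone_lead_cone:
  assumes "s0 \<noteq> 0" "s1 \<noteq> 0" shows "bi_cone (lead_cone s0 s1)"
  unfolding bi_cone_def
proof (intro conjI ballI allI impI)
  show "0 \<notin> lead_cone s0 s1" by (rule zero_notin_lead_cone)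
next
  fix f g assume "f \<in> lead_cone s0 s1" "g \<in> lead_cone s0 s1"
  then obtain p m q n where f: "lead f p m" "(if p = 0 then s0 else s1) * m > 0"
    and g: "lead g q n" "(if q = 0 then s0 else s1) * n > 0" unfolding lead_cone_def by blast
  consider "p < q" | "p = q" | "q < p" by linarith
  then show "f + g \<in> lead_cone s0 s1"
  proof cases
    case 1
    have "lead (f + g) p m" by (rule lead_plus_left(1)[OF f(1) _ 1]) (use g in \<open>auto simp: lead_def\<close>)
    then show ?thesis using f(2) unfolding lead_cone_def by blast
  next
    case 2
    have "(if p = 0 then s0 else s1) * (m + n) > 0" using f(2) g(2) 2 by (simp add: distrib_left)
    moreover from this have "m + n \<noteq> 0" by force
    then have "lead (f + g) p (m + n)" using lead_plus[OF f(1)] g(1) 2 by blast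
    ultimately show ?thesis unfolding lead_cone_def by blast
  next
    case 3
    have "lead (f + g) q n" by (rule lead_plus_left(2)[OF g(1) _ 3]) (use f in \<open>auto simp: lead_def\<close>)
    then show ?thesis using g(2) unfolding lead_cone_def by blast
  qed
next
  fix f :: thompson assume "f \<noteq> 0"
  then obtain p m where f: "lead f p m" using lead_exists by blast
  then have "m \<noteq> 0" by (simp add: lead_def)
  then have "(if p = 0 then s0 else s1) * m > 0 \<or> (if p = 0 then s0 else s1) * - m > 0"
    using assms by (auto simp: zero_less_mult_iff mult_less_0_iff)
  then show "f \<in> lead_cone s0 s1 \<or> - f \<in> lead_cone s0 s1"
    using lead_cone_iff[OF f] lead_cone_iff[OF lead_uminus[OF f]] by blast
next
  fix f h assume "f \<in> lead_cone s0 s1"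
  then obtain p m where f: "lead f p m" "(if p = 0 then s0 else s1) * m > 0" unfolding lead_cone_def by blast
  have "app h p = 0 \<longleftrightarrow> p = 0" using app_mono(3)[of h p 0] by simp
  then show "h + f - h \<in> lead_cone s0 s1" using lead_cone_iff[OF lead_conj[OF f(1), of h]] f(2) by simp
qed

lemma bi_cone_uminus: "bi_cone P \<Longrightarrow> bi_cone (uminus ` P)"
proof -
  assume "bi_cone P"
  then interpret bicone P by unfold_locales
  have "- (h + x - h) \<in> P" if "- x \<in> P" for x h using conj_closed[OF that, of h] by (simp add: group_norm)
  moreover have "- (x + y) \<in> P" if "- x \<in> P" "- y \<in> P" for x y
    using add_closed[OF that(2,1)] by (simp add: minus_add del: add_uminus_conv_diff)
  ultimately show ?thesis unfolding bi_cone_def Ball_def mem_uminus_image using zero_notin total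
    by (intro conjI allI impI) (simp_all del: minus_add minus_diff_eq, metis)
qed

lemma bi_cone_flip: "bi_cone P \<Longrightarrow> bi_cone (flip ` P)"
proof -
  assume "bi_cone P"
  then interpret bicone P by unfold_locales
  show ?thesis unfolding bi_cone_def Ball_def mem_flip_image flip_plus flip_diff flip_uminus
    using zero_notin total add_closed conj_closed by auto
qed

lemma bi_cone_trail_cone: "s0 \<noteq> 0 \<Longrightarrow> s1 \<noteq> 0 \<Longrightarrow> bi_cone (trail_cone s0 s1)"
  using bi_cone_flip[OF bi_cone_lead_cone] by (simp add: flip_lead_cone)

lemma derived_lead: "f \<in> derived \<Longrightarrow> lead f p m \<Longrightarrow> 0 < p"
  using lead_pos_iff by (simp add: derived_def)

lemma derived_trail: "f \<in> derived \<Longrightarrow> trail f q n \<Longrightarrow> q < 1"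
  using trail_less_iff by (simp add: derived_def)

lemma derived_ends:
  assumes "f \<in> derived" "lead f p m" "trail f q n"
  shows "dyadic p" "dyadic q" "0 < p" "p < q" "q < 1"
  using lead_range(3)[OF assms(2)] trail_range(3)[OF assms(3)] derived_lead[OF assms(1,2)]
    lead_less_trail[OF assms(2,3)] derived_trail[OF assms(1,3)] by blast+

lemma lead_trail_derived: "lead f p m \<Longrightarrow> trail f q n \<Longrightarrow> 0 < p \<Longrightarrow> q < 1 \<Longrightarrow> f \<in> derived"
  using lead_trail_supported supported_derived by blast

subsection \<open>Bi-orderings of the derived subgroup\<close>

context thompson_bicone
begin

definition pos_type :: "int \<Rightarrow> int \<Rightarrow> bool" where
  "pos_type m n \<longleftrightarrow> (\<exists>f p q. f \<in> P \<and> f \<in> derived \<and> lead f p m \<and> trail f q n)"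

lemma pos_typeE:
  assumes "pos_type m n" "dyadic p" "dyadic q" "0 < p" "p < q" "q < 1"
  obtains f where "f \<in> P" "f \<in> derived" "lead f p m" "trail f q n"
proof -
  obtain f p0 q0 where f: "f \<in> P" "f \<in> derived" "lead f p0 m" "trail f q0 n"
    using assms(1) unfolding pos_type_def by blast
  obtain h where h: "app h p0 = p" "app h q0 = q"
    using thompson_move_interval[of p0 q0 p q] derived_ends[OF f(2-4)] assms by metis
  show thesis
    by (rule that[of "h + f - h"]) (use f h conj_closed lead_conj[OF f(3), of h] trail_conj[OF f(4), of h] in auto)
qed

text \<open>Conjugation provides a positive \<open>f\<close> with the same ends and exponents as
  \<open>g\<close>. The two agree near both ends, so \<open>- f + g\<close> is supported strictly
  inside the hull of \<open>f\<close>, and \<open>f\<close> dominates its inverse.\<close>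

lemma same_type_in:
  assumes "pos_type m n" and g: "g \<in> derived" "lead g p m" "trail g q n"
  shows "g \<in> P"
proof -
  have pq: "dyadic p" "dyadic q" "0 < p" "p < q" "q < 1"
    by (fact derived_ends[OF g])+
  obtain f where f: "f \<in> P" "f \<in> derived" "lead f p m" "trail f q n" using pos_typeE[OF assms(1) pq] .
  obtain a where a: "p < a" "a < q" "\<And>x. x \<le> a \<Longrightarrow> app f x = app g x"
    using lead_eventually_agree[OF f(3) g(2) pq(4)] by metis
  obtain b where b: "p < b" "b < q" "\<And>x. b \<le> x \<Longrightarrow> app f x = app g x"
    using trail_eventually_agree[OF f(4) g(3) pq(4)] by metis
  have "supported (- f + g) a b" unfolding supported_def app_plus
    using a(3) b(3) by (metis app_uminus_cancel(1))
  then have "- (- f + g) \<sqsubset> f" using inner_dominated[OF f(1,3,4) _ a(1) b(2)] by simp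
  then show ?thesis by (simp add: lt_def group_norm)
qed

text \<open>The summand \<open>e\<close> reaches further to the right and decides the right end,
  while at the common left end the exponents add up.\<close>

lemma pos_type_add_left:
  assumes "pos_type m n" "pos_type m' n'" "m + m' \<noteq> 0" shows "pos_type (m + m') n'"
proof -
  obtain f p q where f: "f \<in> P" "f \<in> derived" "lead f p m" "trail f q n" using assms(1) unfolding pos_type_def by blast
  have pq: "dyadic p" "dyadic q" "0 < p" "p < q" "q < 1"
    by (fact derived_ends[OF f(2-4)])+
  obtain r where r: "dyadic r" "q < r" "r < 1" using dyadic_dense[OF pq(5)] by blast
  obtain e where e: "e \<in> P" "e \<in> derived" "lead e p m'" "trail e r n'"
    using pos_typeE[OF assms(2) pq(1) r(1) pq(3)] pq r by auto
  have "trail (f + e) r n'" by (rule trail_plus_right(2)[OF e(4) _ r(2)]) (use f(4) in \<open>auto simp: trail_def\<close>)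
  moreover have "lead (f + e) p (m + m')" by (rule lead_plus[OF f(3) e(3) assms(3)])
  ultimately show ?thesis unfolding pos_type_def using add_closed[OF f(1) e(1)] f e by (metis derived_simps(2))
qed

lemma pos_type_add_right:
  assumes "pos_type m n" "pos_type m' n'" "n + n' \<noteq> 0" shows "pos_type m' (n + n')"
proof -
  obtain f p q where f: "f \<in> P" "f \<in> derived" "lead f p m" "trail f q n" using assms(1) unfolding pos_type_def by blast
  have pq: "dyadic p" "dyadic q" "0 < p" "p < q" "q < 1"
    by (fact derived_ends[OF f(2-4)])+
  obtain r where r: "dyadic r" "0 < r" "r < p" using dyadic_dense[OF pq(3)] by blast
  obtain e where e: "e \<in> P" "e \<in> derived" "lead e r m'" "trail e q n'"
    using pos_typeE[OF assms(2) r(1) pq(2) r(2)] pq r by auto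
  have "lead (f + e) r m'" by (rule lead_plus_left(2)[OF e(3) _ r(3)]) (use f(3) in \<open>auto simp: lead_def\<close>)
  moreover have "trail (f + e) q (n + n')" by (rule trail_plus[OF f(4) e(4) assms(3)])
  ultimately show ?thesis unfolding pos_type_def using add_closed[OF f(1) e(1)] f e by (metis derived_simps(2))
qed

lemma pos_type_nonzero: "pos_type m n \<Longrightarrow> m \<noteq> 0 \<and> n \<noteq> 0"
  unfolding pos_type_def lead_def trail_def by blast

lemma pos_type_scale_left:
  assumes "pos_type m n" "k > 0" shows "pos_type (k * m) n"
  using assms(2)
proof (induction k rule: int_gr_induct)
  case (step k)
  have "m + k * m = (1 + k) * m" by (simp add: algebra_simps)
  then have "m + k * m \<noteq> 0" using pos_type_nonzero[OF assms(1)] step by simp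
  then show ?case using pos_type_add_left[OF assms(1) step.IH] by (simp add: algebra_simps)
qed (use assms in simp)

lemma pos_type_scale_right:
  assumes "pos_type m n" "k > 0" shows "pos_type m (k * n)"
  using assms(2)
proof (induction k rule: int_gr_induct)
  case (step k)
  have "n + k * n = (1 + k) * n" by (simp add: algebra_simps)
  then have "n + k * n \<noteq> 0" using pos_type_nonzero[OF assms(1)] step by simp
  then show ?case using pos_type_add_right[OF assms(1) step.IH] by (simp add: algebra_simps)
qed (use assms in simp)

text \<open>Some positive pair has a left entry \<open>c\<close> of sign opposite to
  \<open>m\<close>. Since \<open>|m| * c = - |c| * m\<close>, taking \<open>c\<close> and
  \<open>m\<close> with the positive coefficients \<open>2 * |m|\<close> and
  \<open>2 * |c| - 1\<close> yields exactly \<open>- m\<close>; the second summand keeps the right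
  entry \<open>n\<close>.\<close>

lemma pos_type_reflect_left:
  assumes t: "pos_type m n" and "pos_type m1 n1" "m1 > 0" and "pos_type m2 n2" "m2 < 0"
  shows "pos_type (- m) n"
proof -
  have m: "m \<noteq> 0" using pos_type_nonzero[OF t] by blast
  obtain c l where c: "pos_type c l" "c * m < 0"
    using assms m by (metis linorder_neqE mult_less_0_iff)
  have c0: "c \<noteq> 0" using c(2) by auto
  have 1: "pos_type ((2 * \<bar>m\<bar>) * c) l" by (rule pos_type_scale_left[OF c(1)]) (use m in simp)
  have 2: "pos_type ((2 * \<bar>c\<bar> - 1) * m) n" by (rule pos_type_scale_left[OF t]) (use c0 in auto)
  have "\<bar>m\<bar> * c = - (\<bar>c\<bar> * m)" using c(2) by (auto simp: abs_if mult_less_0_iff)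
  then have "(2 * \<bar>m\<bar>) * c + (2 * \<bar>c\<bar> - 1) * m = - m" by (simp add: algebra_simps)
  then show ?thesis using pos_type_add_left[OF 1 2] m by simp
qed

lemma pos_type_reflect_right:
  assumes t: "pos_type m n" and "pos_type m1 n1" "n1 > 0" and "pos_type m2 n2" "n2 < 0"
  shows "pos_type m (- n)"
proof -
  have n: "n \<noteq> 0" using pos_type_nonzero[OF t] by blast
  obtain c l where c: "pos_type l c" "c * n < 0"
    using assms n by (metis linorder_neqE mult_less_0_iff)
  have c0: "c \<noteq> 0" using c(2) by auto
  have 1: "pos_type l ((2 * \<bar>n\<bar>) * c)" by (rule pos_type_scale_right[OF c(1)]) (use n in simp)
  have 2: "pos_type m ((2 * \<bar>c\<bar> - 1) * n)" by (rule pos_type_scale_right[OF t]) (use c0 in auto)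
  have "\<bar>n\<bar> * c = - (\<bar>c\<bar> * n)" using c(2) by (auto simp: abs_if mult_less_0_iff)
  then have "(2 * \<bar>n\<bar>) * c + (2 * \<bar>c\<bar> - 1) * n = - n" by (simp add: algebra_simps)
  then show ?thesis using pos_type_add_right[OF 1 2] n by simp
qed

lemma not_pos_type_uminus: "pos_type m n \<Longrightarrow> \<not> pos_type (- m) (- n)"
proof
  assume "pos_type m n" "pos_type (- m) (- n)"
  then obtain f p q where f: "f \<in> P" "f \<in> derived" "lead f p m" "trail f q n" unfolding pos_type_def by blast
  then have "- f \<in> P"
    using same_type_in[OF \<open>pos_type (- m) (- n)\<close>, of "- f"] lead_uminus[OF f(3)] trail_uminus[OF f(4)] f(2) by simp
  then show False using not_both[OF f(1)] by blast
qed

text \<open>If each entry took both signs, reflecting the left and then the right entry would turn a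
  positive pair into its negative, which \<open>not_pos_type_uminus\<close> forbids.\<close>

lemma pos_type_sign:
  "\<exists>s\<in>{1, - 1}. (\<forall>m n. pos_type m n \<longrightarrow> s * m > 0) \<or> (\<forall>m n. pos_type m n \<longrightarrow> s * n > 0)"
proof (rule ccontr)
  assume "\<not> ?thesis"
  then obtain m1 n1 m2 n2 m3 n3 m4 n4 where
    t: "pos_type m1 n1" "\<not> m1 < 0" "pos_type m2 n2" "\<not> m2 > 0" "pos_type m3 n3" "\<not> n3 < 0" "pos_type m4 n4" "\<not> n4 > 0"
    by auto
  then have s: "m1 > 0" "m2 < 0" "n3 > 0" "n4 < 0" using pos_type_nonzero by force+
  have "pos_type (- m1) n1" by (rule pos_type_reflect_left[OF t(1) t(1) s(1) t(3) s(2)])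
  then have "pos_type (- m1) (- n1)" by (rule pos_type_reflect_right[OF _ t(5) s(3) t(7) s(4)])
  then show False using not_pos_type_uminus t(1) by blast
qed

text \<open>For cones an inclusion on F' is already an equality: an element of \<open>C\<close>
  missing from \<open>P\<close> would have its inverse in \<open>P\<close>, hence also in
  \<open>C\<close>.\<close>

lemma derived_cone_eqI:
  assumes "\<And>f. f \<in> P \<Longrightarrow> f \<in> derived \<Longrightarrow> f \<in> C" and "bi_cone C"
  shows "P \<inter> derived = C \<inter> derived"
proof -
  interpret C: bicone C by unfold_locales fact
  have "f \<in> P" if "f \<in> C" "f \<in> derived" for f
    using assms(1)[of "- f"] C.not_both[OF that(1)] C.zero_notin that total[of f] by (metis derived_simps(3))
  then show ?thesis using assms(1) by blast
qed

theorem derived_classification: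
  "\<exists>s\<in>{1, - 1}. P \<inter> derived = lead_cone s s \<inter> derived \<or> P \<inter> derived = trail_cone s s \<inter> derived"
proof -
  have ex: "\<exists>p q m n. pos_type m n \<and> lead f p m \<and> trail f q n" if "f \<in> P" "f \<in> derived" for f
    using lead_exists[of f] trail_exists[of f] that zero_notin unfolding pos_type_def by metis
  obtain s :: int where s: "s \<in> {1, - 1}"
    "(\<forall>m n. pos_type m n \<longrightarrow> s * m > 0) \<or> (\<forall>m n. pos_type m n \<longrightarrow> s * n > 0)"
    using pos_type_sign by blast
  have s0: "s \<noteq> 0" using s(1) by auto
  from s(2) show ?thesis
  proof
    assume "\<forall>m n. pos_type m n \<longrightarrow> s * m > 0"
    then have "P \<inter> derived = lead_cone s s \<inter> derived"
      using ex lead_cone_iff by (intro derived_cone_eqI bi_cone_lead_cone s0) fastforce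
    then show ?thesis using s(1) by blast
  next
    assume "\<forall>m n. pos_type m n \<longrightarrow> s * n > 0"
    then have "P \<inter> derived = trail_cone s s \<inter> derived"
      using ex trail_cone_iff by (intro derived_cone_eqI bi_cone_trail_cone s0) fastforce
    then show ?thesis using s(1) by blast
  qed
qed

end

subsection \<open>Bi-orderings of the whole group\<close>

definition lex_cone :: "thompson set \<Rightarrow> (int \<times> int) set \<Rightarrow> thompson set" where
  "lex_cone C Q = {f. f \<notin> derived \<and> (slope0 f, slope1 f) \<in> Q \<or> f \<in> derived \<and> f \<in> C}"

lemma derived_iff_slopes: "f \<in> derived \<longleftrightarrow> (slope0 f, slope1 f) = 0"
  by (simp add: derived_def zero_prod_def)

lemma bi_cone_lex_cone:
  assumes C: "bi_cone C" and Q: "bi_cone Q" shows "bi_cone (lex_cone C Q)"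
proof -
  interpret C: bicone C by unfold_locales fact
  interpret Q: bicone Q by unfold_locales fact
  define \<sigma> where "\<sigma> f = (slope0 f, slope1 f)" for f
  have \<sigma>: "\<sigma> (f + g) = \<sigma> f + \<sigma> g" "\<sigma> (- f) = - \<sigma> f" "\<sigma> (h + f - h) = \<sigma> f" for f g h
    by (simp_all add: \<sigma>_def)
  have mem: "f \<in> lex_cone C Q \<longleftrightarrow> \<sigma> f \<in> Q \<or> \<sigma> f = 0 \<and> f \<in> C" for f
    using Q.zero_notin by (auto simp: lex_cone_def derived_iff_slopes \<sigma>_def)
  show ?thesis unfolding bi_cone_def Ball_def mem \<sigma>
  proof (intro conjI allI impI)
    show "\<not> (\<sigma> 0 \<in> Q \<or> \<sigma> 0 = 0 \<and> 0 \<in> C)"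
      using Q.zero_notin C.zero_notin by (simp add: \<sigma>_def flip: zero_prod_def)
    fix f g assume "\<sigma> f \<in> Q \<or> \<sigma> f = 0 \<and> f \<in> C" "\<sigma> g \<in> Q \<or> \<sigma> g = 0 \<and> g \<in> C"
    then show "\<sigma> f + \<sigma> g \<in> Q \<or> \<sigma> f + \<sigma> g = 0 \<and> f + g \<in> C"
      by (elim disjE conjE) (metis Q.add_closed, simp_all add: C.add_closed)
  next
    fix f :: thompson assume "f \<noteq> 0"
    then show "(\<sigma> f \<in> Q \<or> \<sigma> f = 0 \<and> f \<in> C) \<or> - \<sigma> f \<in> Q \<or> - \<sigma> f = 0 \<and> - f \<in> C"
      using Q.total[of "\<sigma> f"] C.total[of f] by auto
  qed (use C.conj_closed in blast)
qed

context thompson_bicone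
begin

text \<open>A positive element outside F' stays positive when it is changed by an element of F',
  which it dominates. So outside F' the sign depends only on the pair of slope exponents.\<close>

lemma lex_cone_if_dominates:
  assumes dom: "\<And>f g. f \<in> P \<Longrightarrow> f \<notin> derived \<Longrightarrow> g \<in> derived \<Longrightarrow> g \<sqsubset> f"
    and C: "P \<inter> derived = C \<inter> derived"
  shows "\<exists>Q. bi_cone Q \<and> P = lex_cone C Q"
proof -
  define \<sigma> where "\<sigma> f = (slope0 f, slope1 f)" for f
  have \<sigma>: "\<sigma> (f + g) = \<sigma> f + \<sigma> g" "\<sigma> (- f) = - \<sigma> f" "\<sigma> 0 = 0" for f g
    by (simp_all add: \<sigma>_def flip: zero_prod_def)
  have der: "f \<in> derived \<longleftrightarrow> \<sigma> f = 0" for f by (simp add: derived_iff_slopes \<sigma>_def)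
  have surj: "\<exists>f. \<sigma> f = v" for v
    using thompson_with_slopes[of "fst v" "snd v"] by (metis \<sigma>_def prod.collapse)
  define Q where "Q = \<sigma> ` (P - derived)"
  have Q: "\<sigma> f \<in> Q \<longleftrightarrow> f \<in> P \<and> f \<notin> derived" for f
  proof
    assume "\<sigma> f \<in> Q"
    then obtain g where g: "\<sigma> f = \<sigma> g" "g \<in> P" "g \<notin> derived" unfolding Q_def by blast
    have "- (- g + f) \<in> derived" using g(1) \<sigma> by (simp add: der del: minus_add)
    then have "- (- g + f) \<sqsubset> g" by (rule dom[OF g(2,3)])
    then show "f \<in> P \<and> f \<notin> derived" using g by (simp add: lt_def group_norm der)
  qed (simp add: Q_def)
  have "bi_cone Q" unfolding bi_cone_def
  proof (intro conjI ballI allI impI)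
    show "0 \<notin> Q" by (auto simp: Q_def der)
    fix u v assume "u \<in> Q" "v \<in> Q"
    then obtain f g where f: "u = \<sigma> f" "f \<in> P" "f \<notin> derived" and g: "v = \<sigma> g" "g \<in> P" "g \<notin> derived"
      unfolding Q_def by blast
    \<comment> \<open>Otherwise \<open>f\<close> would dominate \<open>f + g\<close>, which makes
      \<open>g\<close> negative.\<close>
    have "f + g \<notin> derived"
    proof
      assume "f + g \<in> derived"
      then have "f + g \<sqsubset> f" by (rule dom[OF f(2,3)])
      then have "f + g \<sqsubset> f + 0" by simp
      then have "g \<sqsubset> 0" by (simp only: lt_add_left)
      then show False using g(2) not_both by (simp add: lt_def)
    qed
    then show "u + v \<in> Q" using Q[of "f + g"] f g \<sigma> add_closed by simp
  next
    fix u :: "int \<times> int" assume "u \<noteq> 0"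
    obtain f where f: "u = \<sigma> f" using surj by metis
    then have nd: "f \<notin> derived" "- f \<notin> derived" using \<open>u \<noteq> 0\<close> \<sigma> by (auto simp: der)
    then have "f \<noteq> 0" using \<sigma> by (auto simp: der)
    then show "u \<in> Q \<or> - u \<in> Q" using total Q[of f] Q[of "- f"] nd f \<sigma> by auto
  next
    fix u h :: "int \<times> int" assume "u \<in> Q" then show "h + u - h \<in> Q" by simp
  qed
  moreover have "P = lex_cone C Q"
    unfolding lex_cone_def set_eq_iff mem_Collect_eq \<sigma>_def[symmetric] Q using C by blast
  ultimately show ?thesis by blast
qed

context
  assumes lead: "P \<inter> derived = lead_cone 1 1 \<inter> derived"
begin

lemma derived_in_iff: "f \<in> derived \<Longrightarrow> lead f p m \<Longrightarrow> f \<in> P \<longleftrightarrow> m > 0"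
  using lead lead_cone_iff[of f p m 1 1] by auto

text \<open>An \<open>f\<close> that moves points near 0 shifts a small interval off itself to the
  left of the support of \<open>g\<close>. If \<open>f\<close> were below \<open>g\<close>, the
  commutator estimate would put \<open>- (s - t)\<close> below \<open>g\<close> as well; but the
  support of this element begins left of that of \<open>g\<close> with exponent 1, so the rule on F'
  puts it above \<open>g\<close>.\<close>

lemma slope0_dominates:
  assumes f: "f \<in> P" "slope0 f \<noteq> 0" and g: "g \<in> derived" shows "g \<sqsubset> f"
proof (rule ccontr)
  assume "\<not> g \<sqsubset> f"
  moreover have "f \<noteq> g" using f g by (auto simp: derived_def)
  ultimately have fg: "f \<sqsubset> g" using lt_total by blast
  obtain a b where ab: "dyadic a" "dyadic b" "0 < a" "a < b" "b < 1" "supported g a b"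
    using derived_supported[OF g] .
  have "lead f 0 (slope0 f)" using f by (simp add: lead_0_iff)
  then obtain \<phi> a' b' where \<phi>: "\<phi> = f \<or> \<phi> = - f" "dyadic a'" "dyadic b'" "0 < a'" "a' < b'"
    "b' < app \<phi> a'" "app \<phi> b' < a"
    by (rule shift_near_lead[OF _ ab(3)])
  have \<phi>ab: "app \<phi> a' < app \<phi> b'" using \<phi> by simp
  have "b' < 1" using \<phi> \<phi>ab ab by linarith
  then obtain t where t: "lead t a' 1" "trail t b' 1"
    using thompson_with_lead_trail[of a' b' 1 1] \<phi> by auto
  have ts: "supported t a' b'" using t lead_trail_supported by blast
  define s where "s = \<phi> + t - \<phi>"
  have s: "supported s (app \<phi> a') (app \<phi> b')" unfolding s_def by (rule supported_conj[OF ts])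
  have tg: "t + g = g + t" by (rule disjoint_supports_commute[OF ts ab(6)]) (use \<phi> \<phi>ab in linarith)
  have sg: "s + g = g + s" by (rule disjoint_supports_commute[OF s ab(6)]) (use \<phi> in linarith)
  have st: "s + t = t + s" by (rule disjoint_supports_commute[OF ts s, symmetric]) (use \<phi> in linarith)
  have 1: "s - t \<sqsubset> g" by (rule lt_commutator'[OF f(1) fg \<phi>(1) s_def tg sg st])
  \<comment> \<open>The estimate is applied with \<open>- t\<close> in place of \<open>t\<close>,
    because the inverse of the commutator has the positive leading exponent.\<close>
  have "- s = \<phi> + - t - \<phi>" by (simp add: s_def group_norm)
  then have "- s - (- t) \<sqsubset> g"
    by (rule lt_commutator'[OF f(1) fg \<phi>(1)])
      (use commute_uminus[OF tg] commute_uminus[OF sg] commute_uminus[OF commute_uminus[OF st, symmetric], symmetric] in simp_all)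
  moreover have "- s - (- t) = - (s - t)" using commute_uminus[OF st] by simp
  ultimately have 2: "- (s - t) \<sqsubset> g" by simp
  define w where "w = s - t"
  have "lead s (app \<phi> a') 1" unfolding s_def by (rule lead_conj[OF t(1)])
  have w: "lead w a' (- 1)"
    unfolding w_def diff_conv_add_uminus
    by (rule lead_plus_left(2)[OF lead_uminus[OF t(1)], of "app \<phi> a'"]) (use s \<phi> in \<open>auto simp: supported_def\<close>)
  have wd: "w \<in> derived"
    unfolding w_def using supported_derived[OF ts] supported_derived[OF s] \<phi> \<phi>ab ab by simp
  have "a' < a" using \<phi> \<phi>ab by linarith
  then have "lead (- w + - g) a' 1"
    by (rule lead_plus_left(1)[of _ _ _ a, rotated 2]) (use lead_uminus[OF w] ab in \<open>auto simp: supported_def\<close>)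
  then have "- w + - g \<in> P" using derived_in_iff[of "- w + - g" a' 1] wd g by (simp del: add_uminus_conv_diff)
  then have "g \<sqsubset> - w" by (simp add: lt_def)
  then show False using 2 lt_trans lt_irrefl unfolding w_def by blast
qed

text \<open>If \<open>m < 0\<close>, split \<open>f\<close> as \<open>c + k\<close>, where
  \<open>c\<close> in F' carries the left end of \<open>f\<close> and \<open>k\<close> begins
  further right. Then \<open>- c \<sqsubset> k \<sqsubset> - c + g\<close>. An element
  \<open>u\<close> commuting with \<open>k\<close> drags the left end of \<open>- c\<close> to the
  left of the support of \<open>- c + g\<close>. The result stays below \<open>k\<close>, yet with
  exponent \<open>- m > 0\<close> it exceeds \<open>- c + g\<close>.\<close>

lemma dominated_lead_pos:
  assumes f: "f \<in> P" "slope0 f = 0" "slope1 f \<noteq> 0" "lead f p m" and g: "g \<in> derived" "f \<sqsubset> g"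
  shows "m > 0"
proof (rule ccontr)
  assume "\<not> m > 0"
  then have m: "m < 0" using f(4) by (auto simp: lead_def)
  have p: "dyadic p" "0 < p" "p < 1" using lead_range[OF f(4)] lead_pos_iff[OF f(4)] f(2) by auto
  obtain c0 where c0: "dyadic c0" "p < c0" "c0 < 1" using dyadic_dense[OF p(3)] by blast
  have "max c0 (app f c0) < 1" using c0 by simp
  then obtain r where r: "dyadic r" "max c0 (app f c0) < r" "r < 1" using dyadic_dense by blast
  \<comment> \<open>\<open>t\<close> follows \<open>f\<close> up to \<open>c0\<close> and returns to
    the identity from \<open>r\<close> on; it becomes the factor \<open>c\<close>.\<close>
  obtain t where t: "t \<in> pl2" "\<And>x. x \<le> c0 \<Longrightarrow> t x = app f x" "\<And>x. r \<le> x \<Longrightarrow> t x = id x"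
    using pl2_connect[OF app_pl2[of f] pl2_id c0(1) r(1)] r by auto
  obtain c where c: "app c = t" by (rule thompson_of_pl2[OF t(1)]) (use t c0 r p in auto)
  have cl: "lead c p m" by (rule lead_change[OF f(4) c0(2)]) (use t c in auto)
  have "supported c p r" using cl t(3) c by (auto simp: supported_def lead_def)
  then have cd: "c \<in> derived" by (rule supported_derived) (use p r in auto)
  define k where "k = - c + f"
  have "app k x = x" if "x \<le> c0" for x
    using t(2)[OF that, symmetric] by (simp add: k_def flip: c)
  then have k: "supported k c0 1" by (simp add: supported_def)
  have "k + c = - c + (c + k) - (- c)" by (simp add: group_norm)
  also have "c + k = f" by (simp add: k_def group_norm)
  also have "- c + f - (- c) \<in> P" by (rule conj_closed[OF f(1)])
  finally have hk: "- c \<sqsubset> k" by (simp add: lt_def)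
  have kg: "k \<sqsubset> - c + g" unfolding k_def lt_add_left by (rule g)
  obtain a b where ab: "dyadic a" "dyadic b" "0 < a" "a < b" "b < 1" "supported (- c + g) a b"
    using derived_supported[of "- c + g"] cd g(1) by (metis derived_simps(2,3))
  obtain d where d: "dyadic d" "0 < d" "d < min a p" using dyadic_dense[of 0 "min a p"] ab p by auto
  \<comment> \<open>The support of \<open>u\<close> ends at \<open>c0\<close>, where that of
    \<open>k\<close> begins, so the two commute.\<close>
  obtain u where u: "app u p = d" "supported u 0 c0"
    using thompson_push[OF p(1) d(1) c0(1) p(2) c0(2) d(2)] d c0 by auto
  have "u + k = k + u" by (rule disjoint_supports_commute[OF u(2) k]) simp
  then have "u + k - u = k" by simp
  then have 1: "u + - c - u \<sqsubset> k" using hk lt_conj[of u "- c" k] by simp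
  have ul: "lead (u + - c - u) d (- m)" using lead_conj[OF lead_uminus[OF cl], of u] u(1) by simp
  have "lead ((u + - c - u) + - (- c + g)) d (- m)"
    by (rule lead_plus_left(1)[OF ul, of a]) (use ab d in \<open>auto simp: supported_def simp del: minus_add\<close>)
  moreover have "(u + - c - u) + - (- c + g) \<in> derived"
    using cd g(1) by (simp del: minus_add add_uminus_conv_diff)
  ultimately have "(u + - c - u) + - (- c + g) \<in> P" using derived_in_iff m by simp
  then have "- c + g \<sqsubset> u + - c - u" by (simp add: lt_def del: minus_add)
  then show False using 1 kg lt_trans lt_irrefl by blast
qed

lemma le_nmul: "f \<in> P \<Longrightarrow> j > 0 \<Longrightarrow> f \<sqsubseteq> nmul j f"
proof -
  assume f: "f \<in> P" "j > 0"
  then obtain i where i: "j = Suc i" by (cases j) auto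
  have "nmul i f = 0 \<or> nmul i f \<in> P" using nmul_in[OF f(1), of i] by (cases i) auto
  then have "0 \<sqsubseteq> nmul i f" using pos_iff by (auto simp: le_def)
  then show ?thesis using le_add_left[of 0 "nmul i f" f] by (simp add: i)
qed

text \<open>Modulo F' the elements with slope 1 at 0 are determined by their exponent at 1. So a
  multiple of \<open>f\<close> agrees modulo F' with a multiple of \<open>f0\<close> or of its
  inverse. In the first case the bound of \<open>f0\<close> is transferred; in the second, adding
  the positive multiple of \<open>f0\<close> lands in F'.\<close>

lemma bounded_if_one_bounded:
  assumes f0: "f0 \<in> P" "slope0 f0 = 0" "slope1 f0 \<noteq> 0" "f0 \<sqsubset> g0" "g0 \<in> derived"
    and f: "f \<in> P" "slope0 f = 0"
  shows "\<exists>g\<in>derived. f \<sqsubset> g"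
proof (cases "slope1 f = 0")
  case True
  then have "f + f \<in> derived" using f by (simp add: derived_def)
  moreover have "f \<sqsubset> f + f" using f(1) by (simp add: lt_def)
  ultimately show ?thesis by blast
next
  case False
  define a b where "a = slope1 f0" "b = slope1 f"
  define i j where "i = nat \<bar>a\<bar>" "j = nat \<bar>b\<bar>"
  have ij: "i > 0" "j > 0" using f0 False by (auto simp: a_b_def i_j_def)
  have "\<exists>h\<in>derived. nmul i f \<sqsubseteq> h"
  proof (cases "a * b > 0")
    case True
    then have "int i * b = int j * a" by (auto simp: i_j_def zero_less_mult_iff)
    then have e: "nmul i f - nmul j f0 \<in> derived" using f f0 by (simp add: derived_def slope_nmul a_b_def)
    have "nmul j f0 \<sqsubseteq> nmul j g0" using f0 by (intro nmul_le_mono) (simp add: le_def)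
    then have "(nmul i f - nmul j f0) + nmul j f0 \<sqsubseteq> (nmul i f - nmul j f0) + nmul j g0" by (rule le_add_left)
    then have "nmul i f \<sqsubseteq> (nmul i f - nmul j f0) + nmul j g0" by simp
    moreover have "nmul j g0 \<in> derived" using f0(5) by (induction j) auto
    ultimately show ?thesis using e derived_simps(2) by blast
  next
    case F: False
    have "a \<noteq> 0" "b \<noteq> 0" using f0 False by (auto simp: a_b_def)
    then have "a * b < 0" using F by (metis linorder_neqE mult_eq_0_iff)
    then have "int i * b + int j * a = 0" by (auto simp: i_j_def mult_less_0_iff)
    then have "nmul i f + nmul j f0 \<in> derived" using f f0 by (simp add: derived_def slope_nmul a_b_def)
    moreover have "0 \<sqsubseteq> nmul j f0" using nmul_in[OF f0(1) ij(2)] pos_iff by (simp add: le_def)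
    then have "nmul i f + 0 \<sqsubseteq> nmul i f + nmul j f0" by (rule le_add_left)
    ultimately show ?thesis by (intro bexI[of _ "nmul i f + nmul j f0"]) auto
  qed
  then obtain h where h: "h \<in> derived" "nmul i f \<sqsubseteq> h" by blast
  then have "f \<sqsubseteq> h" using le_trans[OF le_nmul[OF f(1) ij(1)]] by blast
  moreover have "f \<noteq> h" using h(1) False by (auto simp: derived_def)
  ultimately show ?thesis using h(1) by (auto simp: le_def)
qed

theorem lead_classification:
  "P = lead_cone 1 1 \<or> P = lead_cone (- 1) 1 \<or> (\<exists>Q. bi_cone Q \<and> P = lex_cone (lead_cone 1 1) Q)"
proof (cases "\<forall>f g. f \<in> P \<longrightarrow> f \<notin> derived \<longrightarrow> g \<in> derived \<longrightarrow> g \<sqsubset> f")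
  case True
  then show ?thesis using lex_cone_if_dominates[OF _ lead] by blast
next
  case False
  then obtain f0 g0 where f0: "f0 \<in> P" "f0 \<notin> derived" "g0 \<in> derived" "\<not> g0 \<sqsubset> f0" by blast
  then have s0: "slope0 f0 = 0" using slope0_dominates by blast
  then have s1: "slope1 f0 \<noteq> 0" using f0 by (auto simp: derived_def)
  have "f0 \<sqsubset> g0" using f0 lt_total by blast
  then have bounded: "\<exists>g\<in>derived. f \<sqsubset> g" if "f \<in> P" "slope0 f = 0" for f
    using bounded_if_one_bounded[OF f0(1) s0 s1 _ f0(3)] that by blast
  have pos: "m > 0" if "f \<in> P" "slope0 f = 0" "lead f p m" for f p m
  proof (cases "slope1 f = 0")
    case True
    then show ?thesis using that derived_in_iff[of f p m] by (simp add: derived_def)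
  next
    case False
    then show ?thesis using dominated_lead_pos[OF that(1,2) False that(3)] bounded[OF that(1,2)] by blast
  qed
  have iff0: "f \<in> P \<longleftrightarrow> m > 0" if "slope0 f = 0" "lead f p m" for f p m
    using pos[of f p m] pos[of "- f" p "- m"] that lead_uminus[of f p m] total[of f] lead_nonzero[of f p m] not_both by auto
  \<comment> \<open>A positive \<open>e\<close> is bounded by F', and F' in turn lies below every
    positive element whose slope at 0 is not 1.\<close>
  have big: "e \<sqsubset> d" if d: "d \<in> P" "slope0 d \<noteq> 0" and e: "slope0 e = 0" for d e
  proof (cases "e \<in> P")
    case True
    then obtain g where "g \<in> derived" "e \<sqsubset> g" using bounded e by blast
    then show ?thesis using slope0_dominates[OF d] lt_trans by blast
  next
    case False
    then have "e = 0 \<or> - e \<in> P" using total by blast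
    then have "e \<sqsubseteq> 0" by (auto simp: le_def lt_def)
    then show ?thesis using d(1) pos_iff le_lt_trans by blast
  qed
  \<comment> \<open>\<open>nmul j d\<close> has the same slope at 0 as \<open>f\<close> and so
    dominates the inverse of the difference \<open>f - nmul j d\<close>. Adding this difference to
    it gives a positive conjugate of \<open>f\<close>.\<close>
  have *: "f \<in> P" if d: "d \<in> P" "slope0 d = e" "e = 1 \<or> e = - 1" and f: "slope0 f * e > 0" for f d e
  proof -
    define j where "j = nat (slope0 f * e)"
    have j: "j > 0" "int j * e = slope0 f" using f d(3) by (auto simp: j_def)
    have "- (f - nmul j d) \<sqsubset> nmul j d"
      by (rule big) (use j d nmul_in[OF d(1) j(1)] in \<open>auto simp: slope_nmul simp del: minus_diff_eq\<close>)
    then have "nmul j d + (f - nmul j d) \<in> P" by (simp add: lt_def group_norm)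
    then have "- nmul j d + (nmul j d + (f - nmul j d)) - (- nmul j d) \<in> P" by (rule conj_closed)
    then show ?thesis by (simp add: group_norm)
  qed
  obtain d where d: "slope0 d = 1" using thompson_with_slopes by metis
  have cone: "P = lead_cone e 1" if "d' \<in> P" "slope0 d' = e" "e = 1 \<or> e = - 1" for d' e
  proof -
    have "f \<in> lead_cone e 1" if "f \<in> P" for f
    proof -
      have "f \<noteq> 0" using that zero_notin by blast
      then obtain p m where f: "lead f p m" using lead_exists by blast
      show ?thesis
      proof (cases "p = 0")
        case True
        then have "slope0 f = m" "m \<noteq> 0" using f lead_0_iff by auto
        moreover have "\<not> slope0 (- f) * e > 0"
          using *[OF \<open>d' \<in> P\<close> \<open>slope0 d' = e\<close> \<open>e = 1 \<or> e = - 1\<close>, of "- f"] not_both[OF that] by blast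
        ultimately have "e * m > 0" using \<open>e = 1 \<or> e = - 1\<close> by auto
        then show ?thesis using True lead_cone_iff[OF f] by simp
      next
        case False
        then have "slope0 f = 0" using lead_pos_iff[OF f] lead_range(1)[OF f] by simp
        then have "m > 0" using iff0[OF _ f] that by blast
        then show ?thesis using False lead_cone_iff[OF f] by simp
      qed
    qed
    moreover have "bi_cone (lead_cone e 1)" using \<open>e = 1 \<or> e = - 1\<close> by (intro bi_cone_lead_cone) auto
    then interpret L: bicone "lead_cone e 1" by unfold_locales
    have "f \<in> P" if "f \<in> lead_cone e 1" for f
      using that calculation[of "- f"] L.not_both[OF that] L.zero_notin total[of f] by metis
    ultimately show ?thesis by blast
  qed
  have "d \<in> P \<or> - d \<in> P" using total[of d] d by (metis slope0_zero zero_neq_one)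
  then show ?thesis using cone[of d 1] cone[of "- d" "- 1"] d by auto
qed

end

end

lemma uminus_lex_cone: "uminus ` lex_cone C Q = lex_cone (uminus ` C) (uminus ` Q)"
  unfolding set_eq_iff mem_uminus_image by (auto simp: lex_cone_def mem_uminus_image)

lemma flip_lex_cone: "flip ` lex_cone C Q = lex_cone (flip ` C) (prod.swap ` Q)"
proof -
  have swap: "v \<in> prod.swap ` Q \<longleftrightarrow> prod.swap v \<in> Q" for v :: "int \<times> int"
    by (rule mem_image_involution) simp
  show ?thesis unfolding set_eq_iff mem_flip_image by (auto simp: lex_cone_def mem_flip_image swap)
qed

lemma bi_cone_swap: "bi_cone Q \<Longrightarrow> bi_cone (prod.swap ` Q)" for Q :: "(int \<times> int) set"
proof -
  assume "bi_cone Q"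
  then interpret bicone Q by unfold_locales
  have swap: "v \<in> prod.swap ` Q \<longleftrightarrow> prod.swap v \<in> Q" for v :: "int \<times> int"
    by (rule mem_image_involution) simp
  have "prod.swap (u + v) = prod.swap u + prod.swap v" "prod.swap (- u) = - prod.swap u" for u v :: "int \<times> int"
    by (simp_all add: prod_eq_iff)
  moreover have "prod.swap u = 0 \<longleftrightarrow> u = 0" for u :: "int \<times> int" by (auto simp: prod_eq_iff)
  ultimately show ?thesis unfolding bi_cone_def Ball_def swap using zero_notin total add_closed
    by (auto simp: zero_prod_def)
qed

text \<open>Negation of the cone changes the sign \<open>s\<close>; reflection exchanges
  \<open>lead_cone\<close> and \<open>trail_cone\<close> and swaps the lattice coordinates. Both
  preserve the list on the right, which leaves the cones that agree with
  \<open>lead_cone 1 1\<close> on F'.\<close>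

theorem bi_cone_classification:
  "bi_cone P \<longleftrightarrow>
     (\<exists>s0\<in>{1, - 1}. \<exists>s1\<in>{1, - 1}. P = lead_cone s0 s1 \<or> P = trail_cone s0 s1) \<or>
     (\<exists>s\<in>{1, - 1}. \<exists>Q. bi_cone Q \<and> (P = lex_cone (lead_cone s s) Q \<or> P = lex_cone (trail_cone s s) Q))"
    (is "_ \<longleftrightarrow> ?R P")
proof
  assume "?R P"
  moreover have "s \<in> {1, - 1} \<Longrightarrow> s \<noteq> 0" for s :: int by auto
  ultimately show "bi_cone P"
    using bi_cone_lead_cone bi_cone_trail_cone bi_cone_lex_cone by metis
next
  have 1: "?R P" if "bi_cone P" "P \<inter> derived = lead_cone 1 1 \<inter> derived" for P
  proof -
    interpret thompson_bicone P by unfold_locales fact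
    show ?thesis using lead_classification[OF that(2)] by blast
  qed
  have RI1: "?R P" if "s0 \<in> {1, - 1}" "s1 \<in> {1, - 1}" "P = lead_cone s0 s1" for P s0 s1 using that by blast
  have RI2: "?R P" if "s0 \<in> {1, - 1}" "s1 \<in> {1, - 1}" "P = trail_cone s0 s1" for P s0 s1 using that by blast
  have RI3: "?R P" if "s \<in> {1, - 1}" "bi_cone Q" "P = lex_cone (lead_cone s s) Q" for P s Q using that by blast
  have RI4: "?R P" if "s \<in> {1, - 1}" "bi_cone Q" "P = lex_cone (trail_cone s s) Q" for P s Q using that by blast
  have R_uminus: "?R P" if "?R (uminus ` P)" for P
  proof -
    have P: "P = uminus ` uminus ` P" by (simp add: image_image)
    have neg: "- s \<in> {1, - 1}" if "s \<in> {1, - 1}" for s :: int using that by auto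
    from that show ?thesis
    proof (elim disjE bexE exE conjE)
      fix s0 s1 :: int assume s: "s0 \<in> {1, - 1}" "s1 \<in> {1, - 1}" "uminus ` P = lead_cone s0 s1"
      then have "P = lead_cone (- s0) (- s1)" using P uminus_lead_cone by metis
      then show ?thesis using RI1 s(1,2)[THEN neg] by blast
    next
      fix s0 s1 :: int assume s: "s0 \<in> {1, - 1}" "s1 \<in> {1, - 1}" "uminus ` P = trail_cone s0 s1"
      then have "P = uminus ` flip ` lead_cone s0 s1" using P flip_lead_cone by metis
      also have "\<dots> = trail_cone (- s0) (- s1)"
        by (simp add: image_image flip: flip_lead_cone uminus_lead_cone flip_uminus)
      finally show ?thesis using RI2 s(1,2)[THEN neg] by blast
    next
      fix s :: int and Q assume s: "s \<in> {1, - 1}" "bi_cone Q" "uminus ` P = lex_cone (lead_cone s s) Q"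
      then have "P = lex_cone (lead_cone (- s) (- s)) (uminus ` Q)" using P uminus_lead_cone uminus_lex_cone by metis
      then show ?thesis using RI3 neg[OF s(1)] bi_cone_uminus[OF s(2)] by blast
    next
      fix s :: int and Q assume s: "s \<in> {1, - 1}" "bi_cone Q" "uminus ` P = lex_cone (trail_cone s s) Q"
      then have "P = lex_cone (uminus ` trail_cone s s) (uminus ` Q)" using P uminus_lex_cone by metis
      also have "uminus ` trail_cone s s = trail_cone (- s) (- s)"
        by (simp add: image_image flip: flip_lead_cone uminus_lead_cone flip_uminus)
      finally show ?thesis using RI4 neg[OF s(1)] bi_cone_uminus[OF s(2)] by blast
    qed
  qed
  have R_flip: "?R P" if "?R (flip ` P)" for P
  proof -
    have P: "P = flip ` flip ` P" by (simp add: image_image)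
    have ft: "flip ` trail_cone s0 s1 = lead_cone s0 s1" for s0 s1
      by (simp add: image_image flip: flip_lead_cone)
    from that show ?thesis
    proof (elim disjE bexE exE conjE)
      fix s0 s1 :: int assume s: "s0 \<in> {1, - 1}" "s1 \<in> {1, - 1}" "flip ` P = lead_cone s0 s1"
      then have "P = trail_cone s0 s1" using P flip_lead_cone by metis
      then show ?thesis using RI2 s(1,2) by blast
    next
      fix s0 s1 :: int assume s: "s0 \<in> {1, - 1}" "s1 \<in> {1, - 1}" "flip ` P = trail_cone s0 s1"
      then have "P = lead_cone s0 s1" using P ft by metis
      then show ?thesis using RI1 s(1,2) by blast
    next
      fix s :: int and Q assume s: "s \<in> {1, - 1}" "bi_cone Q" "flip ` P = lex_cone (lead_cone s s) Q"
      then have "P = lex_cone (trail_cone s s) (prod.swap ` Q)" using P flip_lead_cone flip_lex_cone by metis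
      then show ?thesis using RI4 s(1) bi_cone_swap[OF s(2)] by blast
    next
      fix s :: int and Q assume s: "s \<in> {1, - 1}" "bi_cone Q" "flip ` P = lex_cone (trail_cone s s) Q"
      then have "P = lex_cone (lead_cone s s) (prod.swap ` Q)" using P ft flip_lex_cone by metis
      then show ?thesis using RI3 s(1) bi_cone_swap[OF s(2)] by blast
    qed
  qed
  have inter_image: "f ` P \<inter> derived = f ` C \<inter> derived"
    if "P \<inter> derived = C \<inter> derived" "\<And>x. f (f x) = x" "\<And>x. f x \<in> derived \<longleftrightarrow> x \<in> derived" for f P C
    using that(1) unfolding set_eq_iff Int_iff mem_image_involution[of f, OF that(2)] by (metis that(3))
  have 2: "?R P" if "bi_cone P" "s \<in> {1, - 1}" "P \<inter> derived = lead_cone s s \<inter> derived" for P s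
  proof (cases "s = 1")
    case True then show ?thesis using 1[OF that(1)] that(3) by simp
  next
    case False
    then have "uminus ` P \<inter> derived = uminus ` lead_cone (- 1) (- 1) \<inter> derived"
      using that by (intro inter_image) auto
    then have "?R (uminus ` P)" using 1[OF bi_cone_uminus[OF that(1)]] by (simp add: uminus_lead_cone)
    then show ?thesis by (rule R_uminus)
  qed
  assume P: "bi_cone P"
  then interpret thompson_bicone P by unfold_locales
  obtain s :: int where s: "s \<in> {1, - 1}"
    "P \<inter> derived = lead_cone s s \<inter> derived \<or> P \<inter> derived = trail_cone s s \<inter> derived"
    using derived_classification by blast
  from s(2) show "?R P"
  proof
    assume "P \<inter> derived = lead_cone s s \<inter> derived"
    then show ?thesis by (rule 2[OF P s(1)])
  next
    assume "P \<inter> derived = trail_cone s s \<inter> derived"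
    then have "flip ` P \<inter> derived = flip ` trail_cone s s \<inter> derived" by (rule inter_image) auto
    also have "flip ` trail_cone s s = lead_cone s s" by (simp add: image_image flip: flip_lead_cone)
    finally have "?R (flip ` P)" by (rule 2[OF bi_cone_flip[OF P] s(1)])
    then show ?thesis by (rule R_flip)
  qed
qed

subsection \<open>Perfect sets of binary sequences\<close>

lemma continuous_on_if_locally_constant:
  fixes g :: "(nat \<Rightarrow> bool) \<Rightarrow> 'a::topological_space"
  assumes "\<And>x. x \<in> K \<Longrightarrow> \<exists>n. \<forall>y\<in>K. (\<forall>i<n. y i = x i) \<longrightarrow> g y = g x"
  shows "continuous_on K g"
  unfolding continuous_on_topological
proof (intro ballI allI impI)
  fix x B assume x: "x \<in> K" and B: "g x \<in> B"
  obtain n where n: "\<And>y. y \<in> K \<Longrightarrow> (\<forall>i<n. y i = x i) \<Longrightarrow> g y = g x" using assms[OF x] by blast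
  have "open ((\<lambda>y::nat \<Rightarrow> bool. y i) -` {x i})" for i
    by (rule open_vimage[OF open_discrete continuous_on_product_coordinates])
  then have "open (\<Inter>i<n. (\<lambda>y::nat \<Rightarrow> bool. y i) -` {x i})" by (intro open_INT) auto
  then show "\<exists>A. open A \<and> x \<in> A \<and> (\<forall>y\<in>K. y \<in> A \<longrightarrow> g y \<in> B)"
    using n B by (intro exI[of _ "\<Inter>i<n. (\<lambda>y::nat \<Rightarrow> bool. y i) -` {x i}"]) auto
qed

definition cantor_value :: "(nat \<Rightarrow> bool) \<Rightarrow> real" where
  "cantor_value b = (\<Sum>n. (if b n then 2 else 0) / 3 ^ Suc n)"

lemma cantor_bound_sums: "(\<lambda>n. 2 / 3 ^ Suc n :: real) sums 1"
  using sums_mult[OF geometric_sums[of "1/3::real"], of "2/3"] by (simp add: power_one_over field_simps)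

lemma cantor_summable: "summable (\<lambda>n. (if b n then 2 else 0) / 3 ^ Suc n :: real)"
  by (rule summable_comparison_test'[OF sums_summable[OF cantor_bound_sums], of 0]) auto

lemma range_cantor_value: "range cantor_value = cantor_set"
proof (intro equalityI subsetI)
  fix x assume "x \<in> range cantor_value"
  then obtain b where b: "x = cantor_value b" by blast
  have "(\<lambda>n. real (if b n then 2 else 0) / 3 ^ Suc n) sums x"
    using summable_sums[OF cantor_summable[of b]] by (simp add: b cantor_value_def if_distrib cong: if_cong)
  then show "x \<in> cantor_set"
    unfolding cantor_set_def by (intro CollectI exI[of _ "\<lambda>n. if b n then 2 else 0"]) auto
next
  fix x assume "x \<in> cantor_set"
  then obtain d :: "nat \<Rightarrow> nat" where d: "\<And>n. d n \<in> {0, 2}" "(\<lambda>n. real (d n) / 3 ^ Suc n) sums x"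
    unfolding cantor_set_def by blast
  have "real (d n) = (if d n = 2 then 2 else 0)" for n using d(1)[of n] by auto
  then have "x = cantor_value (\<lambda>n. d n = 2)"
    using sums_unique[OF d(2)] by (simp add: cantor_value_def)
  then show "x \<in> range cantor_value" by blast
qed

text \<open>The first differing digit contributes \<open>2 / 3 ^ Suc n\<close>, while the tail of
  the smaller sum is at most \<open>1 / 3 ^ Suc n\<close>.\<close>

lemma inj_cantor_value: "inj cantor_value"
proof (rule injI, rule ccontr)
  have less: "cantor_value b < cantor_value c"
    if n: "\<And>i. i < n \<Longrightarrow> b i = c i" "\<not> b n" "c n" for b c n
  proof -
    let ?f = "\<lambda>b i. (if b i then 2 else 0) / 3 ^ Suc i :: real"
    have split: "cantor_value b = (\<Sum>i. ?f b (i + Suc n)) + (\<Sum>i<Suc n. ?f b i)" for b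
      unfolding cantor_value_def by (rule suminf_split_initial_segment[OF cantor_summable])
    have sb: "summable (\<lambda>i. ?f b (i + Suc n))" for b using summable_ignore_initial_segment[OF cantor_summable] .
    have e: "(\<lambda>i. 2 / 3 ^ Suc (i + Suc n) :: real) sums (1 / 3 ^ Suc n)"
      using sums_mult[OF cantor_bound_sums, of "1 / 3 ^ Suc n"] by (simp add: power_add field_simps)
    have "(\<Sum>i. ?f b (i + Suc n)) \<le> (\<Sum>i. 2 / 3 ^ Suc (i + Suc n))"
      by (rule suminf_le[OF _ sb sums_summable[OF e]]) auto
    then have "(\<Sum>i. ?f b (i + Suc n)) \<le> 1 / 3 ^ Suc n" using sums_unique[OF e] by simp
    moreover have "0 \<le> (\<Sum>i. ?f c (i + Suc n))" by (rule suminf_nonneg[OF sb]) auto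
    moreover have "(\<Sum>i<n. ?f b i) = (\<Sum>i<n. ?f c i)" by (rule sum.cong) (use n in auto)
    then have "(\<Sum>i<Suc n. ?f b i) + 2 / 3 ^ Suc n = (\<Sum>i<Suc n. ?f c i)" using n by simp
    moreover have "(0::real) < 1 / 3 ^ Suc n" by simp
    ultimately show ?thesis unfolding split[of b] split[of c] by linarith
  qed
  fix b c assume eq: "cantor_value b = cantor_value c" "b \<noteq> c"
  then obtain m where "b m \<noteq> c m" by blast
  define n where "n = (LEAST n. b n \<noteq> c n)"
  have "b n \<noteq> c n" unfolding n_def by (rule LeastI[of _ m]) fact
  moreover have "b i = c i" if "i < n" for i using not_less_Least that unfolding n_def by blast
  ultimately show False using less[of n b c] less[of n c b] eq(1) by (cases "b n") auto
qed

text \<open>A closed perfect set of sequences is the set of branches of a binary tree in which every branch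
  splits infinitely often; recording the direction taken at the successive splittings
  identifies it with the set of all sequences.\<close>

locale perfect_set =
  fixes K :: "(nat \<Rightarrow> bool) set"
  assumes closed: "closed K" and nonempty: "K \<noteq> {}"
    and perfect: "\<And>x n. x \<in> K \<Longrightarrow> \<exists>y\<in>K. y \<noteq> x \<and> (\<forall>i<n. y i = x i)"
begin

lemma compact: "compact K"
proof -
  have "compact_space (euclidean :: bool topology)" by (simp add: compact_space_def finite_imp_compact)
  then have "compact_space (product_topology (\<lambda>_::nat. euclidean :: bool topology) UNIV)"
    using compact_space_product_topology by blast
  then have "compactin euclidean (UNIV :: (nat \<Rightarrow> bool) set)"
    unfolding euclidean_product_topology compact_space_def topspace_euclidean .
  then have "compact (UNIV :: (nat \<Rightarrow> bool) set)" by simp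
  then show ?thesis using closed by (metis compact_Int_closed inf_top_left)
qed

definition splits :: "(nat \<Rightarrow> bool) \<Rightarrow> nat \<Rightarrow> bool" where
  "splits x n \<longleftrightarrow> (\<exists>y\<in>K. (\<forall>i<n. y i = x i) \<and> y n \<noteq> x n)"

definition rank :: "(nat \<Rightarrow> bool) \<Rightarrow> nat \<Rightarrow> nat" where
  "rank x n = card {i\<in>{..<n}. splits x i}"

text \<open>For \<open>x\<close> in \<open>K\<close> exactly one splitting position has rank
  \<open>k\<close>, so this is the direction taken at the splitting number \<open>k\<close>, counted
  from 0.\<close>

definition bit :: "(nat \<Rightarrow> bool) \<Rightarrow> nat \<Rightarrow> bool" where
  "bit x k \<longleftrightarrow> (\<exists>n. splits x n \<and> rank x n = k \<and> x n)"

lemma splits_cong: "(\<And>i. i \<le> n \<Longrightarrow> y i = x i) \<Longrightarrow> splits y n = splits x n"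
  unfolding splits_def by auto

lemma rank_cong: "(\<And>i. i < n \<Longrightarrow> y i = x i) \<Longrightarrow> rank y n = rank x n"
  unfolding rank_def by (intro arg_cong[where f = card] Collect_cong conj_cong refl splits_cong) auto

lemma rank_Suc: "rank x (Suc n) = (if splits x n then Suc (rank x n) else rank x n)"
proof -
  have "{i\<in>{..<Suc n}. splits x i} = (if splits x n then insert n {i\<in>{..<n}. splits x i} else {i\<in>{..<n}. splits x i})"
    by (auto simp: less_Suc_eq)
  then show ?thesis unfolding rank_def by simp
qed

lemma rank_less: "splits x m \<Longrightarrow> m < n \<Longrightarrow> rank x m < rank x n"
  unfolding rank_def by (intro psubset_card_mono) auto

lemma rank_inject: "splits x m \<Longrightarrow> splits x n \<Longrightarrow> rank x m = rank x n \<Longrightarrow> m = n"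
  using rank_less[of x m n] rank_less[of x n m] by (metis less_irrefl linorder_neqE_nat)

lemma bit_rank: "splits x n \<Longrightarrow> bit x (rank x n) = x n"
  unfolding bit_def using rank_inject by blast

lemma infinite_splits:
  assumes "x \<in> K" shows "infinite {n. splits x n}"
  unfolding infinite_nat_iff_unbounded_le
proof
  fix m
  obtain y where y: "y \<in> K" "y \<noteq> x" "\<forall>i<m. y i = x i" using perfect[OF assms] by blast
  then obtain j where "y j \<noteq> x j" by blast
  define n where "n = (LEAST n. y n \<noteq> x n)"
  have "y n \<noteq> x n" unfolding n_def by (rule LeastI[of _ j]) fact
  moreover have "y i = x i" if "i < n" for i using not_less_Least that unfolding n_def by blast
  ultimately have "splits x n" "m \<le> n" using y unfolding splits_def by (blast, metis not_le)
  then show "\<exists>n\<ge>m. n \<in> {n. splits x n}" by blast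
qed

lemma rank_exists:
  assumes "x \<in> K" obtains n where "splits x n" "rank x n = k"
proof -
  obtain B where B: "finite B" "card B = Suc k" "B \<subseteq> {n. splits x n}"
    using infinite_arbitrarily_large[OF infinite_splits[OF assms]] by metis
  obtain N where "\<forall>i\<in>B. i < N" using B(1) finite_nat_set_iff_bounded by blast
  then have "Suc k \<le> rank x N" unfolding rank_def B(2)[symmetric] using B(3) by (intro card_mono) auto
  define n where "n = (LEAST n. Suc k \<le> rank x n)"
  have n: "Suc k \<le> rank x n" unfolding n_def by (rule LeastI) fact
  have "rank x 0 = 0" by (simp add: rank_def)
  then obtain m where m: "n = Suc m" using n by (cases n) auto
  have "\<not> Suc k \<le> rank x m" using not_less_Least[of m "\<lambda>n. Suc k \<le> rank x n"] m unfolding n_def by auto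
  then have "splits x m \<and> rank x m = k" using n unfolding m rank_Suc by (auto split: if_splits)
  then show thesis using that by blast
qed

lemma bit_locally_constant:
  assumes "x \<in> K" shows "\<exists>n. \<forall>y\<in>K. (\<forall>i<n. y i = x i) \<longrightarrow> bit y k = bit x k"
proof -
  obtain n where n: "splits x n" "rank x n = k" using rank_exists[OF assms] .
  have "bit y k = bit x k" if "\<forall>i<Suc n. y i = x i" for y
  proof -
    have "splits y n" "rank y n = k" using that n splits_cong[of n y x] rank_cong[of n y x] by auto
    then show ?thesis using bit_rank[of x n] bit_rank[of y n] n that by auto
  qed
  then show ?thesis by blast
qed

text \<open>At the first position where two members differ both split, and with the same rank, since
  the rank depends only on earlier entries.\<close>

lemma bit_inj: "inj_on bit K"
proof (rule inj_onI, rule ccontr)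
  fix x y assume xy: "x \<in> K" "y \<in> K" "bit x = bit y" "x \<noteq> y"
  then obtain m where "x m \<noteq> y m" by blast
  define n where "n = (LEAST n. x n \<noteq> y n)"
  have n: "x n \<noteq> y n" unfolding n_def by (rule LeastI[of _ m]) fact
  have below: "x i = y i" if "i < n" for i using not_less_Least that unfolding n_def by blast
  have "splits x n" "splits y n" unfolding splits_def using xy n below by metis+
  moreover have "rank x n = rank y n" using below by (intro rank_cong) auto
  ultimately have "x n = y n" using bit_rank[of x n] bit_rank[of y n] xy(3) by simp
  then show False using n by simp
qed

text \<open>A wrong bit is corrected by a member of \<open>K\<close> that branches off at the
  corresponding splitting; bits of smaller index are decided at earlier positions and do not
  change.\<close>

lemma bit_prefix_surj: "\<exists>x\<in>K. \<forall>j<k. bit x j = b j"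
proof (induction k)
  case 0 then show ?case using nonempty by blast
next
  case (Suc k)
  then obtain x where x: "x \<in> K" "\<forall>j<k. bit x j = b j" by blast
  show ?case
  proof (cases "bit x k = b k")
    case True then show ?thesis using x by (auto simp: less_Suc_eq)
  next
    case False
    obtain n where n: "splits x n" "rank x n = k" using rank_exists[OF x(1)] .
    obtain y where y: "y \<in> K" "\<forall>i<n. y i = x i" "y n \<noteq> x n" using n(1) unfolding splits_def by blast
    have sy: "splits y n" unfolding splits_def using x(1) y by metis
    have ry: "rank y n = k" using y n(2) rank_cong[of n y x] by auto
    have "bit y j = b j" if "j < k" for j
    proof -
      obtain i where i: "splits x i" "rank x i = j" using rank_exists[OF x(1)] .
      have "i < n"
      proof (rule ccontr)
        assume "\<not> i < n"
        then have "n = i \<or> n < i" by auto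
        then show False using rank_less[OF n(1), of i] i n \<open>j < k\<close> by auto
      qed
      then have "splits y i" "rank y i = j" using y i splits_cong[of i y x] rank_cong[of i y x] by auto
      then show ?thesis using bit_rank[of x i] bit_rank[of y i] i y \<open>i < n\<close> x(2) \<open>j < k\<close> by auto
    qed
    moreover have "bit y k = b k" using bit_rank[OF sy] bit_rank[OF n(1)] ry n False y by auto
    ultimately show ?thesis using y(1) by (auto simp: less_Suc_eq)
  qed
qed

text \<open>Finite prefixes are realized by \<open>bit_prefix_surj\<close>; compactness of
  \<open>K\<close> and continuity of each bit give the whole sequence.\<close>

lemma bit_surj: "bit ` K = UNIV"
proof (intro equalityI subsetI UNIV_I)
  fix b :: "nat \<Rightarrow> bool"
  have cl: "closed (K \<inter> (\<lambda>x. bit x j) -` {b j})" for j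
    by (rule continuous_closed_preimage[OF continuous_on_if_locally_constant[OF bit_locally_constant] closed])
      (simp_all add: closed_def open_discrete)
  have "K \<inter> (\<Inter>j\<in>UNIV. K \<inter> (\<lambda>x. bit x j) -` {b j}) \<noteq> {}"
  proof (rule compact_imp_fip_image[OF compact cl])
    fix J :: "nat set" assume "finite J"
    then obtain k where "\<forall>j\<in>J. j < k" using finite_nat_set_iff_bounded by blast
    then show "K \<inter> (\<Inter>j\<in>J. K \<inter> (\<lambda>x. bit x j) -` {b j}) \<noteq> {}" using bit_prefix_surj[of k b] by fastforce
  qed
  then obtain x where "x \<in> K" "\<And>j. bit x j = b j" by blast
  then show "b \<in> bit ` K" by (intro image_eqI[of _ _ x]) auto
qed

theorem homeomorphic_cantor_set: "K homeomorphic cantor_set"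
proof (rule homeomorphic_compact[OF compact])
  show "continuous_on K (\<lambda>x. cantor_value (bit x))"
  proof -
    have "uniform_limit K (\<lambda>n x. \<Sum>i<n. (if bit x i then 2 else 0) / 3 ^ Suc i)
      (\<lambda>x. \<Sum>i. (if bit x i then 2 else 0) / 3 ^ Suc i :: real) sequentially"
      by (rule Weierstrass_m_test[OF _ sums_summable[OF cantor_bound_sums]]) auto
    moreover have "continuous_on K (\<lambda>x. \<Sum>i<n. (if bit x i then 2 else 0) / 3 ^ Suc i :: real)" for n
    proof (intro continuous_on_sum continuous_on_if_locally_constant)
      fix i x assume "x \<in> K"
      then obtain N where "\<And>y. y \<in> K \<Longrightarrow> (\<forall>i<N. y i = x i) \<Longrightarrow> bit y i = bit x i"
        using bit_locally_constant[of x i] by blast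
      then show "\<exists>n. \<forall>y\<in>K. (\<forall>i<n. y i = x i) \<longrightarrow>
        (if bit y i then 2 else 0) / 3 ^ Suc i = ((if bit x i then 2 else 0) / 3 ^ Suc i :: real)"
        by (intro exI[of _ N] ballI impI) simp
    qed
    ultimately show ?thesis unfolding cantor_value_def
      by (intro uniform_limit_theorem[where F = sequentially]) (auto simp: eventually_sequentially)
  qed
  have "(\<lambda>x. cantor_value (bit x)) ` K = cantor_value ` bit ` K" by (simp add: image_image)
  then show "(\<lambda>x. cantor_value (bit x)) ` K = cantor_set" by (simp only: bit_surj range_cantor_value)
  show "inj_on (\<lambda>x. cantor_value (bit x)) K"
    using comp_inj_on[OF bit_inj, of cantor_value] inj_on_subset[OF inj_cantor_value] by (simp add: o_def)
qed

end

subsection \<open>The space of bi-orderings of the integer lattice is perfect\<close>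

definition det2 :: "int \<times> int \<Rightarrow> int \<times> int \<Rightarrow> int" where
  "det2 u v = fst u * snd v - snd u * fst v"

definition lin2 :: "int \<Rightarrow> int \<Rightarrow> int \<times> int \<Rightarrow> int" where
  "lin2 a b v = a * fst v + b * snd v"

lemma finite_total_preorder_min:
  assumes "finite V" "V \<noteq> {}" and tot: "\<And>u v. u \<in> V \<Longrightarrow> v \<in> V \<Longrightarrow> R u v \<or> R v u"
    and tr: "\<And>u v w. u \<in> V \<Longrightarrow> v \<in> V \<Longrightarrow> w \<in> V \<Longrightarrow> R u v \<Longrightarrow> R v w \<Longrightarrow> R u w"
  shows "\<exists>w\<in>V. \<forall>v\<in>V. R w v"
  using assms
proof (induction V rule: finite_ne_induct)
  case (insert x F)
  have "\<exists>w\<in>F. \<forall>v\<in>F. R w v"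
  proof (rule insert.IH)
    show "R u v \<or> R v u" if "u \<in> F" "v \<in> F" for u v using insert.prems(1) that by blast
    show "R u w" if "u \<in> F" "v \<in> F" "w \<in> F" "R u v" "R v w" for u v w
      using insert.prems(2)[of u v w] that by blast
  qed
  then obtain w where w: "w \<in> F" "\<And>v. v \<in> F \<Longrightarrow> R w v" by blast
  have refl: "R x x" using insert.prems(1)[of x x] by blast
  show ?case
  proof (cases "R x w")
    case True
    then have "R x v" if "v \<in> F" for v using insert.prems(2)[of x w v] w that by blast
    then show ?thesis using refl by blast
  next
    case False
    then have "R w x" using insert.prems(1)[of w x] w by blast
    then show ?thesis using w by blast
  qed
qed blast

locale lattice_bicone = bicone Q for Q :: "(int \<times> int) set"
begin

lemma scale_in:
  assumes "u \<in> Q" "a > 0" shows "(a * fst u, a * snd u) \<in> Q"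
  using assms(2)
proof (induction a rule: int_gr_induct)
  case (step a)
  then have "u + (a * fst u, a * snd u) \<in> Q" using add_closed[OF assms(1)] by blast
  then show ?case by (simp add: plus_prod_def algebra_simps)
qed (use assms in simp)

lemma no_relation:
  assumes "u \<in> Q" "v \<in> Q" "a \<ge> 0" "b \<ge> 0" "a * fst u + b * fst v = 0" "a * snd u + b * snd v = 0"
  shows "a = 0 \<and> b = 0"
proof (rule ccontr)
  assume "\<not> (a = 0 \<and> b = 0)"
  then have "(a * fst u + b * fst v, a * snd u + b * snd v) \<in> Q"
    using scale_in[OF assms(1), of a] scale_in[OF assms(2), of b] add_closed[of "(a * fst u, a * snd u)" "(b * fst v, b * snd v)"]
      assms(3,4) by (cases "a = 0"; cases "b = 0") auto
  then show False using assms(5,6) zero_notin by (simp add: zero_prod_def)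
qed

text \<open>The identity \<open>det2 v w * u + det2 u v * w = det2 u w * v\<close>, read
  coordinatewise: if \<open>det2 u w\<close> were negative, the right side would be the negative of
  an element of \<open>Q\<close>, while the left side is 0 or in \<open>Q\<close>.\<close>

lemma det2_trans:
  assumes "u \<in> Q" "v \<in> Q" "w \<in> Q" "det2 u v \<ge> 0" "det2 v w \<ge> 0" shows "det2 u w \<ge> 0"
proof (rule ccontr)
  assume neg: "\<not> det2 u w \<ge> 0"
  define x where "x = (det2 v w * fst u + det2 u v * fst w, det2 v w * snd u + det2 u v * snd w)"
  have x: "x = (det2 u w * fst v, det2 u w * snd v)" by (simp add: x_def det2_def algebra_simps)
  have "- x \<in> Q" using scale_in[OF assms(2), of "- det2 u w"] neg by (simp add: x)
  moreover have "x = 0 \<or> x \<in> Q"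
    using scale_in[OF assms(1), of "det2 v w"] scale_in[OF assms(3), of "det2 u v"]
      add_closed[of "(det2 v w * fst u, det2 v w * snd u)" "(det2 u v * fst w, det2 u v * snd w)"] assms(4,5)
    unfolding x_def by (cases "det2 v w = 0"; cases "det2 u v = 0") (auto simp: zero_prod_def)
  ultimately show False using not_both zero_notin by fastforce
qed

text \<open>The order by angle on \<open>V\<close> has extreme elements \<open>w0\<close> and
  \<open>w1\<close>. If they are independent, both terms of \<open>det2 w0 v + det2 v w1\<close> are
  nonnegative on \<open>V\<close> and vanish together only at 0. Otherwise \<open>V\<close> lies on
  the ray of \<open>w0\<close>, and the inner product with \<open>w0\<close> is positive.\<close>

lemma positive_functional:
  assumes V: "finite V" "V \<subseteq> Q"
  obtains a b where "(a, b) \<noteq> (0, 0)" "\<And>v. v \<in> V \<Longrightarrow> lin2 a b v > 0"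
proof (cases "V = {}")
  case True then show thesis using that[of 1 0] by auto
next
  case False
  have tot: "det2 u v \<ge> 0 \<or> det2 v u \<ge> 0" for u v
  proof -
    have "det2 v u = - det2 u v" by (simp add: det2_def algebra_simps)
    then show ?thesis by linarith
  qed
  obtain w0 where w0: "w0 \<in> V" "\<And>v. v \<in> V \<Longrightarrow> det2 w0 v \<ge> 0"
    using finite_total_preorder_min[OF V(1) False, of "\<lambda>u v. det2 u v \<ge> 0"] tot det2_trans V(2) by (metis subsetD)
  obtain w1 where w1: "w1 \<in> V" "\<And>v. v \<in> V \<Longrightarrow> det2 v w1 \<ge> 0"
    using finite_total_preorder_min[OF V(1) False, of "\<lambda>u v. det2 v u \<ge> 0"] tot det2_trans V(2) by (metis subsetD)
  have Q: "w0 \<in> Q" "w1 \<in> Q" using w0 w1 V by auto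
  have id: "det2 v w1 * fst w0 + det2 w0 v * fst w1 = det2 w0 w1 * fst v"
    "det2 v w1 * snd w0 + det2 w0 v * snd w1 = det2 w0 w1 * snd v" for v
    by (simp_all add: det2_def algebra_simps)
  show thesis
  proof (cases "det2 w0 w1 = 0")
    case True
    show thesis
    proof (rule that[of "fst w0" "snd w0"])
      show "(fst w0, snd w0) \<noteq> (0, 0)" using Q(1) zero_notin by (cases w0) (auto simp: zero_prod_def)
      fix v assume v: "v \<in> V"
      then have vQ: "v \<in> Q" using V by blast
      have "det2 w0 v = 0" using no_relation[OF Q w1(2)[OF v] w0(2)[OF v]] id[of v] True by simp
      then have d: "fst w0 * snd v = snd w0 * fst v" by (simp add: det2_def)
      define s n where "s = lin2 (fst w0) (snd w0) v" "n = fst w0 * fst w0 + snd w0 * snd w0"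
      have "n * fst v = s * fst w0" "n * snd v = s * snd w0"
        using d by (simp_all add: s_n_def lin2_def algebra_simps)
      moreover have "n > 0" using \<open>(fst w0, snd w0) \<noteq> (0, 0)\<close>
        unfolding s_n_def by (metis not_sum_squares_lt_zero sum_squares_eq_zero_iff linorder_neqE)
      ultimately show "lin2 (fst w0) (snd w0) v > 0"
        using no_relation[OF vQ Q(1), of n "- s"] unfolding s_n_def(1)[symmetric] by force
    qed
  next
    case False
    then have pos: "det2 w0 w1 > 0" using w0(2)[OF w1(1)] by simp
    show thesis
    proof (rule that[of "snd w1 - snd w0" "fst w0 - fst w1"])
      show "(snd w1 - snd w0, fst w0 - fst w1) \<noteq> (0, 0)" using False by (auto simp: det2_def)
      fix v assume v: "v \<in> V"
      have e: "lin2 (snd w1 - snd w0) (fst w0 - fst w1) v = det2 w0 v + det2 v w1"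
        by (simp add: lin2_def det2_def algebra_simps)
      have "\<not> (det2 w0 v = 0 \<and> det2 v w1 = 0)"
      proof
        assume "det2 w0 v = 0 \<and> det2 v w1 = 0"
        then have "fst v = 0" "snd v = 0" using id[of v] pos by auto
        then have "v = 0" by (simp add: prod_eq_iff)
        then show False using v V zero_notin by auto
      qed
      then show "lin2 (snd w1 - snd w0) (fst w0 - fst w1) v > 0" using w0(2)[OF v] w1(2)[OF v] unfolding e by linarith
    qed
  qed
qed

end

text \<open>Compares first by an integral linear form and then, on its kernel line, by the
  orthogonal form with sign \<open>s\<close>.\<close>

definition functional_cone :: "int \<Rightarrow> int \<Rightarrow> int \<Rightarrow> (int \<times> int) set" where
  "functional_cone a b s = {v. lin2 a b v > 0 \<or> lin2 a b v = 0 \<and> s * lin2 (- b) a v > 0}"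

lemma lin2_simps [simp]: "lin2 a b (u + v) = lin2 a b u + lin2 a b v" "lin2 a b (- v) = - lin2 a b v" "lin2 a b 0 = 0"
  by (simp_all add: lin2_def algebra_simps)

lemma bi_cone_functional_cone:
  assumes ab: "(a, b) \<noteq> (0, 0)" and s: "s \<noteq> 0" shows "bi_cone (functional_cone a b s)"
proof -
  have "lin2 a b v \<noteq> 0 \<or> lin2 (- b) a v \<noteq> 0" if "v \<noteq> 0" for v
  proof (rule ccontr)
    assume "\<not> ?thesis"
    then have "a * lin2 a b v - b * lin2 (- b) a v = 0" "b * lin2 a b v + a * lin2 (- b) a v = 0" by auto
    then have "(a * a + b * b) * fst v = 0" "(a * a + b * b) * snd v = 0" by (simp_all add: lin2_def algebra_simps)
    moreover have "a * a + b * b \<noteq> 0" using ab by (simp add: sum_squares_eq_zero_iff)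
    ultimately have "fst v = 0" "snd v = 0" by (metis mult_eq_0_iff)+
    then show False using that by (simp add: prod_eq_iff)
  qed
  then have nz: "lin2 a b v \<noteq> 0 \<or> s * lin2 (- b) a v \<noteq> 0" if "v \<noteq> 0" for v using that s by simp
  have "v \<in> functional_cone a b s \<or> - v \<in> functional_cone a b s" if "v \<noteq> 0" for v
  proof -
    have "lin2 a b v > 0 \<or> lin2 a b v < 0 \<or> lin2 a b v = 0 \<and> (s * lin2 (- b) a v > 0 \<or> s * lin2 (- b) a v < 0)"
      using nz[OF that] by linarith
    then show ?thesis unfolding functional_cone_def by auto
  qed
  moreover have "u + v \<in> functional_cone a b s" if "u \<in> functional_cone a b s" "v \<in> functional_cone a b s" for u v
    using that unfolding functional_cone_def by (auto simp: distrib_left)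
  moreover have "0 \<notin> functional_cone a b s" by (simp add: functional_cone_def)
  ultimately show ?thesis unfolding bi_cone_def by auto
qed

text \<open>On the finite set \<open>S\<close> the signs are those of an integral linear form;
  including the negatives of \<open>S\<close> makes it nonzero at all nonzero members. On the kernel
  line through \<open>(- b, a)\<close> two opposite tie-breaking rules are possible, and at least
  one of the two cones differs from \<open>Q\<close>.\<close>

lemma lattice_cone_perturb:
  assumes Q: "bi_cone (Q :: (int \<times> int) set)" and S: "finite S"
  obtains Q' where "bi_cone Q'" "Q' \<noteq> Q" "\<And>v. v \<in> S \<Longrightarrow> v \<in> Q' \<longleftrightarrow> v \<in> Q"
proof -
  interpret lattice_bicone Q by unfold_locales fact
  obtain a b where ab: "(a, b) \<noteq> (0, 0)" "\<And>v. v \<in> (S \<union> uminus ` S) \<inter> Q \<Longrightarrow> lin2 a b v > 0"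
    using positive_functional[of "(S \<union> uminus ` S) \<inter> Q"] S by auto
  have agree: "v \<in> functional_cone a b s \<longleftrightarrow> v \<in> Q" if v: "v \<in> S" for v s
  proof (cases "v \<in> Q")
    case True then show ?thesis using ab(2)[of v] v by (simp add: functional_cone_def)
  next
    case False
    have "v = 0 \<or> lin2 a b (- v) > 0" using ab(2)[of "- v"] v total[of v] False by auto
    then show ?thesis using False by (auto simp: functional_cone_def)
  qed
  have "b * b + a * a > 0"
    using ab(1) by (metis not_sum_squares_lt_zero sum_squares_eq_zero_iff linorder_neqE)
  then have "(- b, a) \<in> functional_cone a b 1" "(- b, a) \<notin> functional_cone a b (- 1)"
    by (simp_all add: functional_cone_def lin2_def)
  then have "functional_cone a b 1 \<noteq> Q \<or> functional_cone a b (- 1) \<noteq> Q" by blast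
  then show thesis using that bi_cone_functional_cone[OF ab(1)] agree
    by (metis zero_neq_neg_one zero_neq_one)
qed

definition lattice_orders :: "(nat \<Rightarrow> bool) set" where
  "lattice_orders = (\<lambda>Q n. (from_nat n :: int \<times> int) \<in> Q) ` {Q. bi_cone Q}"

text \<open>A vector may have several codes under \<open>from_nat\<close>; the second condition
  forces \<open>x\<close> to agree on them. In this form membership is an intersection of conditions
  on finitely many coordinates each, which gives closedness.\<close>

lemma lattice_orders_iff:
  "x \<in> lattice_orders \<longleftrightarrow>
     bi_cone {v :: int \<times> int. x (to_nat v)} \<and> (\<forall>n. x (to_nat (from_nat n :: int \<times> int)) = x n)"
proof
  assume "x \<in> lattice_orders"
  then obtain Q where Q: "bi_cone Q" "x = (\<lambda>n. (from_nat n :: int \<times> int) \<in> Q)" unfolding lattice_orders_def by blast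
  then have "{v. x (to_nat v)} = Q" by simp
  then show "bi_cone {v :: int \<times> int. x (to_nat v)} \<and> (\<forall>n. x (to_nat (from_nat n :: int \<times> int)) = x n)" using Q by simp
next
  assume x: "bi_cone {v :: int \<times> int. x (to_nat v)} \<and> (\<forall>n. x (to_nat (from_nat n :: int \<times> int)) = x n)"
  then show "x \<in> lattice_orders" unfolding lattice_orders_def
    by (intro image_eqI[of _ _ "{v. x (to_nat v)}"]) auto
qed

lemma open_coordinate: "open {x :: nat \<Rightarrow> bool. x i}"
proof -
  have "{x :: nat \<Rightarrow> bool. x i} = (\<lambda>x. x i) -` {True}" by auto
  then show ?thesis using open_vimage[OF open_discrete continuous_on_product_coordinates] by metis
qed

lemma closed_coordinate: "closed {x :: nat \<Rightarrow> bool. x i}"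
proof -
  have "- {x :: nat \<Rightarrow> bool. x i} = (\<lambda>x. x i) -` {False}" by auto
  then show ?thesis unfolding closed_def using open_vimage[OF open_discrete continuous_on_product_coordinates] by metis
qed

interpretation lattice: perfect_set lattice_orders
proof
  have "lattice_orders = {x. \<not> x (to_nat (0 :: int \<times> int)) \<and>
     (\<forall>u v :: int \<times> int. x (to_nat u) \<longrightarrow> x (to_nat v) \<longrightarrow> x (to_nat (u + v))) \<and>
     (\<forall>u :: int \<times> int. u \<noteq> 0 \<longrightarrow> x (to_nat u) \<or> x (to_nat (- u))) \<and>
     (\<forall>n. (x n \<longrightarrow> x (to_nat (from_nat n :: int \<times> int))) \<and> (x (to_nat (from_nat n :: int \<times> int)) \<longrightarrow> x n))}"
    unfolding set_eq_iff lattice_orders_iff bi_cone_def mem_Collect_eq Ball_def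
    by (intro allI) (simp, blast)
  also have "closed \<dots>"
    by (intro closed_Collect_conj closed_Collect_all closed_Collect_imp closed_Collect_disj closed_Collect_neg
        open_coordinate closed_coordinate open_Collect_const closed_Collect_const)
  finally show "closed lattice_orders" .
  have "bi_cone (functional_cone 1 0 1)" by (rule bi_cone_functional_cone) auto
  then show "lattice_orders \<noteq> {}" unfolding lattice_orders_def by blast
next
  fix x n assume "x \<in> lattice_orders"
  then obtain Q where Q: "bi_cone Q" "x = (\<lambda>n. (from_nat n :: int \<times> int) \<in> Q)" unfolding lattice_orders_def by blast
  obtain Q' where Q': "bi_cone Q'" "Q' \<noteq> Q" "\<And>v. v \<in> from_nat ` {..<n} \<Longrightarrow> v \<in> Q' \<longleftrightarrow> v \<in> Q"
    using lattice_cone_perturb[OF Q(1), of "from_nat ` {..<n}"] by blast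
  define y where "y = (\<lambda>n. (from_nat n :: int \<times> int) \<in> Q')"
  have "y \<in> lattice_orders" unfolding lattice_orders_def y_def using Q'(1) by blast
  moreover have "y \<noteq> x"
  proof
    assume "y = x"
    then have "y (to_nat v) = x (to_nat v)" for v :: "int \<times> int" by simp
    then show False using Q'(2) unfolding y_def Q(2) by auto
  qed
  moreover have "\<forall>i<n. y i = x i" using Q'(3) unfolding y_def Q(2) by simp
  ultimately show "\<exists>y\<in>lattice_orders. y \<noteq> x \<and> (\<forall>i<n. y i = x i)" by blast
qed

lemmas lattice_orders_homeomorphic_cantor_set = lattice.homeomorphic_cantor_set

subsection \<open>Bi-orderings and their positive cones\<close>

lemma bi_cone_positive_set:
  fixes le :: "'a::group_add \<Rightarrow> 'a \<Rightarrow> bool"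
  assumes "is_biordering UNIV (+) le" shows "bi_cone (positive_set UNIV 0 le)"
proof -
  note A = assms[unfolded is_biordering_def ball_UNIV]
  have antisym: "le x y \<Longrightarrow> le y x \<Longrightarrow> x = y" and trans: "le x y \<Longrightarrow> le y z \<Longrightarrow> le x z"
    and total: "le x y \<or> le y x" and left: "le x y \<Longrightarrow> le (z + x) (z + y)" and right: "le x y \<Longrightarrow> le (x + z) (y + z)"
    for x y z
    by (use A in meson)+
  have neg: "le 0 x \<longleftrightarrow> le (- x) 0" for x using left[of 0 x "- x"] left[of "- x" 0 x] by auto
  have P: "x \<in> positive_set UNIV 0 le \<longleftrightarrow> x \<noteq> 0 \<and> le 0 x" for x by (simp add: positive_set_def)
  show ?thesis unfolding bi_cone_def Ball_def P
  proof (intro conjI allI impI)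
    fix x y assume xy: "x \<noteq> 0 \<and> le 0 x" "y \<noteq> 0 \<and> le 0 y"
    show "le 0 (x + y)" using trans[of 0 y "x + y"] right[of 0 x y] xy by simp
    show "x + y \<noteq> 0"
    proof
      assume "x + y = 0"
      then have "y = - x" by (metis minus_unique)
      then show False using antisym[of 0 "- x"] neg[of x] xy by auto
    qed
  next
    fix x h assume "x \<noteq> 0 \<and> le 0 x"
    then show "le 0 (h + x - h)" using right[OF left[of 0 x h], of "- h"] by simp
    show "h + x - h \<noteq> 0" using \<open>x \<noteq> 0 \<and> le 0 x\<close> add_left_cancel[of h x 0] by (simp add: diff_eq_eq)
    next
    fix x :: 'a assume "x \<noteq> 0"
    then show "(x \<noteq> 0 \<and> le 0 x) \<or> (- x \<noteq> 0 \<and> le 0 (- x))" using total[of 0 x] neg[of "- x"] by auto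
  qed simp
qed

lemma bi_cone_imp_positive_set:
  fixes P :: "'a::group_add set"
  assumes "bi_cone P" obtains le where "is_biordering UNIV (+) le" "positive_set UNIV 0 le = P"
proof -
  interpret bicone P by unfold_locales fact
  show thesis
  proof (rule that[of le])
    show "is_biordering UNIV (+) le" unfolding is_biordering_def
    proof (intro conjI ballI impI)
      show "x = y" if "x \<sqsubseteq> y \<and> y \<sqsubseteq> x" for x y using that lt_trans[of x y x] by (auto simp: le_def)
      show "x \<sqsubseteq> z" if "x \<sqsubseteq> y \<and> y \<sqsubseteq> z" for x y z using that le_trans by blast
      show "x \<sqsubseteq> y \<or> y \<sqsubseteq> x" for x y using lt_total[of x y] by (auto simp: le_def)
    qed (simp_all add: le_add_left le_add_right)
    show "positive_set UNIV 0 le = P"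
      unfolding positive_set_def le_def using zero_notin by (auto simp: pos_iff[symmetric])
  qed
qed

lemma BO_Z2_eq: "BO_Z2 = {Q. bi_cone Q}"
proof -
  have "addZ2 = (+)" "(0, 0) = (0 :: int \<times> int)"
    by (auto simp: addZ2_def plus_prod_def zero_prod_def fun_eq_iff)
  then show ?thesis unfolding BO_Z2_def
    using bi_cone_positive_set bi_cone_imp_positive_set by (metis (mono_tags, lifting) Collect_cong)
qed

lemma thompsonF_E:
  assumes "x \<in> thompsonF" obtains f where "x = app f"
  using assms app_cases by metis

lemma app_image_eqI:
  assumes "S \<subseteq> thompsonF" "\<And>f. app f \<in> S \<longleftrightarrow> f \<in> C" shows "S = app ` C"
  using assms by (auto elim!: thompsonF_E)

lemma BO_F_eq: "BO_F = (\<lambda>C. app ` C) ` {C. bi_cone C}"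
proof -
  have plus: "app f \<circ> app g = app (f + g)" for f g by (rule app_image_comp)
  have all: "(\<forall>x\<in>thompsonF. R x) \<longleftrightarrow> (\<forall>f. R (app f))" for R by (metis app_in_thompsonF thompsonF_E)
  have pos: "positive_set thompsonF id le = app ` positive_set UNIV 0 (\<lambda>f g. le (app f) (app g))" for le
  proof (rule app_image_eqI)
    have a0: "app 0 = id" by simp
    show "app f \<in> positive_set thompsonF id le \<longleftrightarrow> f \<in> positive_set UNIV 0 (\<lambda>f g. le (app f) (app g))" for f
      unfolding positive_set_def a0 by simp
  qed (auto simp: positive_set_def)
  show ?thesis
  proof (intro equalityI subsetI)
    fix S assume "S \<in> BO_F"
    then obtain le where le: "is_biordering thompsonF (\<circ>) le" "S = positive_set thompsonF id le"
      unfolding BO_F_def by blast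
    have "is_biordering UNIV (+) (\<lambda>f g. le (app f) (app g))"
      using le(1)[unfolded is_biordering_def all plus app_inject] unfolding is_biordering_def ball_UNIV .
    then show "S \<in> (\<lambda>C. app ` C) ` {C. bi_cone C}" using bi_cone_positive_set le(2) pos by blast
  next
    fix S assume "S \<in> (\<lambda>C. app ` C) ` {C. bi_cone C}"
    then obtain C where C: "bi_cone C" "S = app ` C" by blast
    then obtain le where le: "is_biordering UNIV (+) le" "positive_set UNIV 0 le = C"
      using bi_cone_imp_positive_set by blast
    define le' where "le' x y = le (Abs_thompson x) (Abs_thompson y)" for x y
    have le': "le' (app f) (app g) = le f g" for f g by (simp add: le'_def app_inverse)
    have "is_biordering thompsonF (\<circ>) le'"
      using le(1)[unfolded is_biordering_def ball_UNIV] unfolding is_biordering_def all plus le' app_inject .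
    moreover have "positive_set thompsonF id le' = S" unfolding pos le' using le(2) C(2) by simp
    ultimately show "S \<in> BO_F" unfolding BO_F_def by blast
  qed
qed

subsection \<open>The special bi-orderings\<close>

lemma app_derivs:
  "rg (app f) x k \<Longrightarrow> rderiv (app f) x = 2 powi k" "lg (app f) x k \<Longrightarrow> lderiv (app f) x = 2 powi k"
  using rg_rderiv lg_lderiv by blast+

lemma lead_xminus:
  assumes "lead f p m" shows "xminus (app f) = p" "rderiv (app f) p = 2 powi m"
proof -
  have m: "rg (app f) p m" "m \<noteq> 0" using assms by (auto simp: lead_def)
  show d: "rderiv (app f) p = 2 powi m" by (rule app_derivs(1)[OF m(1)])
  show "xminus (app f) = p" unfolding xminus_def
  proof (rule Least_equality)
    show "0 \<le> p \<and> p < 1 \<and> rderiv (app f) p \<noteq> 1" using lead_range[OF assms] d m by simp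
    fix y assume y: "0 \<le> y \<and> y < 1 \<and> rderiv (app f) y \<noteq> 1"
    show "p \<le> y"
    proof (rule ccontr)
      assume "\<not> p \<le> y"
      then have "rg (app f) y 0" using lead_ident[OF assms] by (intro rg_ident[of y p]) auto
      then show False using app_derivs(1) y by fastforce
    qed
  qed
qed

lemma trail_xplus:
  assumes "trail f q n" shows "xplus (app f) = q" "lderiv (app f) q = 2 powi n"
proof -
  have n: "lg (app f) q n" "n \<noteq> 0" "\<And>x. q \<le> x \<Longrightarrow> app f x = x" using assms by (auto simp: trail_def)
  show d: "lderiv (app f) q = 2 powi n" by (rule app_derivs(2)[OF n(1)])
  show "xplus (app f) = q" unfolding xplus_def
  proof (rule Greatest_equality)
    show "0 < q \<and> q \<le> 1 \<and> lderiv (app f) q \<noteq> 1" using trail_range[OF assms] d n by simp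
    fix y assume y: "0 < y \<and> y \<le> 1 \<and> lderiv (app f) y \<noteq> 1"
    show "y \<le> q"
    proof (rule ccontr)
      assume "\<not> y \<le> q"
      then have "lg (app f) y 0" using n(3) by (intro lg_ident[of q y]) auto
      then show False using app_derivs(2) y by fastforce
    qed
  qed
qed

lemma lead_sets:
  "P_xm_plus = app ` lead_cone 1 1" "P_xm_minus = app ` lead_cone (- 1) (- 1)"
  "P_0xm_pm = app ` lead_cone 1 (- 1)" "P_0xm_mp = app ` lead_cone (- 1) 1"
proof -
  have eqI: "{f \<in> thompsonF. f \<noteq> id \<and> R f} = app ` lead_cone s0 s1"
    if "\<And>f p m. lead f p m \<Longrightarrow> R (app f) \<longleftrightarrow> (if p = 0 then s0 else s1) * m > 0" for R s0 s1
  proof (rule app_image_eqI)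
    fix f
    show "app f \<in> {f \<in> thompsonF. f \<noteq> id \<and> R f} \<longleftrightarrow> f \<in> lead_cone s0 s1"
    proof (cases "f = 0")
      case False
      then obtain p m where f: "lead f p m" using lead_exists by blast
      then show ?thesis using that[OF f] lead_cone_iff[OF f] False by simp
    qed simp
  qed blast
  show "P_xm_plus = app ` lead_cone 1 1" unfolding P_xm_plus_def
    by (rule eqI) (simp add: lead_xminus)
  show "P_xm_minus = app ` lead_cone (- 1) (- 1)" unfolding P_xm_minus_def
    by (rule eqI) (simp add: lead_xminus)
  show "P_0xm_pm = app ` lead_cone 1 (- 1)" unfolding P_0xm_pm_def
    by (rule eqI) (auto simp: lead_xminus)
  show "P_0xm_mp = app ` lead_cone (- 1) 1" unfolding P_0xm_mp_def
    by (rule eqI) (auto simp: lead_xminus)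
qed

lemma trail_sets:
  "P_xp_plus = app ` trail_cone (- 1) (- 1)" "P_xp_minus = app ` trail_cone 1 1"
  "P_1xp_pm = app ` trail_cone (- 1) 1" "P_1xp_mp = app ` trail_cone 1 (- 1)"
proof -
  have eqI: "{f \<in> thompsonF. f \<noteq> id \<and> R f} = app ` trail_cone s0 s1"
    if "\<And>f p m. trail f p m \<Longrightarrow> R (app f) \<longleftrightarrow> (if p = 1 then s0 else s1) * m > 0" for R s0 s1
  proof (rule app_image_eqI)
    fix f
    show "app f \<in> {f \<in> thompsonF. f \<noteq> id \<and> R f} \<longleftrightarrow> f \<in> trail_cone s0 s1"
    proof (cases "f = 0")
      case True
      then show ?thesis unfolding flip_lead_cone[symmetric] mem_flip_image by simp
    next
      case False
      then obtain p m where f: "trail f p m" using trail_exists by blast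
      then show ?thesis using that[OF f] trail_cone_iff[OF f] False by simp
    qed
  qed blast
  show "P_xp_plus = app ` trail_cone (- 1) (- 1)" unfolding P_xp_plus_def
    by (rule eqI) (simp add: trail_xplus)
  show "P_xp_minus = app ` trail_cone 1 1" unfolding P_xp_minus_def
    by (rule eqI) (simp add: trail_xplus)
  show "P_1xp_pm = app ` trail_cone (- 1) 1" unfolding P_1xp_pm_def
    by (rule eqI) (auto simp: trail_xplus)
  show "P_1xp_mp = app ` trail_cone 1 (- 1)" unfolding P_1xp_mp_def
    by (rule eqI) (auto simp: trail_xplus)
qed

definition enc :: "thompson set \<Rightarrow> (real \<Rightarrow> real) \<Rightarrow> bool" where
  "enc C = chi (app ` C)"

lemma enc_app [simp]: "enc C (app f) \<longleftrightarrow> f \<in> C"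
  by (simp add: enc_def chi_def image_iff app_inject)

lemma enc_extensional: "enc C \<in> extensional thompsonF"
  by (simp add: enc_def chi_def)

lemma enc_inject: "enc C = enc D \<longleftrightarrow> C = D"
  by (metis enc_app set_eqI)

lemma chi_BO_F: "chi ` BO_F = enc ` {C. bi_cone C}"
  by (simp add: BO_F_eq image_image enc_def)

definition isolated_cones :: "thompson set set" where
  "isolated_cones = {C. \<exists>s0\<in>{1, - 1}. \<exists>s1\<in>{1, - 1}. C = lead_cone s0 s1 \<or> C = trail_cone s0 s1}"

lemma BO_Isol_eq: "BO_Isol = enc ` isolated_cones"
  unfolding BO_Isol_def lead_sets trail_sets isolated_cones_def enc_def by auto

lemma Lambda_eq: "Lambda (app ` C) = enc ` lex_cone C ` {Q. bi_cone Q}"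
proof -
  have log: "log2int (2 powi k) = k" for k unfolding log2int_def by (rule the_equality) auto
  have d: "rderiv (app f) 0 = 2 powi slope0 f" "lderiv (app f) 1 = 2 powi slope1 f" for f
    using app_derivs rg_slope0 lg_slope1 by blast+
  have "{f \<in> thompsonF. (f \<notin> commF \<and> (log2int (rderiv f 0), log2int (lderiv f 1)) \<in> Q) \<or> (f \<in> commF \<and> f \<in> app ` C)}
    = app ` lex_cone C Q" for Q
  proof (rule app_image_eqI)
    fix f
    have "app f \<in> commF \<longleftrightarrow> f \<in> derived" by (simp add: commF_def derived_def d)
    moreover have "app f \<in> app ` C \<longleftrightarrow> f \<in> C" by (auto simp: app_inject)
    ultimately show "app f \<in> {f \<in> thompsonF. (f \<notin> commF \<and> (log2int (rderiv f 0), log2int (lderiv f 1)) \<in> Q) \<or>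
      (f \<in> commF \<and> f \<in> app ` C)} \<longleftrightarrow> f \<in> lex_cone C Q"
      by (simp add: lex_cone_def d log)
  qed blast
  then show ?thesis unfolding Lambda_def BO_Z2_eq by (auto simp: enc_def)
qed

subsection \<open>Separating the special bi-orderings by finitely many elements\<close>

text \<open>\<open>A\<close> reads off the sign on F', and \<open>B\<close>, with opposite exponents
  at its ends, tells the left end from the right. \<open>C1\<close> and \<open>C2\<close> have the
  same slopes at 0 and 1, so a lexicographic cone cannot separate them, whereas cones read off at
  the left end give them opposite signs. \<open>D\<close> determines \<open>s0\<close>. The
  reflected elements do the same for the right end.\<close>

locale separating =
  fixes A B C1 C2 D :: thompson
  assumes derived: "A \<in> derived" "B \<in> derived"
    and A: "A \<in> lead_cone s0 s1 \<longleftrightarrow> s1 > 0" "A \<in> trail_cone s0 s1 \<longleftrightarrow> s1 > 0"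
    and B: "B \<in> lead_cone s0 s1 \<longleftrightarrow> s1 > 0" "B \<in> trail_cone s0 s1 \<longleftrightarrow> s1 < 0"
    and C: "C1 \<notin> derived" "C2 \<notin> derived" "slope0 C1 = slope0 C2" "slope1 C1 = slope1 C2"
      "C1 \<in> lead_cone s0 s1 \<longleftrightarrow> s1 > 0" "C2 \<in> lead_cone s0 s1 \<longleftrightarrow> s1 < 0"
    and D: "D \<in> lead_cone s0 s1 \<longleftrightarrow> s0 > 0"

lemma separating_exists: "\<exists>A B C1 C2 D. separating A B C1 C2 D"
proof -
  have dy: "dyadic (1/4)" "dyadic (1/2)" "dyadic (3/4)"
    using dyadic_div2[of 1] dyadic_div2[of "1/2"] dyadic_div2[OF dyadic_div2[of 3]] by simp_all
  obtain A where A: "lead A (1/4) 1" "trail A (3/4) 1"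
    by (rule thompson_with_lead_trail[of "1/4" "3/4" 1 1]) (use dy in auto)
  obtain B where B: "lead B (1/4) 1" "trail B (3/4) (- 1)"
    by (rule thompson_with_lead_trail[of "1/4" "3/4" 1 "- 1"]) (use dy in auto)
  obtain C1 where C1: "lead C1 (1/2) 1" "trail C1 1 1"
    by (rule thompson_with_lead_trail[of "1/2" 1 1 1]) (use dy in auto)
  obtain C2 where C2: "lead C2 (1/2) (- 1)" "trail C2 1 1"
    by (rule thompson_with_lead_trail[of "1/2" 1 "- 1" 1]) (use dy in auto)
  obtain D where D: "lead D 0 1" "trail D 1 1"
    by (rule thompson_with_lead_trail[of 0 1 1 1]) auto
  have s: "slope0 C1 = 0" "slope0 C2 = 0" "slope1 C1 = 1" "slope1 C2 = 1"
    using lead_pos_iff[OF C1(1)] lead_pos_iff[OF C2(1)] C1(2) C2(2) by (simp_all add: trail_1_iff)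
  have "separating A B C1 C2 D"
  proof
    show "A \<in> derived" by (rule lead_trail_derived[OF A]) auto
    show "B \<in> derived" by (rule lead_trail_derived[OF B]) auto
  qed (use s in \<open>simp_all add: derived_def lead_cone_iff[OF A(1)] lead_cone_iff[OF B(1)] lead_cone_iff[OF C1(1)]
    lead_cone_iff[OF C2(1)] lead_cone_iff[OF D(1)] trail_cone_iff[OF A(2)] trail_cone_iff[OF B(2)]\<close>)
  then show ?thesis by blast
qed

context separating
begin

definition "tests = {A, B, C1, C2, D, flip C1, flip C2, flip D}"

lemma tests: "A \<in> tests" "B \<in> tests" "C1 \<in> tests" "C2 \<in> tests" "D \<in> tests"
    "flip C1 \<in> tests" "flip C2 \<in> tests" "flip D \<in> tests" "finite tests"
  by (simp_all add: tests_def)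

lemma flip_mem_trail: "flip f \<in> trail_cone s0 s1 \<longleftrightarrow> f \<in> lead_cone s0 s1"
  unfolding flip_lead_cone[symmetric] mem_flip_image by simp

lemma lex_mem: "A \<in> lex_cone K Q \<longleftrightarrow> A \<in> K" "B \<in> lex_cone K Q \<longleftrightarrow> B \<in> K"
    "C1 \<in> lex_cone K Q \<longleftrightarrow> C2 \<in> lex_cone K Q" "flip C1 \<in> lex_cone K Q \<longleftrightarrow> flip C2 \<in> lex_cone K Q"
  using derived C(1-4) by (auto simp: lex_cone_def)

lemma agree_on_tests: "P \<inter> tests = P' \<inter> tests \<Longrightarrow> f \<in> tests \<Longrightarrow> f \<in> P \<longleftrightarrow> f \<in> P'"
  by blast

lemma opposite_sign: "s \<in> {1, - 1} \<Longrightarrow> s < 0 \<longleftrightarrow> \<not> s > 0" for s :: int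
  by auto

lemma same_sign: "s \<in> {1, - 1} \<Longrightarrow> t \<in> {1, - 1} \<Longrightarrow> s > 0 \<longleftrightarrow> t > 0 \<Longrightarrow> s = t" for s t :: int
  by auto

lemma lead_lead:
  assumes e: "lead_cone s0 s1 \<inter> tests = lead_cone t0 t1 \<inter> tests"
    and s: "s0 \<in> {1, - 1}" "s1 \<in> {1, - 1}" "t0 \<in> {1, - 1}" "t1 \<in> {1, - 1}"
  shows "s0 = t0 \<and> s1 = t1"
  using agree_on_tests[OF e tests(1)] agree_on_tests[OF e tests(5)] same_sign[OF s(1,3)] same_sign[OF s(2,4)]
  unfolding A D by blast

lemma trail_trail:
  assumes e: "trail_cone s0 s1 \<inter> tests = trail_cone t0 t1 \<inter> tests"
    and s: "s0 \<in> {1, - 1}" "s1 \<in> {1, - 1}" "t0 \<in> {1, - 1}" "t1 \<in> {1, - 1}"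
  shows "s0 = t0 \<and> s1 = t1"
  using agree_on_tests[OF e tests(1)] agree_on_tests[OF e tests(8)] same_sign[OF s(1,3)] same_sign[OF s(2,4)]
  unfolding A flip_mem_trail D by blast

lemma lead_trail:
  assumes e: "lead_cone s0 s1 \<inter> tests = trail_cone t0 t1 \<inter> tests" and t: "t1 \<in> {1, - 1}"
  shows False
  using agree_on_tests[OF e tests(1)] agree_on_tests[OF e tests(2)] opposite_sign[OF t] unfolding A B by blast

lemma isolated_lex:
  assumes P: "P \<in> isolated_cones" and e: "P \<inter> tests = lex_cone K Q \<inter> tests" shows False
proof -
  obtain s0 s1 where s: "s1 \<in> {1, - 1}" "P = lead_cone s0 s1 \<or> P = trail_cone s0 s1"
    using P unfolding isolated_cones_def by blast
  from s(2) show False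
  proof
    assume "P = lead_cone s0 s1"
    then show False using agree_on_tests[OF e tests(3)] agree_on_tests[OF e tests(4)] opposite_sign[OF s(1)] lex_mem(3)[of K Q]
      by (simp add: C)
  next
    assume "P = trail_cone s0 s1"
    then show False using agree_on_tests[OF e tests(6)] agree_on_tests[OF e tests(7)] opposite_sign[OF s(1)] lex_mem(4)[of K Q]
      by (simp add: C flip_mem_trail)
  qed
qed

lemma isolated_determined:
  assumes P: "P \<in> isolated_cones" and P': "bi_cone P'" and e: "P \<inter> tests = P' \<inter> tests"
  shows "P = P'"
proof -
  have "P' \<in> isolated_cones" using P' isolated_lex[OF P] e
    unfolding bi_cone_classification isolated_cones_def by blast
  then obtain t0 t1 where t: "t0 \<in> {1, - 1}" "t1 \<in> {1, - 1}" "P' = lead_cone t0 t1 \<or> P' = trail_cone t0 t1"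
    unfolding isolated_cones_def by blast
  obtain s0 s1 where s: "s0 \<in> {1, - 1}" "s1 \<in> {1, - 1}" "P = lead_cone s0 s1 \<or> P = trail_cone s0 s1"
    using P unfolding isolated_cones_def by blast
  show ?thesis
    using s(3) t(3)
  proof (elim disjE)
    assume "P = lead_cone s0 s1" "P' = lead_cone t0 t1"
    then show ?thesis using lead_lead[of s0 s1 t0 t1] e s t by blast
  next
    assume "P = lead_cone s0 s1" "P' = trail_cone t0 t1"
    then show ?thesis using lead_trail[of s0 s1 t0 t1] e t by blast
  next
    assume "P = trail_cone s0 s1" "P' = lead_cone t0 t1"
    then show ?thesis using lead_trail[of t0 t1 s0 s1] e s by blast
  next
    assume "P = trail_cone s0 s1" "P' = trail_cone t0 t1"
    then show ?thesis using trail_trail[of s0 s1 t0 t1] e s t by blast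
  qed
qed

end

lemma cones_distinct:
  shows isolated_not_lex: "P \<in> isolated_cones \<Longrightarrow> P \<noteq> lex_cone K Q"
    and lex_lead_sign: "lex_cone (lead_cone s s) Q = lex_cone (lead_cone s' s') Q' \<Longrightarrow> s > 0 \<longleftrightarrow> s' > 0"
    and lex_trail_sign: "lex_cone (trail_cone s s) Q = lex_cone (trail_cone s' s') Q' \<Longrightarrow> s > 0 \<longleftrightarrow> s' > 0"
    and lex_lead_trail: "s' \<in> {1, - 1} \<Longrightarrow> lex_cone (lead_cone s s) Q \<noteq> lex_cone (trail_cone s' s') Q'"
    and lead_not_trail: "t1 \<in> {1, - 1} \<Longrightarrow> lead_cone s0 s1 \<noteq> trail_cone t0 t1"
    and lead_inject: "lead_cone s0 s1 = lead_cone t0 t1 \<Longrightarrow>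
      s0 \<in> {1, - 1} \<Longrightarrow> s1 \<in> {1, - 1} \<Longrightarrow> t0 \<in> {1, - 1} \<Longrightarrow> t1 \<in> {1, - 1} \<Longrightarrow> s0 = t0 \<and> s1 = t1"
    and trail_inject: "trail_cone s0 s1 = trail_cone t0 t1 \<Longrightarrow>
      s0 \<in> {1, - 1} \<Longrightarrow> s1 \<in> {1, - 1} \<Longrightarrow> t0 \<in> {1, - 1} \<Longrightarrow> t1 \<in> {1, - 1} \<Longrightarrow> s0 = t0 \<and> s1 = t1"
proof -
  obtain A B C1 C2 D where "separating A B C1 C2 D" using separating_exists by blast
  then interpret separating A B C1 C2 D .
  show "P \<in> isolated_cones \<Longrightarrow> P \<noteq> lex_cone K Q" using isolated_lex by blast
  show "lex_cone (lead_cone s s) Q = lex_cone (lead_cone s' s') Q' \<Longrightarrow> s > 0 \<longleftrightarrow> s' > 0"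
    using lex_mem(1) A(1) by metis
  show "lex_cone (trail_cone s s) Q = lex_cone (trail_cone s' s') Q' \<Longrightarrow> s > 0 \<longleftrightarrow> s' > 0"
    using lex_mem(1) A(2) by metis
  show "lex_cone (lead_cone s s) Q \<noteq> lex_cone (trail_cone s' s') Q'" if "s' \<in> {1, - 1}"
    using lex_mem(1,2) A B opposite_sign[OF that] by metis
  show "t1 \<in> {1, - 1} \<Longrightarrow> lead_cone s0 s1 \<noteq> trail_cone t0 t1" using lead_trail by metis
  show "lead_cone s0 s1 = lead_cone t0 t1 \<Longrightarrow>
      s0 \<in> {1, - 1} \<Longrightarrow> s1 \<in> {1, - 1} \<Longrightarrow> t0 \<in> {1, - 1} \<Longrightarrow> t1 \<in> {1, - 1} \<Longrightarrow> s0 = t0 \<and> s1 = t1"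
    by (rule lead_lead) auto
  show "trail_cone s0 s1 = trail_cone t0 t1 \<Longrightarrow>
      s0 \<in> {1, - 1} \<Longrightarrow> s1 \<in> {1, - 1} \<Longrightarrow> t0 \<in> {1, - 1} \<Longrightarrow> t1 \<in> {1, - 1} \<Longrightarrow> s0 = t0 \<and> s1 = t1"
    by (rule trail_trail) auto
qed

lemma card_isolated_cones: "card isolated_cones = 8"
proof -
  define S where "S = {1, - 1 :: int} \<times> {1, - 1 :: int}"
  have "finite S" "card S = 4" by (simp_all add: S_def card_cartesian_product)
  have iso: "isolated_cones = case_prod lead_cone ` S \<union> case_prod trail_cone ` S"
    unfolding isolated_cones_def S_def by auto
  have "inj_on (case_prod lead_cone) S" "inj_on (case_prod trail_cone) S"
  proof (rule_tac [!] inj_onI)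
    fix x y assume S: "x \<in> S" "y \<in> S"
    then have *: "fst x \<in> {1, - 1}" "snd x \<in> {1, - 1}" "fst y \<in> {1, - 1}" "snd y \<in> {1, - 1}"
      by (auto simp: S_def)
    show "x = y" if "case_prod lead_cone x = case_prod lead_cone y"
      using lead_inject[OF _ *] that by (simp add: case_prod_beta prod_eq_iff)
    show "x = y" if "case_prod trail_cone x = case_prod trail_cone y"
      using trail_inject[OF _ *] that by (simp add: case_prod_beta prod_eq_iff)
  qed
  then have "card (case_prod lead_cone ` S) = 4" "card (case_prod trail_cone ` S) = 4"
    using \<open>card S = 4\<close> card_image by metis+
  moreover have "case_prod lead_cone ` S \<inter> case_prod trail_cone ` S = {}"
  proof (intro equalityI subsetI)
    fix P assume "P \<in> case_prod lead_cone ` S \<inter> case_prod trail_cone ` S"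
    then have "\<exists>x\<in>S. P = case_prod lead_cone x" "\<exists>y\<in>S. P = case_prod trail_cone y"
      by (simp_all only: Int_iff image_iff)
    then obtain x y where "y \<in> S" "P = case_prod lead_cone x" "P = case_prod trail_cone y" by metis
    then have "y \<in> S" "P = lead_cone (fst x) (snd x)" "P = trail_cone (fst y) (snd y)"
      by (simp_all add: case_prod_beta)
    moreover from this have "snd y \<in> {1, - 1}" by (auto simp: S_def)
    ultimately show "P \<in> {}" using lead_not_trail by metis
  qed simp
  ultimately show ?thesis unfolding iso using \<open>finite S\<close> by (simp add: card_Un_disjoint)
qed

subsection \<open>Topology of the space of bi-orderings\<close>

abbreviation cube :: "((real \<Rightarrow> real) \<Rightarrow> bool) topology" where
  "cube \<equiv> product_topology (\<lambda>_. discrete_topology (UNIV :: bool set)) thompsonF"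

lemma topspace_cube: "topspace cube = extensional thompsonF"
  by (simp add: PiE_UNIV_domain PiE_def)

lemma bool_discrete: "discrete_topology (UNIV :: bool set) = euclidean"
  by (rule topology_eq[THEN iffD2]) (simp add: open_discrete flip: open_openin)

lemma openin_cube_agree:
  assumes "finite T" shows "openin cube {x \<in> topspace cube. \<forall>f\<in>T. x (app f) = a f}"
  using assms
proof (induction T rule: finite_induct)
  case empty then show ?case using openin_topspace[of cube] by simp
next
  case (insert f T)
  have "continuous_map cube (discrete_topology UNIV) (\<lambda>x. x (app f))"
    by (rule continuous_map_product_projection) simp
  then have "openin cube {x \<in> topspace cube. x (app f) \<in> {a f}}"
    by (rule openin_continuous_map_preimage) simp
  then have "openin cube ({x \<in> topspace cube. x (app f) \<in> {a f}} \<inter> {x \<in> topspace cube. \<forall>f\<in>T. x (app f) = a f})"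
    using insert.IH by (rule openin_Int)
  also have "\<dots> = {x \<in> topspace cube. \<forall>f\<in>insert f T. x (app f) = a f}" by auto
  finally show ?case .
qed

text \<open>The finite set \<open>tests\<close> determines such a cone among all bi-orderings, so a
  basic open set of the cube meets the space in this point only.\<close>

lemma isolated_open:
  assumes P: "P \<in> isolated_cones" shows "openin BO_top {enc P}"
proof -
  obtain A B C1 C2 D where "separating A B C1 C2 D" using separating_exists by blast
  then interpret separating A B C1 C2 D .
  have "bi_cone P" using P unfolding bi_cone_classification isolated_cones_def by blast
  define U where "U = {x \<in> topspace cube. \<forall>f\<in>tests. x (app f) = enc P (app f)}"
  have "U \<inter> enc ` {C. bi_cone C} = {enc P}"
  proof (intro equalityI subsetI)
    fix x assume "x \<in> U \<inter> enc ` {C. bi_cone C}"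
    then obtain C where C: "x = enc C" "bi_cone C" "\<forall>f\<in>tests. f \<in> C \<longleftrightarrow> f \<in> P" unfolding U_def by auto
    then have "P = C" by (intro isolated_determined[OF P]) auto
    then show "x \<in> {enc P}" using C(1) by simp
  next
    fix x assume "x \<in> {enc P}"
    then show "x \<in> U \<inter> enc ` {C. bi_cone C}"
      using \<open>bi_cone P\<close> enc_extensional unfolding U_def topspace_cube by auto
  qed
  moreover have "openin cube U" unfolding U_def by (rule openin_cube_agree[OF tests(9)])
  ultimately show ?thesis unfolding BO_top_def chi_BO_F openin_subtopology by metis
qed

text \<open>\<open>r\<close> reads the signs of representatives \<open>w v\<close>, one for each
  pair of slope exponents, and \<open>s\<close> rebuilds the lexicographic cone from the signs on
  the lattice. Both are continuous, since each coordinate of the image depends on at most one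
  coordinate of the argument.\<close>

lemma lex_space_homeomorphic:
  assumes C: "bi_cone C"
  shows "subtopology BO_top (enc ` lex_cone C ` {Q. bi_cone Q}) homeomorphic_space top_of_set cantor_set"
proof -
  interpret C: bicone C by unfold_locales fact
  define L where "L = enc ` lex_cone C ` {Q. bi_cone Q}"
  have "L \<subseteq> enc ` {C. bi_cone C}" unfolding L_def using bi_cone_lex_cone[OF C] by blast
  then have sub: "subtopology BO_top L = subtopology cube L"
    unfolding BO_top_def chi_BO_F subtopology_subtopology by (simp add: inf_absorb2)
  \<comment> \<open>The pair 0 is represented by the neutral element, which lies in no cone, just as
    0 lies in no cone of the lattice.\<close>
  have "\<exists>f. (slope0 f, slope1 f) = v \<and> (v = 0 \<longrightarrow> f = 0)" for v
  proof (cases "v = 0")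
    case True then show ?thesis by (intro exI[of _ 0]) (simp add: zero_prod_def)
  next
    case False then show ?thesis using thompson_with_slopes[of "fst v" "snd v"] by (metis prod.collapse)
  qed
  then obtain w where w: "\<And>v. (slope0 (w v), slope1 (w v)) = v" "w 0 = 0" by metis
  define r where "r x n = (x (app (w (from_nat n))) :: bool)" for x :: "(real \<Rightarrow> real) \<Rightarrow> bool" and n
  define s where "s x = enc (lex_cone C {v. x (to_nat v)})" for x :: "nat \<Rightarrow> bool"
  have mem: "w v \<in> lex_cone C Q \<longleftrightarrow> v \<in> Q" if "bi_cone Q" for v Q
  proof -
    interpret Q: bicone Q by unfold_locales fact
    show ?thesis
      using w C.zero_notin Q.zero_notin by (cases "v = 0") (auto simp: lex_cone_def derived_iff_slopes simp flip: zero_prod_def)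
  qed
  have r_lex: "r (enc (lex_cone C Q)) = (\<lambda>n. from_nat n \<in> Q)" if "bi_cone Q" for Q
    using mem[OF that] by (simp add: r_def fun_eq_iff)
  have s_lat: "s (\<lambda>n. from_nat n \<in> Q) = enc (lex_cone C Q)" for Q by (simp add: s_def)
  have top: "topspace (subtopology cube L) = L"
    unfolding topspace_subtopology topspace_cube L_def using enc_extensional by blast
  have "homeomorphic_maps (subtopology cube L) (top_of_set lattice_orders) r s"
    unfolding homeomorphic_maps_def
  proof (intro conjI ballI)
    show "continuous_map (subtopology cube L) (top_of_set lattice_orders) r"
      unfolding continuous_map_in_subtopology
    proof
      have "continuous_map (subtopology cube L) euclidean (\<lambda>x. r x n)" for n
        unfolding r_def bool_discrete[symmetric]
        by (intro continuous_map_from_subtopology continuous_map_product_projection app_in_thompsonF)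
      then show "continuous_map (subtopology cube L) euclidean r"
        unfolding euclidean_product_topology[symmetric] continuous_map_componentwise_UNIV by blast
      show "r \<in> topspace (subtopology cube L) \<rightarrow> lattice_orders"
        unfolding top L_def lattice_orders_def using r_lex by auto
    qed
    show "continuous_map (top_of_set lattice_orders) (subtopology cube L) s"
      unfolding continuous_map_in_subtopology
    proof
      have "continuous_map (top_of_set lattice_orders) (discrete_topology UNIV) (\<lambda>x. s x y)" if y: "y \<in> thompsonF" for y
      proof -
        obtain f where f: "y = app f" using y by (rule thompsonF_E)
        have "continuous_on lattice_orders (\<lambda>x. s x y)"
        proof (cases "f \<in> derived")
          case True
          then show ?thesis by (simp add: s_def f lex_cone_def)
        next
          case False
          have "continuous_on lattice_orders (\<lambda>x. x (to_nat (slope0 f, slope1 f)))"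
            by (rule continuous_on_subset[OF continuous_on_product_coordinates]) simp
          then show ?thesis using False by (simp add: s_def f lex_cone_def)
        qed
        then show ?thesis unfolding bool_discrete by simp
      qed
      then show "continuous_map (top_of_set lattice_orders) cube s"
        unfolding continuous_map_componentwise using enc_extensional by (auto simp: s_def)
      show "s \<in> topspace (top_of_set lattice_orders) \<rightarrow> L"
        unfolding L_def lattice_orders_def using s_lat by auto
    qed
    show "s (r x) = x" if "x \<in> topspace (subtopology cube L)" for x
      using that r_lex s_lat unfolding top L_def by auto
    show "r (s x) = x" if "x \<in> topspace (top_of_set lattice_orders)" for x
      using that r_lex s_lat unfolding lattice_orders_def by auto
  qed
  then have "subtopology BO_top L homeomorphic_space top_of_set lattice_orders"
    unfolding sub homeomorphic_space_def by blast
  also have "top_of_set lattice_orders homeomorphic_space top_of_set cantor_set"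
  proof -
    obtain f g where "homeomorphism lattice_orders cantor_set f g"
      using lattice_orders_homeomorphic_cantor_set unfolding homeomorphic_def by blast
    then have "homeomorphic_maps (top_of_set lattice_orders) (top_of_set cantor_set) f g"
      unfolding homeomorphism_def homeomorphic_maps_def
      by (auto simp: continuous_map_in_subtopology image_subset_iff_funcset[symmetric])
    then show ?thesis unfolding homeomorphic_space_def by blast
  qed
  finally show ?thesis unfolding L_def .
qed

theorem theoremG:
  shows "chi ` BO_F = BO_Isol \<union> Lambda P_xm_plus \<union> Lambda P_xm_minus
                       \<union> Lambda P_xp_plus \<union> Lambda P_xp_minus
       \<and> card BO_Isol = 8
       \<and> BO_Isol \<inter> Lambda P_xm_plus = {} \<and> BO_Isol \<inter> Lambda P_xm_minus = {}
       \<and> BO_Isol \<inter> Lambda P_xp_plus = {} \<and> BO_Isol \<inter> Lambda P_xp_minus = {}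
       \<and> Lambda P_xm_plus \<inter> Lambda P_xm_minus = {} \<and> Lambda P_xm_plus \<inter> Lambda P_xp_plus = {}
       \<and> Lambda P_xm_plus \<inter> Lambda P_xp_minus = {} \<and> Lambda P_xm_minus \<inter> Lambda P_xp_plus = {}
       \<and> Lambda P_xm_minus \<inter> Lambda P_xp_minus = {} \<and> Lambda P_xp_plus \<inter> Lambda P_xp_minus = {}
       \<and> (\<forall>p \<in> BO_Isol. openin BO_top {p})
       \<and> subtopology BO_top (Lambda P_xm_plus) homeomorphic_space top_of_set cantor_set
       \<and> subtopology BO_top (Lambda P_xm_minus) homeomorphic_space top_of_set cantor_set
       \<and> subtopology BO_top (Lambda P_xp_plus) homeomorphic_space top_of_set cantor_set
       \<and> subtopology BO_top (Lambda P_xp_minus) homeomorphic_space top_of_set cantor_set"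
proof -
  have L: "Lambda P_xm_plus = enc ` lex_cone (lead_cone 1 1) ` {Q. bi_cone Q}"
    "Lambda P_xm_minus = enc ` lex_cone (lead_cone (- 1) (- 1)) ` {Q. bi_cone Q}"
    "Lambda P_xp_plus = enc ` lex_cone (trail_cone (- 1) (- 1)) ` {Q. bi_cone Q}"
    "Lambda P_xp_minus = enc ` lex_cone (trail_cone 1 1) ` {Q. bi_cone Q}"
    by (simp_all add: lead_sets trail_sets Lambda_eq)
  have disj: "enc ` \<A> \<inter> enc ` \<B> = {}" if "\<A> \<inter> \<B> = {}" for \<A> \<B>
    using that by (auto simp: enc_inject)
  have "chi ` BO_F = BO_Isol \<union> Lambda P_xm_plus \<union> Lambda P_xm_minus \<union> Lambda P_xp_plus \<union> Lambda P_xp_minus"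
  proof -
    have "{P. bi_cone P} = isolated_cones \<union> lex_cone (lead_cone 1 1) ` {Q. bi_cone Q}
      \<union> lex_cone (lead_cone (- 1) (- 1)) ` {Q. bi_cone Q} \<union> lex_cone (trail_cone (- 1) (- 1)) ` {Q. bi_cone Q}
      \<union> lex_cone (trail_cone 1 1) ` {Q. bi_cone Q}"
      unfolding set_eq_iff bi_cone_classification[where P = P for P] Un_iff mem_Collect_eq isolated_cones_def image_iff Bex_def by auto
    then show ?thesis unfolding chi_BO_F BO_Isol_eq L by (simp only: image_Un)
  qed
  moreover have "card BO_Isol = 8"
  proof -
    have "inj_on enc isolated_cones" by (rule inj_onI) (simp add: enc_inject)
    then show ?thesis unfolding BO_Isol_eq by (simp add: card_image card_isolated_cones)
  qed
  moreover have "BO_Isol \<inter> Lambda P_xm_plus = {}" "BO_Isol \<inter> Lambda P_xm_minus = {}"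
    "BO_Isol \<inter> Lambda P_xp_plus = {}" "BO_Isol \<inter> Lambda P_xp_minus = {}"
    unfolding BO_Isol_eq L using isolated_not_lex by (intro disj; blast)+
  moreover have "Lambda P_xm_plus \<inter> Lambda P_xm_minus = {}" "Lambda P_xp_plus \<inter> Lambda P_xp_minus = {}"
    unfolding L using lex_lead_sign[of 1 _ "- 1"] lex_trail_sign[of "- 1" _ 1] by (intro disj; force)+
  moreover have "Lambda P_xm_plus \<inter> Lambda P_xp_plus = {}" "Lambda P_xm_plus \<inter> Lambda P_xp_minus = {}"
    "Lambda P_xm_minus \<inter> Lambda P_xp_plus = {}" "Lambda P_xm_minus \<inter> Lambda P_xp_minus = {}"
    unfolding L using lex_lead_trail by (intro disj; blast)+
  moreover have "\<forall>p \<in> BO_Isol. openin BO_top {p}"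
    unfolding BO_Isol_eq using isolated_open by blast
  moreover have "subtopology BO_top (Lambda P_xm_plus) homeomorphic_space top_of_set cantor_set"
    "subtopology BO_top (Lambda P_xm_minus) homeomorphic_space top_of_set cantor_set"
    "subtopology BO_top (Lambda P_xp_plus) homeomorphic_space top_of_set cantor_set"
    "subtopology BO_top (Lambda P_xp_minus) homeomorphic_space top_of_set cantor_set"
    unfolding L by (intro lex_space_homeomorphic bi_cone_lead_cone bi_cone_trail_cone; simp)+
  ultimately show ?thesis by blast
qed

end
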